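(* The map \[ \theta^{(10)}:\mathfrak{stab}_{\mathfrak{Lie}(X)}(\Delta_Y)\to\mathfrak{stab}_{\mathfrak{Lie}(B)}(\tau),\qquad \psi+\lambda_1x_1+\lambda_0x_0\mapsto\theta(\psi)+\lambda_1b_1+\lambda_0b_0\quad(\psi\in\mathfrak{ls},\ \lambda_0,\lambda_1\in\mathbb{Q}), \] is an injective Lie algebra morphism from $(\mathfrak{stab}_{\mathfrak{Lie}(X)}(\Delta_Y),\{-,-\})$ to $(\mathfrak{stab}_{\mathfrak{Lie}(B)}(\tau),\{-,-\}_A)$.
   Context: Setting X/Y: $\mathbb{Q}\langle X\rangle$ is the free associative $\mathbb{Q}$-algebra on $X=\{x_0,x_1\}$ with coproduct $\Delta_X(x_i)=x_i\otimes1+1\otimes x_i$ (algebra morphism); $\mathfrak{Lie}(X)$ is the free Lie algebra on $X$ (= $\Delta_X$-primitives). $\mathbb{Q}\langle Y\rangle$ is the free associative algebra on $Y=\{y_1,y_2,\dots\}$ with $\Delta_Y(y_n)=y_n\otimes1+1\otimes y_n$. Identify $\mathbb{Q}\langle Y\rangle\subset\mathbb{Q}\langle X\rangle$ via $y_n\mapsto x_0^{n-1}x_1$; $\pi_Y:\mathbb{Q}\langle X\rangle\to\mathbb{Q}\langle Y\rangle$ sends $x_0^{k_1-1}x_1\cdots x_0^{k_d-1}x_1x_0^r$ to $y_{k_1}\cdots y_{k_d}$ if $r=0$, to $0$ otherwise. $(\psi\mid w)$ is the coefficient of a word $w$ in $\psi$. For $\psi\in\mathbb{Q}\langle X\rangle$,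 $d_\psi$ is the derivation with $d_\psi(x_0)=0$, $d_\psi(x_1)=[x_1,\psi]$; the Ihara bracket $\{\psi_1,\psi_2\}=d_{\psi_1}(\psi_2)-d_{\psi_2}(\psi_1)+[\psi_1,\psi_2]$ is a Lie bracket on $\mathfrak{Lie}(X)$. For $\psi\in\mathfrak{Lie}(X)$, $s_\psi=\ell_\psi+d_\psi$ ($\ell_\psi$ = left multiplication) preserves $\mathbb{Q}\langle X\rangle x_0$, and $s^Y_\psi$ is the unique linear endomorphism of $\mathbb{Q}\langle Y\rangle$ with $\pi_Y\circ s_\psi=s^Y_\psi\circ\pi_Y$. $\mathfrak{stab}_{\mathfrak{Lie}(X)}(\Delta_Y)=\{\psi\in\mathfrak{Lie}(X)\mid(s^Y_\psi\otimes\mathrm{id}+\mathrm{id}\otimes s^Y_\psi)\circ\Delta_Y=\Delta_Y\circ s^Y_\psi\}$. $\mathfrak{ls}$ is the set of $\psi\in\mathbb{Q}\langle X\rangle$ with $(\psi\mid x_0)=(\psi\mid x_1)=0$, $\psi$ $\Delta_X$-primitive, $\pi_Y(\psi)$ $\Delta_Y$-primitive, and $(\psi\mid x_0^{n-1}x_1)=0$ for even $n\ge2$. Setting B: $\mathbb{Q}\langle B\rangle$ is the free algebra on $B=\{b_0,b_1,\dots\}$ with $\Delta_B(b_i)=b_i\otimes1+1\otimes b_i$; $\mathfrak{Lie}(B)$ its primitives. $\mathbb{Q}\langle B\rangle^0$ is the span (and subalgebra) of words not ending in $b_0$, $\pi_0$ the projection killing words ending in $b_0$. For a word $w=b_0^{m_1}b_{k_1}\cdots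 b_0^{m_d}b_{k_d}b_0^{m_{d+1}}$ ($d\ge1$), $\mathbf{k}=(k_1,\dots,k_d)$, $\mathbf{l}\in\mathbb{Z}_{>0}^d$, $w(\mathbf{l})$ replaces each $b_{k_i}$ by $b_{l_i}$; $\partial_w$ is the derivation with $\partial_w(b_0)=0$, $\partial_w(b_i)=\sum_{\mathbf{l}\le\mathbf{k}}(-1)^{|\mathbf{k}|+|\mathbf{l}|}\prod_j\binom{k_j-1}{l_j-1}[b_{i+|\mathbf{k}|-|\mathbf{l}|},w(\mathbf{l})]$ ($i\ge1$, $|\mathbf{k}|=\sum k_j$, $\mathbf{l}\le\mathbf{k}$ componentwise); for $w=b_0^m$, $\partial_w(b_0)=0$, $\partial_w(b_i)=[b_i,w]$; extend linearly in $w$. $\{\psi_1,\psi_2\}_A=\partial_{\psi_1}(\psi_2)-\partial_{\psi_2}(\psi_1)+[\psi_1,\psi_2]$ is a Lie bracket on $\mathfrak{Lie}(B)$. For $\psi\in\mathfrak{Lie}(B)$, $\sigma_\psi=\ell_\psi+\partial_\psi$ preserves $\mathbb{Q}\langle B\rangle b_0$ and induces $\sigma^0_\psi$ on $\mathbb{Q}\langle B\rangle^0$ with $\pi_0\circ\sigma_\psi=\sigma^0_\psi\circ\pi_0$. $\tau$ is the algebra antiautomorphism of $\mathbb{Q}\langle B\rangle^0$ with $\tau(b_0^mb_k)=b_0^{k-1}b_{m+1}$. $\mathfrak{stab}_{\mathfrak{Lie}(B)}(\tau)=\{\psi\in\mathfrak{Lie}(B)\mid\sigma^0_\psi\circ\tau=\tau\circ\sigma^0_\psi\}$.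 $\mathfrak{lq}$ is the set of $\psi\in\mathbb{Q}\langle B\rangle$ with $(\psi\mid b_0)=0$, $\psi$ $\Delta_B$-primitive, $\tau(\pi_0(\psi))=\pi_0(\psi)$, and $(\psi\mid b_0^mb_k)=0$ whenever $k+m$ is even. Known facts used: $\mathfrak{stab}_{\mathfrak{Lie}(X)}(\Delta_Y)=\mathfrak{ls}\oplus\mathbb{Q}x_1\oplus\mathbb{Q}x_0$ and $\mathfrak{stab}_{\mathfrak{Lie}(B)}(\tau)=\mathfrak{lq}\oplus\mathbb{Q}b_0$ (direct sums); $\mathfrak{ls}$ and $\mathfrak{lq}$ are Lie subalgebras. Let $\theta_X:\mathbb{Q}\langle X\rangle\to\mathbb{Q}\langle B\rangle$ be the algebra morphism $x_i\mapsto b_i$ ($i=0,1$), $\theta_Y:\mathbb{Q}\langle Y\rangle\to\mathbb{Q}\langle B\rangle^0$ the algebra antimorphism $y_n\mapsto b_n$, and $\theta(\psi)=\theta_X(\psi)+\theta_Y(\pi_Y(\psi))$; it is known that $\theta$ is an injective Lie algebra morphism $(\mathfrak{ls},\{-,-\})\to(\mathfrak{lq},\{-,-\}_A)$. *)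

theory Defs
  imports Complex_Main "HOL-Library.Poly_Mapping" "HOL-Library.Product_Plus"
begin

text \<open>
  Words form a monoid under concatenation, written additively because the type of finitely
  supported functions takes its convolution product from an additive monoid. Hence
  \<open>'a list \<Rightarrow>\<^sub>0 rat\<close> is the free associative algebra on \<open>'a\<close>. Its tensor square is the
  monoid algebra of the product monoid, with \<open>(u, v)\<close> standing for \<open>u \<otimes> v\<close>.
\<close>

instantiation list :: (type) monoid_add
begin

definition zero_list_def: "0 = []"
definition plus_list_def: "xs + ys = xs @ ys"

instance
  by standard (simp_all add: zero_list_def plus_list_def)

end

type_synonym 'a free_alg = "'a list \<Rightarrow>\<^sub>0 rat"
type_synonym 'a free_alg2 = "('a list \<times> 'a list) \<Rightarrow>\<^sub>0 rat"

definition scale :: "rat \<Rightarrow> ('m \<Rightarrow>\<^sub>0 rat) \<Rightarrow> ('m \<Rightarrow>\<^sub>0 rat)" (infixr "*\<^sub>Q" 75)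
  where "c *\<^sub>Q f = Poly_Mapping.map ((*) c) f"

abbreviation mon :: "'m \<Rightarrow> 'm \<Rightarrow>\<^sub>0 rat"
  where "mon w \<equiv> Poly_Mapping.single w 1"

abbreviation letter :: "'a \<Rightarrow> 'a free_alg"
  where "letter a \<equiv> mon [a]"

definition lin_ext :: "('m \<Rightarrow> ('n \<Rightarrow>\<^sub>0 rat)) \<Rightarrow> ('m \<Rightarrow>\<^sub>0 rat) \<Rightarrow> ('n \<Rightarrow>\<^sub>0 rat)"
  where "lin_ext g f = (\<Sum>w\<in>Poly_Mapping.keys f. Poly_Mapping.lookup f w *\<^sub>Q g w)"

definition alg_hom :: "('a \<Rightarrow> ('m::monoid_add \<Rightarrow>\<^sub>0 rat)) \<Rightarrow> 'a free_alg \<Rightarrow> ('m \<Rightarrow>\<^sub>0 rat)"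
  where "alg_hom g = lin_ext (\<lambda>w. prod_list (map g w))"

definition alg_antihom :: "('a \<Rightarrow> ('m::monoid_add \<Rightarrow>\<^sub>0 rat)) \<Rightarrow> 'a free_alg \<Rightarrow> ('m \<Rightarrow>\<^sub>0 rat)"
  where "alg_antihom g = lin_ext (\<lambda>w. prod_list (map g (rev w)))"

primrec der_word :: "('a \<Rightarrow> 'a free_alg) \<Rightarrow> 'a list \<Rightarrow> 'a free_alg"
  where
    "der_word g [] = 0"
  | "der_word g (a # w) = g a * mon w + letter a * der_word g w"

definition derivation :: "('a \<Rightarrow> 'a free_alg) \<Rightarrow> 'a free_alg \<Rightarrow> 'a free_alg"
  where "derivation g = lin_ext (der_word g)"

definition comm :: "'a free_alg \<Rightarrow> 'a free_alg \<Rightarrow> 'a free_alg"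
  where "comm f g = f * g - g * f"

definition tensor :: "'a free_alg \<Rightarrow> 'a free_alg \<Rightarrow> 'a free_alg2"  (infixr "\<otimes>" 72)
  where "f \<otimes> g = lin_ext (\<lambda>u. lin_ext (\<lambda>v. mon (u, v)) g) f"

definition tensor_map ::
    "('a free_alg \<Rightarrow> 'a free_alg) \<Rightarrow> ('a free_alg \<Rightarrow> 'a free_alg) \<Rightarrow> 'a free_alg2 \<Rightarrow> 'a free_alg2"
  where "tensor_map S T = lin_ext (\<lambda>(u, v). S (mon u) \<otimes> T (mon v))"

text \<open>All three alphabets consist of primitive letters, so one coproduct serves for
  \<open>\<Delta>\<^sub>X\<close>, \<open>\<Delta>\<^sub>Y\<close> and \<open>\<Delta>\<^sub>B\<close>.\<close>

definition coprod :: "'a free_alg \<Rightarrow> 'a free_alg2"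
  where "coprod = alg_hom (\<lambda>a. letter a \<otimes> 1 + 1 \<otimes> letter a)"

definition primitive :: "'a free_alg \<Rightarrow> bool"
  where "primitive f \<longleftrightarrow> coprod f = f \<otimes> 1 + 1 \<otimes> f"

definition Lie :: "'a free_alg set"
  where "Lie = {f. primitive f}"

definition lie_algebra_on ::
    "('m \<Rightarrow>\<^sub>0 rat) set \<Rightarrow> (('m \<Rightarrow>\<^sub>0 rat) \<Rightarrow> ('m \<Rightarrow>\<^sub>0 rat) \<Rightarrow> ('m \<Rightarrow>\<^sub>0 rat)) \<Rightarrow> bool"
  where "lie_algebra_on V br \<longleftrightarrow>
     module.subspace (*\<^sub>Q) V \<and>
     (\<forall>f\<in>V. \<forall>g\<in>V. br f g \<in> V) \<and>
     (\<forall>f\<in>V. \<forall>g\<in>V. \<forall>h\<in>V. br (f + g) h = br f h + br g h \<and> br h (f + g) = br h f + br h g) \<and>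
     (\<forall>c. \<forall>f\<in>V. \<forall>g\<in>V. br (c *\<^sub>Q f) g = c *\<^sub>Q br f g \<and> br f (c *\<^sub>Q g) = c *\<^sub>Q br f g) \<and>
     (\<forall>f\<in>V. br f f = 0) \<and>
     (\<forall>f\<in>V. \<forall>g\<in>V. \<forall>h\<in>V. br f (br g h) + br g (br h f) + br h (br f g) = 0)"

definition lie_hom_on ::
    "('m \<Rightarrow>\<^sub>0 rat) set \<Rightarrow> (('m \<Rightarrow>\<^sub>0 rat) \<Rightarrow> ('m \<Rightarrow>\<^sub>0 rat) \<Rightarrow> ('m \<Rightarrow>\<^sub>0 rat)) \<Rightarrow>
     ('n \<Rightarrow>\<^sub>0 rat) set \<Rightarrow> (('n \<Rightarrow>\<^sub>0 rat) \<Rightarrow> ('n \<Rightarrow>\<^sub>0 rat) \<Rightarrow> ('n \<Rightarrow>\<^sub>0 rat)) \<Rightarrow>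
     (('m \<Rightarrow>\<^sub>0 rat) \<Rightarrow> ('n \<Rightarrow>\<^sub>0 rat)) \<Rightarrow> bool"
  where "lie_hom_on V br W br' F \<longleftrightarrow>
     lie_algebra_on V br \<and> lie_algebra_on W br' \<and>
     (\<forall>f\<in>V. F f \<in> W) \<and>
     (\<forall>f\<in>V. \<forall>g\<in>V. F (f + g) = F f + F g) \<and>
     (\<forall>c. \<forall>f\<in>V. F (c *\<^sub>Q f) = c *\<^sub>Q F f) \<and>
     (\<forall>f\<in>V. \<forall>g\<in>V. F (br f g) = br' (F f) (F g))"

datatype xletter = X0 | X1

typedef yletter = "{n::nat. 1 \<le> n}"
  morphisms yindex Y
  by auto

text \<open>The inclusion of Y-words into X-words, \<open>y\<^sub>n \<mapsto> x\<^sub>0\<^bsup>n-1\<^esup> x\<^sub>1\<close>. It is injective, and its image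
  consists of the words that do not end in \<open>x\<^sub>0\<close>.\<close>

definition yx :: "yletter list \<Rightarrow> xletter list"
  where "yx v = concat (map (\<lambda>y. replicate (yindex y - 1) X0 @ [X1]) v)"

definition pi_Y :: "xletter free_alg \<Rightarrow> yletter free_alg"
  where "pi_Y = lin_ext (\<lambda>w. if w \<in> range yx then mon (inv yx w) else 0)"

definition d_der :: "xletter free_alg \<Rightarrow> xletter free_alg \<Rightarrow> xletter free_alg"
  where "d_der \<psi> = derivation (\<lambda>a. case a of X0 \<Rightarrow> 0 | X1 \<Rightarrow> comm (letter X1) \<psi>)"

definition ihara :: "xletter free_alg \<Rightarrow> xletter free_alg \<Rightarrow> xletter free_alg"
  where "ihara \<psi>1 \<psi>2 = d_der \<psi>1 \<psi>2 - d_der \<psi>2 \<psi>1 + comm \<psi>1 \<psi>2"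

definition s_map :: "xletter free_alg \<Rightarrow> xletter free_alg \<Rightarrow> xletter free_alg"
  where "s_map \<psi> f = \<psi> * f + d_der \<psi> f"

definition sY :: "xletter free_alg \<Rightarrow> yletter free_alg \<Rightarrow> yletter free_alg"
  where "sY \<psi> = (THE S. Vector_Spaces.linear (*\<^sub>Q) (*\<^sub>Q) S \<and> pi_Y \<circ> s_map \<psi> = S \<circ> pi_Y)"

definition stab_DeltaY :: "xletter free_alg set"
  where "stab_DeltaY = {\<psi>\<in>Lie. \<forall>f. tensor_map (sY \<psi>) id (coprod f) + tensor_map id (sY \<psi>) (coprod f)
                                  = coprod (sY \<psi> f)}"

definition ls :: "xletter free_alg set"
  where "ls = {\<psi>. Poly_Mapping.lookup \<psi> [X0] = 0 \<and> Poly_Mapping.lookup \<psi> [X1] = 0 \<and>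
                  primitive \<psi> \<and> primitive (pi_Y \<psi>) \<and>
                  (\<forall>n\<ge>2. even n \<longrightarrow> Poly_Mapping.lookup \<psi> (replicate (n - 1) X0 @ [X1]) = 0)}"

text \<open>The letter \<open>b\<^sub>i\<close> is the natural number \<open>i\<close>.\<close>

definition QB0 :: "nat free_alg set"
  where "QB0 = {f. \<forall>w\<in>Poly_Mapping.keys f. w = [] \<or> last w \<noteq> 0}"

definition pi_0 :: "nat free_alg \<Rightarrow> nat free_alg"
  where "pi_0 = lin_ext (\<lambda>w. if w \<noteq> [] \<and> last w = 0 then 0 else mon w)"

text \<open>
  \<open>lowerings w\<close> is the set of all words \<open>w(l)\<close> with \<open>1 \<le> l \<le> k\<close>, where \<open>k\<close> is the
  sequence of nonzero letters of \<open>w\<close>: the letters \<open>b\<^sub>0\<close> stay in place and each letter \<open>b\<^sub>k\<close> with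
  \<open>k \<ge> 1\<close> becomes some \<open>b\<^sub>l\<close> with \<open>1 \<le> l \<le> k\<close>. Then \<open>|k| = sum_list w\<close> and
  \<open>|l| = sum_list v\<close> for \<open>v = w(l)\<close>. If \<open>w = b\<^sub>0\<^sup>m\<close>, then \<open>lowerings w = {w}\<close>, and
  \<open>del_gen w i = [b\<^sub>i, w]\<close> for \<open>i \<ge> 1\<close>.
\<close>

definition lowerings :: "nat list \<Rightarrow> nat list set"
  where "lowerings w = {v. list_all2 (\<lambda>l k. if k = 0 then l = 0 else 1 \<le> l \<and> l \<le> k) v w}"

definition lowering_coeff :: "nat list \<Rightarrow> nat list \<Rightarrow> rat"
  where "lowering_coeff w v = (- 1) ^ (sum_list w + sum_list v) *
     (\<Prod>(k, l)\<leftarrow>zip w v. if k = 0 then 1 else of_nat ((k - 1) choose (l - 1)))"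

definition del_gen :: "nat list \<Rightarrow> nat \<Rightarrow> nat free_alg"
  where "del_gen w i = (if i = 0 then 0 else
     (\<Sum>v\<in>lowerings w. lowering_coeff w v *\<^sub>Q comm (letter (i + sum_list w - sum_list v)) (mon v)))"

definition del :: "nat free_alg \<Rightarrow> nat free_alg \<Rightarrow> nat free_alg"
  where "del \<psi> f = lin_ext (\<lambda>w. derivation (del_gen w) f) \<psi>"

definition bracket_A :: "nat free_alg \<Rightarrow> nat free_alg \<Rightarrow> nat free_alg"
  where "bracket_A \<psi>1 \<psi>2 = del \<psi>1 \<psi>2 - del \<psi>2 \<psi>1 + comm \<psi>1 \<psi>2"

definition sigma :: "nat free_alg \<Rightarrow> nat free_alg \<Rightarrow> nat free_alg"
  where "sigma \<psi> f = \<psi> * f + del \<psi> f"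

text \<open>As \<open>\<pi>\<^sub>0\<close> is the identity on \<open>QB0\<close>, the relation \<open>\<pi>\<^sub>0 \<circ> \<sigma>\<^sub>\<psi> = \<sigma>\<^sup>0\<^sub>\<psi> \<circ> \<pi>\<^sub>0\<close> forces this value on
  \<open>QB0\<close>; that the relation does hold is lemma \<open>pi_0_sigma\<close>.\<close>

definition sigma0 :: "nat free_alg \<Rightarrow> nat free_alg \<Rightarrow> nat free_alg"
  where "sigma0 \<psi> f = pi_0 (sigma \<psi> f)"

text \<open>\<open>QB0\<close> is free on the words \<open>block (m, j) = b\<^sub>0\<^sup>m b\<^bsub>j+1\<^esub>\<close>, and \<open>\<tau>\<close> sends this generator
  to \<open>b\<^sub>0\<^sup>j b\<^bsub>m+1\<^esub> = block (j, m)\<close>.\<close>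

definition block :: "nat \<times> nat \<Rightarrow> nat list"
  where "block = (\<lambda>(m, j). replicate m 0 @ [Suc j])"

definition blocks :: "(nat \<times> nat) list \<Rightarrow> nat list"
  where "blocks ps = concat (map block ps)"

definition tau :: "nat free_alg \<Rightarrow> nat free_alg"
  where "tau = lin_ext (\<lambda>w. if w \<in> range blocks
                            then mon (blocks (map prod.swap (rev (inv blocks w)))) else 0)"

definition stab_tau :: "nat free_alg set"
  where "stab_tau = {\<psi>\<in>Lie. \<forall>f\<in>QB0. sigma0 \<psi> (tau f) = tau (sigma0 \<psi> f)}"

definition theta_X :: "xletter free_alg \<Rightarrow> nat free_alg"
  where "theta_X = alg_hom (\<lambda>a. case a of X0 \<Rightarrow> letter 0 | X1 \<Rightarrow> letter 1)"

definition theta_Y :: "yletter free_alg \<Rightarrow> nat free_alg"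
  where "theta_Y = alg_antihom (\<lambda>y. letter (yindex y))"

definition theta :: "xletter free_alg \<Rightarrow> nat free_alg"
  where "theta \<psi> = theta_X \<psi> + theta_Y (pi_Y \<psi>)"

text \<open>The decomposition is unique, because elements of \<open>ls\<close> have no coefficient at \<open>x\<^sub>0\<close>
  and \<open>x\<^sub>1\<close> (lemma \<open>theta10_eq\<close>).\<close>

definition theta10 :: "xletter free_alg \<Rightarrow> nat free_alg"
  where "theta10 f = (THE g. \<exists>\<psi>\<in>ls. \<exists>c1 c0.
            f = \<psi> + c1 *\<^sub>Q letter X1 + c0 *\<^sub>Q letter X0 \<and>
            g = theta \<psi> + c1 *\<^sub>Q letter 1 + c0 *\<^sub>Q letter 0)"

lemma lookup_scale [simp]: "Poly_Mapping.lookup (c *\<^sub>Q f) w = c * Poly_Mapping.lookup f w"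
  by (simp add: scale_def Poly_Mapping.map.rep_eq when_def)

lemma vector_space_scale: "vector_space ((*\<^sub>Q) :: rat \<Rightarrow> ('m \<Rightarrow>\<^sub>0 rat) \<Rightarrow> _)"
  by standard (simp_all add: poly_mapping_eq_iff fun_eq_iff lookup_add algebra_simps)

interpretation Qvs: vector_space "(*\<^sub>Q) :: rat \<Rightarrow> ('m \<Rightarrow>\<^sub>0 rat) \<Rightarrow> _"
  by (rule vector_space_scale)

lemma lin_ext_superset:
  assumes "finite A" "Poly_Mapping.keys f \<subseteq> A"
  shows "lin_ext g f = (\<Sum>w\<in>A. Poly_Mapping.lookup f w *\<^sub>Q g w)"
  unfolding lin_ext_def
  by (rule sum.mono_neutral_left) (use assms in \<open>auto simp: in_keys_iff\<close>)

lemma lin_ext_add: "lin_ext g (f + f') = lin_ext g f + lin_ext g f'"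
proof -
  let ?A = "Poly_Mapping.keys f \<union> Poly_Mapping.keys f'"
  have "lin_ext g h = (\<Sum>w\<in>?A. Poly_Mapping.lookup h w *\<^sub>Q g w)"
    if "h \<in> {f + f', f, f'}" for h
    by (rule lin_ext_superset) (use that keys_add[of f f'] in auto)
  then show ?thesis
    by (simp add: lookup_add Qvs.scale_left_distrib sum.distrib)
qed

lemma lin_ext_scale: "lin_ext g (c *\<^sub>Q f) = c *\<^sub>Q lin_ext g f"
proof -
  have "lin_ext g (c *\<^sub>Q f) = (\<Sum>w\<in>Poly_Mapping.keys f. Poly_Mapping.lookup (c *\<^sub>Q f) w *\<^sub>Q g w)"
    by (rule lin_ext_superset) (auto simp: in_keys_iff)
  then show ?thesis
    by (simp add: lin_ext_def Qvs.scale_sum_right)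
qed

lemma linear_lin_ext: "Vector_Spaces.linear (*\<^sub>Q) (*\<^sub>Q) (lin_ext g)"
  by (simp add: Vector_Spaces.linear_iff vector_space_scale lin_ext_add lin_ext_scale)

lemma lin_ext_mon [simp]: "lin_ext g (mon w) = g w"
  by (simp add: lin_ext_def)

lemma lin_ext_id [simp]: "lin_ext mon f = f"
proof (rule poly_mapping_eqI)
  fix w
  have "Poly_Mapping.lookup (lin_ext mon f) w =
      (\<Sum>v\<in>Poly_Mapping.keys f. if v = w then Poly_Mapping.lookup f v else 0)"
    unfolding lin_ext_def lookup_sum lookup_scale lookup_single
    by (intro sum.cong) (auto simp: when_def)
  then show "Poly_Mapping.lookup (lin_ext mon f) w = Poly_Mapping.lookup f w"
    by (simp add: in_keys_iff)
qed

lemma linear_eq_lin_ext: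
  assumes "Vector_Spaces.linear (*\<^sub>Q) (*\<^sub>Q) S"
  shows "S f = lin_ext (\<lambda>w. S (mon w)) f"
proof -
  interpret S: Vector_Spaces.linear "(*\<^sub>Q)" "(*\<^sub>Q)" S by fact
  have "S f = S (lin_ext mon f)" by simp
  then show ?thesis by (simp only: lin_ext_def S.sum S.scale)
qed

lemma linear_eqI:
  assumes "Vector_Spaces.linear (*\<^sub>Q) (*\<^sub>Q) S" "Vector_Spaces.linear (*\<^sub>Q) (*\<^sub>Q) T"
    and "\<And>w. S (mon w) = T (mon w)"
  shows "S f = T f"
  unfolding linear_eq_lin_ext[OF assms(1), of f] linear_eq_lin_ext[OF assms(2), of f]
  by (simp only: assms(3))

lemma scale_mult_left: "(c *\<^sub>Q f) * g = c *\<^sub>Q (f * (g :: 'm::monoid_add \<Rightarrow>\<^sub>0 rat))"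
  by (simp add: scale_def mult_map_scale_conv_mult mult.assoc)

lemma scale_mult_right: "f * (c *\<^sub>Q g) = c *\<^sub>Q (f * (g :: 'm::monoid_add \<Rightarrow>\<^sub>0 rat))"
proof -
  have "f * Poly_Mapping.single 0 c = Poly_Mapping.single 0 c * f"
  proof -
    have L: "Vector_Spaces.linear (*\<^sub>Q) (*\<^sub>Q) (\<lambda>f :: 'm \<Rightarrow>\<^sub>0 rat. Poly_Mapping.single 0 c * f)"
      by (simp add: Vector_Spaces.linear_iff vector_space_scale mult_map_scale_conv_mult[symmetric]
            scale_def[symmetric] Qvs.scale_right_distrib mult.commute)
    have R: "Vector_Spaces.linear (*\<^sub>Q) (*\<^sub>Q) (\<lambda>f :: 'm \<Rightarrow>\<^sub>0 rat. f * Poly_Mapping.single 0 c)"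
      by (simp add: Vector_Spaces.linear_iff vector_space_scale scale_mult_left distrib_right)
    show ?thesis
      by (rule linear_eqI[OF R L]) (simp add: mult_single)
  qed
  then show ?thesis
    by (simp add: scale_def mult_map_scale_conv_mult mult.assoc[symmetric])
qed

lemma linear_mult_left: "Vector_Spaces.linear (*\<^sub>Q) (*\<^sub>Q) (\<lambda>f :: 'm::monoid_add \<Rightarrow>\<^sub>0 rat. g * f)"
  by (simp add: Vector_Spaces.linear_iff vector_space_scale scale_mult_right distrib_left)

lemma linear_mult_right: "Vector_Spaces.linear (*\<^sub>Q) (*\<^sub>Q) (\<lambda>f :: 'm::monoid_add \<Rightarrow>\<^sub>0 rat. f * g)"
  by (simp add: Vector_Spaces.linear_iff vector_space_scale scale_mult_left distrib_right)

lemma linear_comp: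
  assumes "Vector_Spaces.linear (*\<^sub>Q) (*\<^sub>Q) S" "Vector_Spaces.linear (*\<^sub>Q) (*\<^sub>Q) T"
  shows "Vector_Spaces.linear (*\<^sub>Q) (*\<^sub>Q) (\<lambda>f. S (T f))"
  using assms by (simp add: Vector_Spaces.linear_iff)

lemma linear_add:
  assumes "Vector_Spaces.linear (*\<^sub>Q) (*\<^sub>Q) S" "Vector_Spaces.linear (*\<^sub>Q) (*\<^sub>Q) T"
  shows "Vector_Spaces.linear (*\<^sub>Q) (*\<^sub>Q) (\<lambda>f. S f + T f)"
  using assms by (simp add: Vector_Spaces.linear_iff Qvs.scale_right_distrib algebra_simps)

lemma bilinear_eqI:
  assumes "\<And>g. Vector_Spaces.linear (*\<^sub>Q) (*\<^sub>Q) (\<lambda>f. S f g)"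
    "\<And>g. Vector_Spaces.linear (*\<^sub>Q) (*\<^sub>Q) (\<lambda>f. T f g)"
    "\<And>u. Vector_Spaces.linear (*\<^sub>Q) (*\<^sub>Q) (S (mon u))"
    "\<And>u. Vector_Spaces.linear (*\<^sub>Q) (*\<^sub>Q) (T (mon u))"
    and "\<And>u v. S (mon u) (mon v) = T (mon u) (mon v)"
  shows "S f g = T f g"
proof -
  have "S (mon u) g = T (mon u) g" for u
    by (rule linear_eqI[OF assms(3,4,5)])
  then show ?thesis
    by (rule linear_eqI[OF assms(1,2)])
qed

lemma mon_append: "mon (u @ v) = mon u * mon v"
  by (simp add: mult_single plus_list_def)

lemma mon_Nil: "mon [] = (1 :: 'a free_alg)"
  by (simp flip: zero_list_def)

lemma alg_hom_one: "alg_hom g 1 = 1"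
  by (simp add: alg_hom_def flip: mon_Nil)

lemma alg_hom_letter: "alg_hom g (letter a) = g a"
  by (simp add: alg_hom_def)

lemma linear_alg_hom: "Vector_Spaces.linear (*\<^sub>Q) (*\<^sub>Q) (alg_hom g)"
  by (simp add: alg_hom_def linear_lin_ext)

lemma alg_hom_mult: "alg_hom g (f * h) = alg_hom g f * alg_hom g h"
proof (rule bilinear_eqI[where S = "\<lambda>f h. alg_hom g (f * h)"
      and T = "\<lambda>f h. alg_hom g f * alg_hom g h"])
  show "alg_hom g (mon u * mon v) = alg_hom g (mon u) * alg_hom g (mon v)" for u v
    unfolding mon_append[symmetric] by (simp add: alg_hom_def)
qed (rule linear_comp[OF linear_alg_hom linear_mult_right]
      linear_comp[OF linear_mult_right linear_alg_hom]
      linear_comp[OF linear_alg_hom linear_mult_left]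
      linear_comp[OF linear_mult_left linear_alg_hom])+

lemma linear_alg_antihom: "Vector_Spaces.linear (*\<^sub>Q) (*\<^sub>Q) (alg_antihom g)"
  by (simp add: alg_antihom_def linear_lin_ext)

lemma alg_antihom_mult: "alg_antihom g (f * h) = alg_antihom g h * alg_antihom g f"
proof (rule bilinear_eqI[where S = "\<lambda>f h. alg_antihom g (f * h)"
      and T = "\<lambda>f h. alg_antihom g h * alg_antihom g f"])
  show "alg_antihom g (mon u * mon v) = alg_antihom g (mon v) * alg_antihom g (mon u)" for u v
    unfolding mon_append[symmetric] by (simp add: alg_antihom_def)
qed (rule linear_comp[OF linear_alg_antihom linear_mult_right]
      linear_comp[OF linear_mult_left linear_alg_antihom]
      linear_comp[OF linear_alg_antihom linear_mult_left]
      linear_comp[OF linear_mult_right linear_alg_antihom])+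

lemma der_word_append: "der_word g (u @ v) = der_word g u * mon v + mon u * der_word g v"
proof (induction u)
  case Nil
  then show ?case by (simp add: mon_Nil)
next
  case (Cons a u)
  have "mon (a # u) = letter a * mon u"
    using mon_append[of "[a]" u] by simp
  then show ?case
    by (simp only: append_Cons der_word.simps Cons.IH mon_append distrib_left distrib_right
        mult.assoc add.assoc)
qed

lemma derivation_letter: "derivation g (letter a) = g a"
  by (simp add: derivation_def mon_Nil)

lemma linear_derivation: "Vector_Spaces.linear (*\<^sub>Q) (*\<^sub>Q) (derivation g)"
  by (simp add: derivation_def linear_lin_ext)

lemma derivation_mult: "derivation g (f * h) = derivation g f * h + f * derivation g h"
proof (rule bilinear_eqI[where S = "\<lambda>f h. derivation g (f * h)"
      and T = "\<lambda>f h. derivation g f * h + f * derivation g h"])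
  show "derivation g (mon u * mon v) = derivation g (mon u) * mon v + mon u * derivation g (mon v)"
    for u v
    unfolding mon_append[symmetric] by (simp add: derivation_def der_word_append)
qed (rule linear_comp[OF linear_derivation linear_mult_right]
      linear_comp[OF linear_derivation linear_mult_left]
      linear_add[OF linear_comp[OF linear_mult_right linear_derivation] linear_mult_right]
      linear_add[OF linear_mult_left linear_comp[OF linear_mult_left linear_derivation]])+

lemma tensor_mon: "mon u \<otimes> mon v = mon (u, v)"
  by (simp add: tensor_def)

lemma yx_Nil [simp]: "yx [] = []"
  by (simp add: yx_def)

lemma yx_Cons: "yx (y # v) = replicate (yindex y - 1) X0 @ X1 # yx v"
  by (simp add: yx_def)

lemma replicate_sep_inject:
  assumes "replicate m a @ b # u = replicate n a @ c # v" "b \<noteq> a" "c \<noteq> a"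
  shows "m = n \<and> b = c \<and> u = v"
  using assms
proof (induction m arbitrary: n)
  case 0
  then show ?case by (cases n) auto
next
  case (Suc m)
  then show ?case by (cases n) auto
qed

lemma inj_yx: "inj yx"
proof (rule injI)
  fix u v
  assume "yx u = yx v"
  then show "u = v"
  proof (induction u arbitrary: v)
    case Nil
    then show ?case by (cases v) (auto simp: yx_Cons)
  next
    case (Cons y u)
    then obtain z v' where v: "v = z # v'"
      by (cases v) (auto simp: yx_Cons)
    from Cons.prems have *: "yindex y - 1 = yindex z - 1 \<and> yx u = yx v'"
      unfolding v yx_Cons by (auto dest: replicate_sep_inject)
    have "1 \<le> yindex y" "1 \<le> yindex z"
      using yindex[of y] yindex[of z] by auto
    with * have "yindex y = yindex z" by arith
    then have "y = z" by (simp add: yindex_inject)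
    with Cons.IH * v show ?case by simp
  qed
qed

lemma yx_snoc: "yx (v @ [y]) = yx v @ replicate (yindex y - 1) X0 @ [X1]"
  by (simp add: yx_def)

lemma range_yx: "w \<in> range yx \<longleftrightarrow> w = [] \<or> last w = X1"
proof
  assume "w \<in> range yx"
  then obtain v where "w = yx v" by auto
  then show "w = [] \<or> last w = X1"
    by (cases v rule: rev_exhaust) (auto simp: yx_snoc)
next
  have *: "\<exists>v. replicate r X0 @ w = yx v" if "w \<noteq> []" "last w = X1" for w r
    using that
  proof (induction w arbitrary: r)
    case (Cons a w)
    show ?case
    proof (cases a)
      case X0
      with Cons.prems Cons.IH[of "Suc r"] show ?thesis
        by (auto simp: replicate_app_Cons_same split: if_splits)
    next
      case X1
      have "\<exists>v. w = yx v"
        using Cons.prems Cons.IH[of 0] by (cases "w = []") (auto intro: exI[of _ "[]"])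
      then obtain v where "w = yx v" ..
      with X1 have "replicate r X0 @ a # w = yx (Y (Suc r) # v)"
        by (simp add: yx_Cons Y_inverse)
      then show ?thesis ..
    qed
  qed simp
  assume "w = [] \<or> last w = X1"
  then show "w \<in> range yx"
    using *[of w 0] by (cases "w = []") (auto intro: image_eqI[of _ _ "[]"])
qed

lemma pi_Y_yx: "pi_Y (mon (yx v)) = mon v"
  by (simp add: pi_Y_def inj_yx)

lemma linear_pi_Y: "Vector_Spaces.linear (*\<^sub>Q) (*\<^sub>Q) pi_Y"
  by (simp add: pi_Y_def linear_lin_ext)

lemma pi_Y_X0: "pi_Y (f * letter X0) = 0"
proof -
  have "pi_Y (f * letter X0) = lin_ext (\<lambda>w. 0) f"
  proof (rule linear_eqI[where S = "\<lambda>f. pi_Y (f * letter X0)"])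
    show "pi_Y (mon w * letter X0) = lin_ext (\<lambda>w. 0) (mon w)" for w
      unfolding mon_append[symmetric] by (simp add: pi_Y_def range_yx)
  qed (rule linear_comp[OF linear_pi_Y linear_mult_right] linear_lin_ext)+
  then show ?thesis
    by (simp add: lin_ext_def)
qed

lemma linear_s_map: "Vector_Spaces.linear (*\<^sub>Q) (*\<^sub>Q) (s_map \<psi>)"
  unfolding s_map_def d_der_def by (intro linear_add linear_mult_left linear_derivation)

lemma s_map_X0: "s_map \<psi> (f * letter X0) = s_map \<psi> f * letter X0"
  by (simp add: s_map_def d_der_def derivation_mult derivation_letter algebra_simps)

lemma sY_props:
  shows sY_eq: "sY \<psi> = lin_ext (\<lambda>v. pi_Y (s_map \<psi> (mon (yx v))))"
    and linear_sY: "Vector_Spaces.linear (*\<^sub>Q) (*\<^sub>Q) (sY \<psi>)"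
    and pi_Y_s_map: "pi_Y \<circ> s_map \<psi> = sY \<psi> \<circ> pi_Y"
proof -
  let ?S = "lin_ext (\<lambda>v. pi_Y (s_map \<psi> (mon (yx v))))"
  have "pi_Y (s_map \<psi> f) = ?S (pi_Y f)" for f
  proof (rule linear_eqI[where S = "\<lambda>f. pi_Y (s_map \<psi> f)" and T = "\<lambda>f. ?S (pi_Y f)"])
    fix w :: "xletter list"
    show "pi_Y (s_map \<psi> (mon w)) = ?S (pi_Y (mon w))"
    proof (cases "w \<in> range yx")
      case True
      then show ?thesis by (auto simp: pi_Y_yx)
    next
      case False
      then obtain u where "w = u @ [X0]"
        by (cases w rule: rev_exhaust) (auto simp: range_yx intro: xletter.exhaust)
      then have "mon w = mon u * letter X0" by (simp add: mon_append)
      then show ?thesis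
        by (simp add: s_map_X0 pi_Y_X0 lin_ext_def)
    qed
  qed (rule linear_comp[OF linear_pi_Y linear_s_map] linear_comp[OF linear_lin_ext linear_pi_Y])+
  then have ex: "Vector_Spaces.linear (*\<^sub>Q) (*\<^sub>Q) ?S \<and> pi_Y \<circ> s_map \<psi> = ?S \<circ> pi_Y"
    unfolding comp_def by (intro conjI linear_lin_ext ext)
  have "S = ?S" if S: "Vector_Spaces.linear (*\<^sub>Q) (*\<^sub>Q) S \<and> pi_Y \<circ> s_map \<psi> = S \<circ> pi_Y" for S
  proof
    fix f
    have "S (mon v) = ?S (mon v)" for v
      using fun_cong[OF conjunct2[OF S], of "mon (yx v)"] by (simp add: pi_Y_yx)
    then show "S f = ?S f"
      by (rule linear_eqI[OF conjunct1[OF S] linear_lin_ext])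
  qed
  with ex show eq: "sY \<psi> = ?S"
    unfolding sY_def by (rule the_equality)
  show "Vector_Spaces.linear (*\<^sub>Q) (*\<^sub>Q) (sY \<psi>)" "pi_Y \<circ> s_map \<psi> = sY \<psi> \<circ> pi_Y"
    unfolding eq using ex by (rule conjunct1, rule conjunct2)
qed

lemma linear_pi_0: "Vector_Spaces.linear (*\<^sub>Q) (*\<^sub>Q) pi_0"
  by (simp add: pi_0_def linear_lin_ext)

lemma linear_sum:
  assumes "\<And>i. i \<in> I \<Longrightarrow> Vector_Spaces.linear (*\<^sub>Q) (*\<^sub>Q) (S i)"
  shows "Vector_Spaces.linear (*\<^sub>Q) (*\<^sub>Q) (\<lambda>f. \<Sum>i\<in>I. c i *\<^sub>Q S i f)"
  using assms
  by (simp add: Vector_Spaces.linear_iff vector_space_scale Qvs.scale_right_distrib sum.distrib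
      Qvs.scale_sum_right mult.commute)

lemma linear_del: "Vector_Spaces.linear (*\<^sub>Q) (*\<^sub>Q) (del \<psi>)"
  unfolding del_def lin_ext_def by (intro linear_sum linear_derivation)

lemma del_mult: "del \<psi> (f * g) = del \<psi> f * g + f * del \<psi> g"
  by (simp add: del_def lin_ext_def derivation_mult Qvs.scale_right_distrib sum.distrib
      sum_distrib_left sum_distrib_right scale_mult_left scale_mult_right)

lemma del_letter_0: "del \<psi> (letter 0) = 0"
  by (simp add: del_def lin_ext_def derivation_letter del_gen_def)

lemma linear_sigma: "Vector_Spaces.linear (*\<^sub>Q) (*\<^sub>Q) (sigma \<psi>)"
  unfolding sigma_def by (intro linear_add linear_mult_left linear_del)

lemma sigma_letter_0: "sigma \<psi> (f * letter 0) = sigma \<psi> f * letter 0"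
  by (simp add: sigma_def del_mult del_letter_0 algebra_simps)

lemma pi_0_letter_0: "pi_0 (f * letter 0) = 0"
proof -
  have "pi_0 (f * letter 0) = lin_ext (\<lambda>w. 0) f"
  proof (rule linear_eqI[where S = "\<lambda>f. pi_0 (f * letter 0)"])
    show "pi_0 (mon w * letter 0) = lin_ext (\<lambda>w. 0) (mon w)" for w
      unfolding mon_append[symmetric] by (simp add: pi_0_def)
  qed (rule linear_comp[OF linear_pi_0 linear_mult_right] linear_lin_ext)+
  then show ?thesis
    by (simp add: lin_ext_def)
qed

lemma pi_0_QB0: "f \<in> QB0 \<Longrightarrow> pi_0 f = f"
proof -
  assume "f \<in> QB0"
  then have "pi_0 f = lin_ext mon f"
    unfolding pi_0_def lin_ext_def by (intro sum.cong) (auto simp: QB0_def)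
  then show ?thesis by simp
qed

lemma pi_0_sigma: "pi_0 (sigma \<psi> f) = sigma0 \<psi> (pi_0 f)"
  unfolding sigma0_def
proof (rule linear_eqI[where S = "\<lambda>f. pi_0 (sigma \<psi> f)"
      and T = "\<lambda>f. pi_0 (sigma \<psi> (pi_0 f))"])
  fix w :: "nat list"
  show "pi_0 (sigma \<psi> (mon w)) = pi_0 (sigma \<psi> (pi_0 (mon w)))"
  proof (cases "w \<noteq> [] \<and> last w = 0")
    case True
    then obtain u where "w = u @ [0]"
      by (cases w rule: rev_exhaust) auto
    then have w: "mon w = mon u * letter 0" by (simp add: mon_append)
    have "sigma \<psi> 0 = 0"
      by (simp add: sigma_def del_def derivation_def lin_ext_def)
    then show ?thesis
      unfolding w sigma_letter_0 pi_0_letter_0 by (simp add: pi_0_def lin_ext_def)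
  next
    case False
    then have "pi_0 (mon w) = mon w" by (auto simp: pi_0_def)
    then show ?thesis by simp
  qed
qed (rule linear_comp[OF linear_pi_0 linear_sigma]
      linear_comp[OF linear_pi_0 linear_comp[OF linear_sigma linear_pi_0]])+

lemma blocks_Cons: "blocks (p # ps) = replicate (fst p) 0 @ Suc (snd p) # blocks ps"
  by (simp add: blocks_def block_def split: prod.split)

lemma inj_blocks: "inj blocks"
proof (rule injI)
  fix ps qs
  assume "blocks ps = blocks qs"
  then show "ps = qs"
  proof (induction ps arbitrary: qs)
    case Nil
    then show ?case by (cases qs) (auto simp: blocks_Cons blocks_def[of "[]"])
  next
    case (Cons p ps)
    then obtain q qs' where qs: "qs = q # qs'"
      by (cases qs) (auto simp: blocks_Cons blocks_def[of "[]"])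
    from Cons.prems have "fst p = fst q \<and> Suc (snd p) = Suc (snd q) \<and> blocks ps = blocks qs'"
      unfolding qs blocks_Cons by (rule replicate_sep_inject) auto
    with Cons.IH qs show ?case by (auto simp: prod_eq_iff)
  qed
qed

lemma range_blocks: "w \<in> range blocks \<longleftrightarrow> w = [] \<or> last w \<noteq> 0"
proof
  assume "w \<in> range blocks"
  then obtain v where "w = blocks v" by auto
  then show "w = [] \<or> last w \<noteq> 0"
    by (cases v rule: rev_exhaust) (auto simp: blocks_def block_def split: prod.split)
next
  have *: "\<exists>v. replicate r 0 @ w = blocks v" if "w \<noteq> []" "last w \<noteq> 0" for w r
    using that
  proof (induction w arbitrary: r)
    case (Cons a w)
    show ?case
    proof (cases a)
      case 0
      with Cons.prems Cons.IH[of "Suc r"] show ?thesis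
        by (auto simp: replicate_app_Cons_same split: if_splits)
    next
      case (Suc j)
      have "\<exists>v. w = blocks v"
        using Cons.prems Cons.IH[of 0]
        by (cases "w = []") (auto simp: blocks_def intro: exI[of _ "[]"])
      then obtain v where "w = blocks v" ..
      with Suc have "replicate r 0 @ a # w = blocks ((r, j) # v)"
        by (simp add: blocks_Cons)
      then show ?thesis ..
    qed
  qed simp
  assume "w = [] \<or> last w \<noteq> 0"
  then show "w \<in> range blocks"
    using *[of w 0] by (cases "w = []") (auto simp: blocks_def intro: image_eqI[of _ _ "[]"])
qed

lemma tau_blocks: "tau (mon (blocks ps)) = mon (blocks (map prod.swap (rev ps)))"
  by (simp add: tau_def inj_blocks)

lemma tau_generator:
  assumes "1 \<le> k"
  shows "tau (mon (replicate m 0 @ [k])) = mon (replicate (k - 1) 0 @ [m + 1])"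
  using tau_blocks[of "[(m, k - 1)]"] assms by (simp add: blocks_def block_def)

lemma tau_mult:
  assumes "f \<in> QB0" "g \<in> QB0"
  shows "tau (f * g) = tau g * tau f"
proof -
  have mm: "tau (mon u * mon v) = tau (mon v) * tau (mon u)"
    if "u \<in> range blocks" "v \<in> range blocks" for u v
  proof -
    from that obtain ps qs where uv: "u = blocks ps" "v = blocks qs" by auto
    have app: "blocks (as @ bs) = blocks as @ blocks bs" for as bs
      by (simp add: blocks_def)
    show ?thesis
      unfolding uv mon_append[symmetric] app[symmetric] tau_blocks by simp
  qed
  have keys: "\<And>w. w \<in> Poly_Mapping.keys h \<Longrightarrow> w \<in> range blocks" if "h \<in> QB0" for h
    using that by (auto simp: QB0_def range_blocks)
  interpret T: Vector_Spaces.linear "(*\<^sub>Q)" "(*\<^sub>Q)" tau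
    by (simp add: tau_def linear_lin_ext)
  have expand: "h = (\<Sum>w\<in>Poly_Mapping.keys h. Poly_Mapping.lookup h w *\<^sub>Q mon w)" for h :: "nat free_alg"
    using lin_ext_id[of h, symmetric] unfolding lin_ext_def .
  have T: "tau h = (\<Sum>w\<in>Poly_Mapping.keys h. Poly_Mapping.lookup h w *\<^sub>Q tau (mon w))" for h
    using arg_cong[OF expand[of h], of tau] by (simp only: T.sum T.scale)
  have "tau (f * g) = tau ((\<Sum>u\<in>Poly_Mapping.keys f. Poly_Mapping.lookup f u *\<^sub>Q mon u) *
      (\<Sum>v\<in>Poly_Mapping.keys g. Poly_Mapping.lookup g v *\<^sub>Q mon v))"
    by (simp only: expand[symmetric])
  also have "\<dots> = (\<Sum>u\<in>Poly_Mapping.keys f. \<Sum>v\<in>Poly_Mapping.keys g.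
      Poly_Mapping.lookup g v *\<^sub>Q Poly_Mapping.lookup f u *\<^sub>Q tau (mon u * mon v))"
    by (simp only: sum_product T.sum T.scale scale_mult_left scale_mult_right)
  also have "\<dots> = (\<Sum>u\<in>Poly_Mapping.keys f. \<Sum>v\<in>Poly_Mapping.keys g.
      Poly_Mapping.lookup f u *\<^sub>Q Poly_Mapping.lookup g v *\<^sub>Q (tau (mon v) * tau (mon u)))"
    using assms by (intro sum.cong refl) (simp only: mm keys Qvs.scale_left_commute)
  also have "\<dots> = (\<Sum>v\<in>Poly_Mapping.keys g. \<Sum>u\<in>Poly_Mapping.keys f.
      Poly_Mapping.lookup f u *\<^sub>Q Poly_Mapping.lookup g v *\<^sub>Q (tau (mon v) * tau (mon u)))"
    by (rule sum.swap)
  also have "\<dots> = tau g * tau f"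
    unfolding T[of f] T[of g]
    by (simp only: sum_product scale_mult_left scale_mult_right)
  finally show ?thesis .
qed

lemma theta10_eq:
  assumes "\<psi> \<in> ls"
  shows "theta10 (\<psi> + c1 *\<^sub>Q letter X1 + c0 *\<^sub>Q letter X0) =
           theta \<psi> + c1 *\<^sub>Q letter 1 + c0 *\<^sub>Q letter 0"
  unfolding theta10_def
proof (rule the_equality)
  fix g
  assume "\<exists>\<phi>\<in>ls. \<exists>e1 e0. \<psi> + c1 *\<^sub>Q letter X1 + c0 *\<^sub>Q letter X0 =
      \<phi> + e1 *\<^sub>Q letter X1 + e0 *\<^sub>Q letter X0 \<and> g = theta \<phi> + e1 *\<^sub>Q letter 1 + e0 *\<^sub>Q letter 0"
  then obtain \<phi> e1 e0 where \<phi>: "\<phi> \<in> ls"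
    and eq: "\<psi> + c1 *\<^sub>Q letter X1 + c0 *\<^sub>Q letter X0 = \<phi> + e1 *\<^sub>Q letter X1 + e0 *\<^sub>Q letter X0"
    and g: "g = theta \<phi> + e1 *\<^sub>Q letter 1 + e0 *\<^sub>Q letter 0"
    by blast
  from arg_cong[OF eq, of "\<lambda>f. Poly_Mapping.lookup f [X1]"] have "c1 = e1"
    using assms \<phi> by (simp add: ls_def lookup_add lookup_single when_def)
  moreover from arg_cong[OF eq, of "\<lambda>f. Poly_Mapping.lookup f [X0]"] have "c0 = e0"
    using assms \<phi> by (simp add: ls_def lookup_add lookup_single when_def)
  ultimately show "g = theta \<psi> + c1 *\<^sub>Q letter 1 + c0 *\<^sub>Q letter 0"
    using eq g by simp
qed (use assms in blast)

end

theory Submission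
  imports Defs
begin

text \<open>
  Both brackets come from representations of the form \<open>\<psi> \<mapsto> (left multiplication by \<psi>) + (derivation)\<close>,
  so the stabilizers are Lie algebras. For \<open>\<psi>\<close> in the stabilizer of \<open>\<Delta>\<^sub>Y\<close>, evaluating the
  stabilizer condition at \<open>1\<close> and at \<open>y\<^sub>2\<close> shows that \<open>\<pi>\<^sub>Y(\<psi>)\<close> and \<open>\<pi>\<^sub>Y([\<psi>, x\<^sub>0] x\<^sub>1)\<close> are
  primitive. The antipode of the second element forces \<open>\<psi>\<close>, up to its \<open>x\<^sub>0\<close>-coefficient, to be
  antisymmetric under reversal of words with the sign of the depth. Together with the antipode of
  \<open>\<rat>\<langle>X\<rangle>\<close> this gives the parity condition in \<open>ls\<close>.

  Write \<open>a = \<theta>\<^sub>X(\<psi>)\<close> and \<open>c = \<theta>\<^sub>Y(\<pi>\<^sub>Y(\<psi>))\<close>. The reversal symmetry yields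
  \<open>\<partial>\<^sub>c(b\<^bsub>j+1\<^esub>) = \<theta>\<^sub>Y(\<pi>\<^sub>Y([\<psi>, x\<^sub>0\<^sup>j] x\<^sub>1))\<close>, which says that \<open>\<tau>\<close> conjugates \<open>\<sigma>\<^sup>0\<^sub>a\<close> into \<open>\<sigma>\<^sup>0\<^sub>c\<close>.
  Hence \<open>\<tau>\<close> commutes with \<open>\<sigma>\<^sup>0\<close> of \<open>\<theta>(\<psi>) = a + c\<close>. The case \<open>j = 0\<close> says that \<open>\<partial>\<^sub>c\<close> kills
  \<open>b\<^sub>1\<close>, so the mixed brackets \<open>{a\<^sub>1, c\<^sub>2}\<^sub>A\<close> vanish, and \<open>{c\<^sub>1, c\<^sub>2}\<^sub>A\<close> is the image of
  \<open>{a\<^sub>1, a\<^sub>2}\<^sub>A\<close> under \<open>\<tau> \<circ> \<pi>\<^sub>0\<close>.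
\<close>

section \<open>Linear maps and derivations of free algebras\<close>

abbreviation lin :: "(('m \<Rightarrow>\<^sub>0 rat) \<Rightarrow> ('n \<Rightarrow>\<^sub>0 rat)) \<Rightarrow> bool"
  where "lin S \<equiv> Vector_Spaces.linear (*\<^sub>Q) (*\<^sub>Q) S"

lemma lin_iff: "lin S \<longleftrightarrow> (\<forall>f g. S (f + g) = S f + S g) \<and> (\<forall>c f. S (c *\<^sub>Q f) = c *\<^sub>Q S f)"
  by (simp add: Vector_Spaces.linear_iff vector_space_scale)

lemma linI:
  assumes "\<And>f g. S (f + g) = S f + S g" "\<And>c f. S (c *\<^sub>Q f) = c *\<^sub>Q S f"
  shows "lin S"
  using assms by (simp add: lin_iff)

lemma lin_add: "lin S \<Longrightarrow> S (f + g) = S f + S g"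
  by (simp add: lin_iff)

lemma lin_scale: "lin S \<Longrightarrow> S (c *\<^sub>Q f) = c *\<^sub>Q S f"
  by (simp add: lin_iff)

lemma lin_zero: "lin S \<Longrightarrow> S 0 = 0"
  using lin_scale[of S 0 0] by simp

lemma lin_minus: "lin S \<Longrightarrow> S (- f) = - S f"
  using lin_scale[of S "- 1" f] by simp

lemma lin_diff: "lin S \<Longrightarrow> S (f - g) = S f - S g"
  using lin_add[of S f "- g"] by (simp add: lin_minus)

lemma lin_sum: "lin S \<Longrightarrow> S (sum F A) = (\<Sum>i\<in>A. S (F i))"
  by (induction A rule: infinite_finite_induct) (simp_all add: lin_zero lin_add)

lemma linear_diff:
  assumes "lin S" "lin T"
  shows "lin (\<lambda>f. S f - T f)"
  using assms by (simp add: lin_iff Qvs.scale_right_diff_distrib algebra_simps)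

lemma linear_ident: "lin (\<lambda>f. f)"
  by (simp add: lin_iff)

lemma linear_const_zero: "lin (\<lambda>f. 0)"
  by (simp add: lin_iff)

lemma linear_scale_comp: "lin S \<Longrightarrow> lin (\<lambda>f. c *\<^sub>Q S f)"
  by (simp add: lin_iff Qvs.scale_right_distrib mult.commute)

lemma linear_setsum: "(\<And>i. i \<in> I \<Longrightarrow> lin (S i)) \<Longrightarrow> lin (\<lambda>f. \<Sum>i\<in>I. S i f)"
  using linear_sum[of I S "\<lambda>_. 1"] by simp

lemma linear_mult_left_comp: "lin S \<Longrightarrow> lin (\<lambda>f. g * (S f :: 'm::monoid_add \<Rightarrow>\<^sub>0 rat))"
  by (rule linear_comp[OF linear_mult_left])

lemma linear_mult_right_comp: "lin S \<Longrightarrow> lin (\<lambda>f. (S f :: 'm::monoid_add \<Rightarrow>\<^sub>0 rat) * g)"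
  by (rule linear_comp[OF linear_mult_right])

lemmas lin_intros = linear_ident linear_const_zero linear_add linear_diff linear_scale_comp
  linear_setsum linear_mult_left_comp linear_mult_right_comp

lemma linear_funpow: "lin (S :: ('m \<Rightarrow>\<^sub>0 rat) \<Rightarrow> ('m \<Rightarrow>\<^sub>0 rat)) \<Longrightarrow> lin (S ^^ n)"
  by (induction n) (simp_all add: lin_iff)

lemma lin_ext_cong: "(\<And>w. w \<in> Poly_Mapping.keys f \<Longrightarrow> g w = h w) \<Longrightarrow> lin_ext g f = lin_ext h f"
  unfolding lin_ext_def by (rule sum.cong) simp_all

lemma lin_eq_on_keys:
  assumes "lin S" "lin T" "\<And>w. w \<in> Poly_Mapping.keys f \<Longrightarrow> S (mon w) = T (mon w)"
  shows "S f = T f"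
  using linear_eq_lin_ext[OF assms(1), of f] linear_eq_lin_ext[OF assms(2), of f]
    lin_ext_cong[of f "\<lambda>w. S (mon w)" "\<lambda>w. T (mon w)"] assms(3) by simp

lemma mon_Cons: "mon (a # w) = letter a * mon w"
  using mon_append[of "[a]" w] by simp

lemma mon_replicate: "mon (replicate n a) = letter a ^ n"
proof (induction n)
  case (Suc n)
  then show ?case using mon_Cons[of a "replicate n a"] by simp
qed (simp add: mon_Nil)

text \<open>Serves for coefficients, whose values lie in \<open>rat\<close> rather than in a space
  that \<open>linear_eqI\<close> covers, and for existence statements.\<close>

lemma free_alg_induct [case_names scale add]:
  assumes "\<And>c w. P (c *\<^sub>Q mon w)" "\<And>f g. P f \<Longrightarrow> P g \<Longrightarrow> P (f + g)"
  shows "P f"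
proof -
  have "P (\<Sum>w\<in>A. Poly_Mapping.lookup f w *\<^sub>Q mon w)" if "finite A" for A
    using that
  proof induction
    case empty
    then show ?case using assms(1)[of 0] by simp
  next
    case (insert x A)
    then show ?case using assms by simp
  qed
  from this[of "Poly_Mapping.keys f"] show ?thesis
    by (simp only: lin_ext_def[symmetric] lin_ext_id finite_keys)
qed

lemma lookup_letter_mult:
  "Poly_Mapping.lookup (letter a * f) w =
     (case w of [] \<Rightarrow> 0 | b # v \<Rightarrow> if b = a then Poly_Mapping.lookup f v else 0)"
proof (induction f rule: free_alg_induct)
  case (scale c v)
  show ?case
    by (cases w) (auto simp: scale_mult_right lookup_single when_def simp flip: mon_Cons)
next
  case (add f g)
  then show ?case
    by (cases w) (auto simp: distrib_left lookup_add)
qed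

lemma lookup_mult_letter:
  "Poly_Mapping.lookup (f * letter a) (w @ [b]) = (if b = a then Poly_Mapping.lookup f w else 0)"
proof (induction f rule: free_alg_induct)
  case (scale c v)
  show ?case
    by (auto simp: scale_mult_left lookup_single when_def simp flip: mon_append)
next
  case (add f g)
  then show ?case
    by (auto simp: distrib_right lookup_add)
qed

lemma lookup_single_letter_mult:
  "Poly_Mapping.lookup (f * g) [a] =
     Poly_Mapping.lookup f [] * Poly_Mapping.lookup g [a] +
     Poly_Mapping.lookup f [a] * Poly_Mapping.lookup (g :: 'a free_alg) []"
proof (induction f rule: free_alg_induct)
  case (scale c v)
  show ?case
  proof (induction g rule: free_alg_induct)
    case (scale d u)
    then show ?case
      by (auto simp: scale_mult_left scale_mult_right lookup_single when_def append_eq_Cons_conv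
          simp flip: mon_append)
  qed (simp add: distrib_left lookup_add)
qed (simp add: distrib_right lookup_add algebra_simps)

lemma lookup_Nil_mult:
  "Poly_Mapping.lookup (f * g) [] = Poly_Mapping.lookup f [] * Poly_Mapping.lookup (g :: 'a free_alg) []"
proof (induction f rule: free_alg_induct)
  case (scale c v)
  show ?case
  proof (induction g rule: free_alg_induct)
    case (scale d u)
    then show ?case
      by (auto simp: scale_mult_left scale_mult_right lookup_single when_def simp flip: mon_append)
  qed (simp add: distrib_left lookup_add)
qed (simp add: distrib_right lookup_add algebra_simps)

lemma lin_mult_eqI:
  assumes "lin S" "lin T" "S 1 = T 1"
    and "\<And>a w. S (mon w) = T (mon w) \<Longrightarrow> S (letter a * mon w) = T (letter a * mon w)"
  shows "S f = T f"
proof (rule linear_eqI[OF assms(1,2)])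
  show "S (mon w) = T (mon w)" for w
  proof (induction w)
    case (Cons a w)
    then show ?case unfolding mon_Cons[of a w] by (rule assms(4))
  qed (simp add: mon_Nil assms(3))
qed

definition is_derivation :: "(('m::monoid_add \<Rightarrow>\<^sub>0 rat) \<Rightarrow> ('m \<Rightarrow>\<^sub>0 rat)) \<Rightarrow> bool"
  where "is_derivation \<delta> \<longleftrightarrow> lin \<delta> \<and> (\<forall>f g. \<delta> (f * g) = \<delta> f * g + f * \<delta> g)"

lemma is_derivation_lin: "is_derivation \<delta> \<Longrightarrow> lin \<delta>"
  by (simp add: is_derivation_def)

lemma is_derivation_mult: "is_derivation \<delta> \<Longrightarrow> \<delta> (f * g) = \<delta> f * g + f * \<delta> g"
  by (simp add: is_derivation_def)

lemma is_derivation_one: "is_derivation \<delta> \<Longrightarrow> \<delta> 1 = 0"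
  using is_derivation_mult[of \<delta> 1 1] by simp

lemma is_derivation_comm: "is_derivation \<delta> \<Longrightarrow> \<delta> (comm f g) = comm (\<delta> f) g + comm f (\<delta> g)"
  using is_derivation_mult[of \<delta> f g] is_derivation_mult[of \<delta> g f]
    lin_diff[OF is_derivation_lin, of \<delta> "f * g" "g * f"]
  by (simp add: comm_def)

lemma is_derivation_derivation: "is_derivation (derivation g)"
  by (simp add: is_derivation_def linear_derivation derivation_mult)

lemma is_derivation_add:
  "is_derivation \<delta> \<Longrightarrow> is_derivation \<epsilon> \<Longrightarrow> is_derivation (\<lambda>f. \<delta> f + \<epsilon> f)"
  by (simp add: is_derivation_def linear_add algebra_simps)

lemma is_derivation_scale: "is_derivation \<delta> \<Longrightarrow> is_derivation (\<lambda>f. c *\<^sub>Q \<delta> f)"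
  by (simp add: is_derivation_def linear_scale_comp Qvs.scale_right_distrib scale_mult_left
      scale_mult_right)

lemma is_derivation_bracket:
  assumes "is_derivation \<delta>" "is_derivation \<epsilon>"
  shows "is_derivation (\<lambda>f. \<delta> (\<epsilon> f) - \<epsilon> (\<delta> f))"
  unfolding is_derivation_def
proof (intro conjI allI)
  show "lin (\<lambda>f. \<delta> (\<epsilon> f) - \<epsilon> (\<delta> f))"
    using assms[THEN is_derivation_lin]
    by (intro linear_diff linear_comp[of \<delta> \<epsilon>] linear_comp[of \<epsilon> \<delta>])
  fix f g
  note add = assms[THEN is_derivation_lin, THEN lin_add]
  have "\<delta> (\<epsilon> (f * g)) = \<delta> (\<epsilon> f) * g + \<epsilon> f * \<delta> g + (\<delta> f * \<epsilon> g + f * \<delta> (\<epsilon> g))"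
    "\<epsilon> (\<delta> (f * g)) = \<epsilon> (\<delta> f) * g + \<delta> f * \<epsilon> g + (\<epsilon> f * \<delta> g + f * \<epsilon> (\<delta> g))"
    by (simp_all only: assms[THEN is_derivation_mult] add)
  then show "\<delta> (\<epsilon> (f * g)) - \<epsilon> (\<delta> (f * g)) =
      (\<delta> (\<epsilon> f) - \<epsilon> (\<delta> f)) * g + f * (\<delta> (\<epsilon> g) - \<epsilon> (\<delta> g))"
    by (simp add: algebra_simps)
qed

lemma is_derivation_ad: "is_derivation (\<lambda>f. g * f - f * g)"
  unfolding is_derivation_def
  by (intro conjI allI linear_diff linear_mult_left linear_mult_right) (simp add: algebra_simps)

lemma is_derivation_zero: "is_derivation (\<lambda>f. 0)"
  by (simp add: is_derivation_def linear_const_zero)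

lemma is_derivation_eqI:
  fixes \<delta> \<epsilon> :: "'a free_alg \<Rightarrow> 'a free_alg"
  assumes "is_derivation \<delta>" "is_derivation \<epsilon>" "\<And>a. \<delta> (letter a) = \<epsilon> (letter a)"
  shows "\<delta> f = \<epsilon> f"
proof (rule lin_mult_eqI[of \<delta> \<epsilon>])
  show "\<delta> (letter a * mon w) = \<epsilon> (letter a * mon w)" if "\<delta> (mon w) = \<epsilon> (mon w)" for a w
    by (simp only: assms(1,2)[THEN is_derivation_mult] assms(3) that)
qed (use assms in \<open>simp_all add: is_derivation_one is_derivation_lin\<close>)

lemma alg_antihom_one: "alg_antihom g 1 = 1"
  by (simp add: alg_antihom_def flip: mon_Nil)

lemma alg_antihom_letter: "alg_antihom g (letter a) = g a"
  by (simp add: alg_antihom_def)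

lemma comm_add_left: "comm (f + g) h = comm f h + comm g h"
  and comm_add_right: "comm h (f + g) = comm h f + comm h g"
  and comm_scale_left: "comm (c *\<^sub>Q f) h = c *\<^sub>Q comm f h"
  and comm_scale_right: "comm h (c *\<^sub>Q f) = c *\<^sub>Q comm h f"
  by (simp_all add: comm_def algebra_simps scale_mult_left scale_mult_right
      Qvs.scale_right_diff_distrib)

lemma linear_comm_right: "lin (comm f)"
  by (simp add: lin_iff comm_add_right comm_scale_right)

lemma linear_comm_left: "lin (\<lambda>f. comm f g)"
  by (simp add: lin_iff comm_add_left comm_scale_left)

text \<open>The operators \<open>f \<mapsto> \<psi> f + der \<psi> f\<close> represent the bracket on the whole free algebra, and
  they determine \<open>\<psi>\<close> as their value at \<open>1\<close>. So the Jacobi identity is inherited from the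
  commutator of operators.\<close>

locale derivation_bracket =
  fixes der :: "'a free_alg \<Rightarrow> 'a free_alg \<Rightarrow> 'a free_alg"
    and br :: "'a free_alg \<Rightarrow> 'a free_alg \<Rightarrow> 'a free_alg"
    and act :: "'a free_alg \<Rightarrow> 'a free_alg \<Rightarrow> 'a free_alg"
  assumes br_eq: "br \<psi> \<phi> = der \<psi> \<phi> - der \<phi> \<psi> + comm \<psi> \<phi>"
    and act_eq: "act \<psi> f = \<psi> * f + der \<psi> f"
    and is_derivation_der: "is_derivation (der \<psi>)"
    and lin_der: "lin (\<lambda>\<psi>. der \<psi> f)"
    and der_br_letter: "der (br \<psi> \<phi>) (letter a) =
          der \<psi> (der \<phi> (letter a)) - der \<phi> (der \<psi> (letter a))"
begin

lemma der_br: "der (br \<psi> \<phi>) f = der \<psi> (der \<phi> f) - der \<phi> (der \<psi> f)"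
  by (rule is_derivation_eqI[OF is_derivation_der is_derivation_bracket])
    (simp_all add: is_derivation_der der_br_letter)

lemma act_one: "act \<psi> 1 = \<psi>"
  by (simp add: act_eq is_derivation_one[OF is_derivation_der])

lemma br_eq_act: "br \<psi> \<phi> = act \<psi> \<phi> - act \<phi> \<psi>"
  by (simp add: br_eq act_eq comm_def algebra_simps)

text \<open>The commutator of \<open>der \<psi>\<close> with left multiplication by \<phi> is left
  multiplication by \<open>der \<psi> \<phi>\<close>. So the multiplication parts add up to left
  multiplication by \<open>br \<psi> \<phi>\<close>, and the derivation parts are
  \<open>der_br\<close>.\<close>

lemma act_br: "act (br \<psi> \<phi>) f = act \<psi> (act \<phi> f) - act \<phi> (act \<psi> f)"
  unfolding act_eq der_br
  by (simp add: br_eq comm_def lin_add[OF is_derivation_lin[OF is_derivation_der]]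
      is_derivation_mult[OF is_derivation_der] algebra_simps)

lemma linear_act: "lin (act \<psi>)"
  unfolding act_eq by (intro lin_intros is_derivation_lin is_derivation_der)

lemma linear_act_left: "lin (\<lambda>\<psi>. act \<psi> f)"
  unfolding act_eq by (intro lin_intros lin_der)

lemma linear_br: "lin (br \<psi>)" and linear_br_left: "lin (\<lambda>\<psi>. br \<psi> \<phi>)"
  unfolding br_eq_act by (intro lin_intros linear_act linear_act_left)+

lemma br_self: "br \<psi> \<psi> = 0"
  by (simp add: br_eq_act)

lemma br_skew: "br \<psi> \<phi> = - br \<phi> \<psi>"
  by (simp add: br_eq_act)

lemma jacobi: "br f (br g h) + br g (br h f) + br h (br f g) = 0"
proof -
  have "br f (br g h) = act f (act g h - act h g) - act (br g h) f" for f g h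
    by (simp only: br_eq_act[of f] br_eq_act[of g h])
  then show ?thesis
    by (simp add: act_br lin_diff[OF linear_act])
qed

lemma lie_algebra_onI:
  assumes "Qvs.subspace V" "\<And>f g. f \<in> V \<Longrightarrow> g \<in> V \<Longrightarrow> br f g \<in> V"
  shows "lie_algebra_on V br"
  unfolding lie_algebra_on_def
  using assms by (simp add: lin_add[OF linear_br] lin_add[OF linear_br_left] br_self jacobi
      lin_scale[OF linear_br] lin_scale[OF linear_br_left])

end

section \<open>Primitive elements\<close>

lemma linear_tensor_left: "lin (\<lambda>f. f \<otimes> g)"
  by (simp add: tensor_def linear_lin_ext)

lemma linear_tensor_right: "lin (\<lambda>g. f \<otimes> g)"
  unfolding tensor_def lin_ext_def[of _ f] by (intro linear_sum linear_lin_ext)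

lemmas tensor_add_left = lin_add[OF linear_tensor_left]
  and tensor_add_right = lin_add[OF linear_tensor_right]
  and tensor_diff_left = lin_diff[OF linear_tensor_left]
  and tensor_diff_right = lin_diff[OF linear_tensor_right]
  and tensor_scale_left = lin_scale[OF linear_tensor_left]
  and tensor_scale_right = lin_scale[OF linear_tensor_right]
  and tensor_zero_left = lin_zero[OF linear_tensor_left]
  and tensor_zero_right = lin_zero[OF linear_tensor_right]

lemma tensor_mult: "(f \<otimes> g) * (f' \<otimes> g') = (f * f') \<otimes> (g * g')"
proof -
  have 1: "(mon u \<otimes> mon v) * (mon u' \<otimes> mon v') = (mon u * mon u') \<otimes> (mon v * mon v')"
    for u v u' v' :: "'a list"
    unfolding mon_append[symmetric] tensor_mon by (simp add: mult_single plus_list_def)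
  have 2: "(mon u \<otimes> mon v) * (mon u' \<otimes> g') = (mon u * mon u') \<otimes> (mon v * g')"
    for u v u' :: "'a list"
    by (rule linear_eqI[where S = "\<lambda>g'. (mon u \<otimes> mon v) * (mon u' \<otimes> g')"])
      (intro linear_mult_left_comp linear_tensor_right
        linear_comp[OF linear_tensor_right linear_mult_left] 1)+
  have 3: "(mon u \<otimes> mon v) * (f' \<otimes> g') = (mon u * f') \<otimes> (mon v * g')" for u v :: "'a list"
    by (rule linear_eqI[where S = "\<lambda>f'. (mon u \<otimes> mon v) * (f' \<otimes> g')"])
      (intro linear_mult_left_comp linear_tensor_left
        linear_comp[OF linear_tensor_left linear_mult_left] 2)+
  have 4: "(mon u \<otimes> g) * (f' \<otimes> g') = (mon u * f') \<otimes> (g * g')" for u :: "'a list"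
    by (rule linear_eqI[where S = "\<lambda>g. (mon u \<otimes> g) * (f' \<otimes> g')"])
      (intro linear_mult_right_comp linear_tensor_right
        linear_comp[OF linear_tensor_right linear_mult_right] 3)+
  show ?thesis
    by (rule linear_eqI[where S = "\<lambda>f. (f \<otimes> g) * (f' \<otimes> g')"])
      (intro linear_mult_right_comp linear_tensor_left
        linear_comp[OF linear_tensor_left linear_mult_right] 4)+
qed

lemma one_tensor_one: "1 \<otimes> 1 = (1 :: 'a free_alg2)"
  using tensor_mon[of "[] :: 'a list" "[]"] by (simp add: mon_Nil flip: zero_list_def zero_prod_def)

lemma linear_coprod: "lin coprod"
  by (simp add: coprod_def linear_alg_hom)

lemma coprod_mult: "coprod (f * g) = coprod f * coprod g"
  by (simp add: coprod_def alg_hom_mult)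

lemma coprod_one: "coprod 1 = 1 \<otimes> 1"
  by (simp add: coprod_def alg_hom_one one_tensor_one)

lemma coprod_letter: "coprod (letter a) = letter a \<otimes> 1 + 1 \<otimes> letter a"
  by (simp add: coprod_def alg_hom_letter)

lemma primitive_letter: "primitive (letter a)"
  by (simp add: primitive_def coprod_letter)

lemma subspace_Lie: "Qvs.subspace Lie"
  by (simp add: Qvs.subspace_def Lie_def primitive_def lin_zero[OF linear_coprod]
      lin_add[OF linear_coprod] lin_scale[OF linear_coprod] tensor_zero_left tensor_zero_right
      tensor_add_left tensor_add_right tensor_scale_left tensor_scale_right Qvs.scale_right_distrib)

lemma primitive_add: "primitive f \<Longrightarrow> primitive g \<Longrightarrow> primitive (f + g)"
  using Qvs.subspace_add[OF subspace_Lie] by (auto simp: Lie_def)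

lemma primitive_diff: "primitive f \<Longrightarrow> primitive g \<Longrightarrow> primitive (f - g)"
  using Qvs.subspace_diff[OF subspace_Lie] by (auto simp: Lie_def)

lemma primitive_scale: "primitive f \<Longrightarrow> primitive (c *\<^sub>Q f)"
  using Qvs.subspace_scale[OF subspace_Lie] by (auto simp: Lie_def)

lemma primitive_zero: "primitive 0"
  using Qvs.subspace_0[OF subspace_Lie] by (auto simp: Lie_def)

lemma primitive_sum: "(\<And>i. i \<in> I \<Longrightarrow> primitive (F i)) \<Longrightarrow> primitive (sum F I)"
  using Qvs.subspace_sum[OF subspace_Lie, of I F] by (auto simp: Lie_def)

lemma primitive_minus: "primitive f \<Longrightarrow> primitive (- f)"
  using primitive_diff[OF primitive_zero, of f] by simp

lemma primitive_comm:
  assumes "primitive f" "primitive g"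
  shows "primitive (comm f g)"
  using assms
  by (simp add: primitive_def comm_def lin_diff[OF linear_coprod] coprod_mult tensor_mult
      tensor_diff_left tensor_diff_right algebra_simps)

section \<open>Operators on the tensor square and their compatibility with the coproduct\<close>

lemma linear_tensor_map: "lin (tensor_map S T)"
  by (simp add: tensor_map_def linear_lin_ext)

lemma tensor_map_tensor:
  assumes "lin S" "lin T"
  shows "tensor_map S T (f \<otimes> g) = S f \<otimes> T g"
proof (rule bilinear_eqI[where S = "\<lambda>f g. tensor_map S T (f \<otimes> g)"])
  show "tensor_map S T (mon u \<otimes> mon v) = S (mon u) \<otimes> T (mon v)" for u v
    by (simp add: tensor_mon tensor_map_def)
qed (intro linear_comp[OF linear_tensor_map linear_tensor_left] linear_tensor_right
    linear_comp[OF linear_tensor_map linear_tensor_right]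
    linear_comp[OF linear_tensor_left assms(1)] linear_comp[OF linear_tensor_right assms(2)])+

lemma tensor_eqI:
  assumes "lin S" "lin T" "\<And>f g. S (f \<otimes> g) = T (f \<otimes> g)"
  shows "S X = T X"
proof (rule linear_eqI[OF assms(1,2)])
  show "S (mon w) = T (mon w)" for w
    using assms(3)[of "mon (fst w)" "mon (snd w)"] by (simp add: tensor_mon)
qed

text \<open>The extension of an operator to the tensor square by the Leibniz rule. The condition in
  \<open>stab_DeltaY\<close> says that \<open>coprod\<close> intertwines \<open>sY \<psi>\<close>
  with \<open>coder (sY \<psi>)\<close>.\<close>

definition coder :: "('a free_alg \<Rightarrow> 'a free_alg) \<Rightarrow> 'a free_alg2 \<Rightarrow> 'a free_alg2"
  where "coder S X = tensor_map S id X + tensor_map id S X"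

lemma linear_id: "lin id"
  by (simp add: lin_iff)

lemma linear_coder: "lin (coder S)"
  unfolding coder_def by (intro linear_add linear_tensor_map)

lemma coder_tensor: "lin S \<Longrightarrow> coder S (f \<otimes> g) = S f \<otimes> g + f \<otimes> S g"
  by (simp add: coder_def tensor_map_tensor linear_id)

lemma coder_zero: "coder (\<lambda>f. 0) X = 0"
  by (rule tensor_eqI[OF linear_coder linear_const_zero])
    (simp add: coder_tensor linear_const_zero tensor_zero_left tensor_zero_right)

lemma is_derivation_coder:
  assumes "is_derivation \<delta>"
  shows "is_derivation (coder \<delta>)"
  unfolding is_derivation_def
proof (intro conjI allI linear_coder)
  note L = is_derivation_lin[OF assms]
  have 1: "coder \<delta> ((f \<otimes> g) * (f' \<otimes> g')) =
      coder \<delta> (f \<otimes> g) * (f' \<otimes> g') + (f \<otimes> g) * coder \<delta> (f' \<otimes> g')" for f g f' g'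
    by (simp add: tensor_mult coder_tensor[OF L] is_derivation_mult[OF assms] tensor_add_left
        tensor_add_right algebra_simps)
  have 2: "coder \<delta> ((f \<otimes> g) * Z) = coder \<delta> (f \<otimes> g) * Z + (f \<otimes> g) * coder \<delta> Z" for f g Z
    by (rule tensor_eqI[where S = "\<lambda>Z. coder \<delta> ((f \<otimes> g) * Z)"])
      (intro linear_comp[OF linear_coder linear_mult_left] linear_add linear_mult_left
        linear_comp[OF linear_mult_left linear_coder] 1)+
  show "coder \<delta> (W * Z) = coder \<delta> W * Z + W * coder \<delta> Z" for W Z
    by (rule tensor_eqI[where S = "\<lambda>W. coder \<delta> (W * Z)"])
      (intro linear_comp[OF linear_coder linear_mult_right] linear_add linear_mult_right
        linear_comp[OF linear_mult_right linear_coder] 2)+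
qed

text \<open>Since \<open>coder \<delta>\<close> is a derivation and \<open>coprod\<close> is
  multiplicative, both sides obey the same Leibniz rule. On a letter the equation is the primitivity
  of its image, because \<delta> kills 1.\<close>

lemma coprod_derivation:
  fixes \<delta> :: "'a free_alg \<Rightarrow> 'a free_alg"
  assumes \<delta>: "is_derivation \<delta>" and prim: "\<And>a. primitive (\<delta> (letter a))"
  shows "coprod (\<delta> f) = coder \<delta> (coprod f)"
proof (rule lin_mult_eqI[where S = "\<lambda>f. coprod (\<delta> f)"])
  note L = is_derivation_lin[OF \<delta>]
  show "lin (\<lambda>f. coprod (\<delta> f))" "lin (\<lambda>f. coder \<delta> (coprod f))"
    using linear_comp[OF linear_coprod L] linear_comp[OF linear_coder linear_coprod] by blast+
  show "coprod (\<delta> 1) = coder \<delta> (coprod 1)"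
    by (simp add: is_derivation_one[OF \<delta>] lin_zero[OF linear_coprod] coprod_one coder_tensor[OF L]
        tensor_zero_left tensor_zero_right)
  fix a :: 'a and w
  assume IH: "coprod (\<delta> (mon w)) = coder \<delta> (coprod (mon w))"
  have "coprod (\<delta> (letter a)) = coder \<delta> (coprod (letter a))"
    using prim[of a] by (simp add: primitive_def coprod_letter lin_add[OF linear_coder]
        coder_tensor[OF L] is_derivation_one[OF \<delta>] tensor_zero_left tensor_zero_right)
  with IH show "coprod (\<delta> (letter a * mon w)) = coder \<delta> (coprod (letter a * mon w))"
    by (simp add: is_derivation_mult[OF \<delta>] lin_add[OF linear_coprod] coprod_mult
        is_derivation_mult[OF is_derivation_coder[OF \<delta>]])
qed

lemma primitive_derivation:
  fixes \<delta> :: "'a free_alg \<Rightarrow> 'a free_alg"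
  assumes \<delta>: "is_derivation \<delta>" and prim: "\<And>a. primitive (\<delta> (letter a))" and f: "primitive f"
  shows "primitive (\<delta> f)"
  using f unfolding primitive_def coprod_derivation[OF \<delta> prim]
  by (simp add: lin_add[OF linear_coder] coder_tensor[OF is_derivation_lin[OF \<delta>]]
      is_derivation_one[OF \<delta>] tensor_zero_left tensor_zero_right)

definition hom2 :: "('a free_alg \<Rightarrow> 'b free_alg) \<Rightarrow> 'a free_alg2 \<Rightarrow> 'b free_alg2"
  where "hom2 \<theta> = lin_ext (\<lambda>(u, v). \<theta> (mon u) \<otimes> \<theta> (mon v))"

lemma hom2_tensor:
  assumes "lin \<theta>"
  shows "hom2 \<theta> (f \<otimes> g) = \<theta> f \<otimes> \<theta> g"
proof (rule bilinear_eqI[where S = "\<lambda>f g. hom2 \<theta> (f \<otimes> g)"])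
  have L: "lin (hom2 \<theta>)"
    by (simp add: hom2_def linear_lin_ext)
  show "hom2 \<theta> (mon u \<otimes> mon v) = \<theta> (mon u) \<otimes> \<theta> (mon v)" for u v
    by (simp add: tensor_mon hom2_def)
  show "lin (\<lambda>f. hom2 \<theta> (f \<otimes> g))" "lin (\<lambda>g. hom2 \<theta> (f \<otimes> g))" for f g
    by (rule linear_comp[OF L linear_tensor_left] linear_comp[OF L linear_tensor_right])+
qed (rule linear_comp[OF linear_tensor_left assms(1)] linear_comp[OF linear_tensor_right assms(1)])+

text \<open>The homomorphism commutes with coproducts as soon as it does so on letters, by
  multiplicativity; on letters this is the primitivity of \<open>g a\<close>.\<close>

lemma primitive_alg_hom:
  fixes g :: "'a \<Rightarrow> 'b free_alg"
  assumes prim: "\<And>a. primitive (g a)" and f: "primitive f"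
  shows "primitive (alg_hom g f)"
proof -
  let ?h = "alg_hom g" let ?h2 = "hom2 (alg_hom g)"
  note h2 = hom2_tensor[OF linear_alg_hom, of g]
  have L: "lin ?h2"
    by (simp add: hom2_def linear_lin_ext)
  have mult: "?h2 ((f \<otimes> f') * Z) = ?h2 (f \<otimes> f') * ?h2 Z" for f f' Z
  proof (rule tensor_eqI[where S = "\<lambda>Z. ?h2 ((f \<otimes> f') * Z)"])
    show "?h2 ((f \<otimes> f') * (e \<otimes> e')) = ?h2 (f \<otimes> f') * ?h2 (e \<otimes> e')" for e e'
      by (simp add: tensor_mult h2 alg_hom_mult)
  qed (rule linear_comp[OF L linear_mult_left] linear_comp[OF linear_mult_left L])+
  have "coprod (?h f) = ?h2 (coprod f)"
  proof (rule lin_mult_eqI[where S = "\<lambda>f. coprod (?h f)"])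
    show "coprod (?h 1) = ?h2 (coprod 1)"
      by (simp add: alg_hom_one coprod_one h2)
    show "coprod (?h (letter a * mon w)) = ?h2 (coprod (letter a * mon w))"
      if "coprod (?h (mon w)) = ?h2 (coprod (mon w))" for a w
      using prim[of a]
      by (simp add: alg_hom_mult coprod_mult alg_hom_letter that primitive_def coprod_letter
          distrib_right lin_add[OF L] mult h2 alg_hom_one)
  qed (rule linear_comp[OF linear_coprod linear_alg_hom] linear_comp[OF L linear_coprod])+
  then show ?thesis
    using f by (simp add: primitive_def lin_add[OF L] h2 alg_hom_one)
qed

section \<open>Extracting coefficients from the coproduct\<close>

lemma letter_tensor_mult:
  "(letter a \<otimes> 1) * mon (u, v) = mon (a # u, v)" "(1 \<otimes> letter a) * mon (u, v) = mon (u, a # v)"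
  by (simp_all add: tensor_mult mon_append[symmetric] flip: tensor_mon mon_Nil)

lemma coprod_mon_Cons:
  "coprod (letter a * f) = (letter a \<otimes> 1) * coprod f + (1 \<otimes> letter a) * coprod f"
  by (simp add: coprod_mult coprod_letter distrib_right)

text \<open>The functional with value \<open>\<chi> u\<close> on the word \<open>u\<close>, applied
  to the left tensor factor. With the indicator of one word it reads off the terms of a coproduct
  that have this word on the left.\<close>

definition contract :: "('a list \<Rightarrow> rat) \<Rightarrow> 'a free_alg2 \<Rightarrow> 'a free_alg"
  where "contract \<chi> = lin_ext (\<lambda>(u, v). \<chi> u *\<^sub>Q mon v)"

lemma linear_contract: "lin (contract \<chi>)"
  by (simp add: contract_def linear_lin_ext)

lemma contract_tensor_mon: "contract \<chi> (mon u \<otimes> g) = \<chi> u *\<^sub>Q g"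
proof (rule linear_eqI[where S = "\<lambda>g. contract \<chi> (mon u \<otimes> g)"])
  show "contract \<chi> (mon u \<otimes> mon v) = \<chi> u *\<^sub>Q mon v" for v
    by (simp add: contract_def tensor_mon)
qed (intro linear_comp[OF linear_contract linear_tensor_right] lin_intros)+

lemma contract_one_tensor: "contract \<chi> (1 \<otimes> g) = \<chi> [] *\<^sub>Q g"
  using contract_tensor_mon[of \<chi> "[]" g] by (simp add: mon_Nil)

lemma contract_tensor_one_indicator:
  "contract (\<lambda>u. if u = w then 1 else 0) (f \<otimes> 1) = Poly_Mapping.lookup f w *\<^sub>Q 1"
  (is "contract ?\<chi> _ = _")
proof -
  have "contract ?\<chi> (f \<otimes> 1) = lin_ext (\<lambda>v. contract ?\<chi> (mon v \<otimes> 1)) f"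
    by (rule linear_eq_lin_ext[OF linear_comp[OF linear_contract linear_tensor_left]])
  also have "\<dots> = (\<Sum>v\<in>Poly_Mapping.keys f. if v = w then Poly_Mapping.lookup f w *\<^sub>Q 1 else 0)"
    unfolding lin_ext_def by (rule sum.cong) (auto simp: contract_tensor_mon)
  finally show ?thesis
    by (auto simp: in_keys_iff)
qed

lemma contract_mult_right: "contract \<chi> ((1 \<otimes> letter a) * X) = letter a * contract \<chi> X"
proof (rule linear_eqI[where S = "\<lambda>X. contract \<chi> ((1 \<otimes> letter a) * X)"])
  show "contract \<chi> ((1 \<otimes> letter a) * mon w) = letter a * contract \<chi> (mon w)" for w
    by (cases w) (simp add: letter_tensor_mult contract_def scale_mult_right
        mon_append[symmetric])
qed (rule linear_comp[OF linear_contract linear_mult_left]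
      linear_comp[OF linear_mult_left linear_contract])+

lemma contract_mult_left:
  "contract \<chi> ((letter a \<otimes> 1) * X) = contract (\<lambda>u. \<chi> (a # u)) X"
proof (rule linear_eqI[where S = "\<lambda>X. contract \<chi> ((letter a \<otimes> 1) * X)"])
  show "contract \<chi> ((letter a \<otimes> 1) * mon w) = contract (\<lambda>u. \<chi> (a # u)) (mon w)" for w
    by (cases w) (simp add: letter_tensor_mult contract_def)
qed (rule linear_comp[OF linear_contract linear_mult_left] linear_contract)+

lemma contract_zero: "contract (\<lambda>u. 0) X = 0"
  by (simp add: contract_def lin_ext_def case_prod_beta)

lemma contract_counit_coprod: "contract (\<lambda>u. if u = [] then 1 else 0) (coprod f) = f"
  (is "contract ?\<epsilon> _ = _")
proof (rule lin_mult_eqI[where S = "\<lambda>f. contract ?\<epsilon> (coprod f)" and T = "\<lambda>f. f"])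
  show "contract ?\<epsilon> (coprod 1) = 1"
    by (simp add: coprod_one contract_one_tensor)
  show "contract ?\<epsilon> (coprod (letter a * mon w)) = letter a * mon w"
    if "contract ?\<epsilon> (coprod (mon w)) = mon w" for a w
    using that by (simp add: coprod_mon_Cons lin_add[OF linear_contract] contract_mult_left
        contract_mult_right contract_zero)
qed (rule linear_comp[OF linear_contract linear_coprod] linear_ident)+

text \<open>A term of the coproduct of a word has left factor \<open>[a]\<close> exactly when one
  occurrence of \<open>a\<close> moves to the left. Deleting one occurrence in all ways is the
  derivation on the right.\<close>

lemma contract_letter_coprod:
  "contract (\<lambda>u. if u = [a] then 1 else 0) (coprod f) = derivation (\<lambda>b. if b = a then 1 else 0) f"
  (is "contract ?\<chi> _ = ?d f")
proof (rule lin_mult_eqI[where S = "\<lambda>f. contract ?\<chi> (coprod f)" and T = ?d])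
  show "contract ?\<chi> (coprod 1) = ?d 1"
    by (simp add: coprod_one contract_one_tensor is_derivation_one[OF is_derivation_derivation])
  show "contract ?\<chi> (coprod (letter b * mon w)) = ?d (letter b * mon w)"
    if "contract ?\<chi> (coprod (mon w)) = ?d (mon w)" for b w
    using that contract_counit_coprod[of "mon w"]
    by (cases "b = a") (simp_all add: coprod_mon_Cons lin_add[OF linear_contract] contract_mult_left
        contract_mult_right contract_zero derivation_mult derivation_letter)
qed (rule linear_comp[OF linear_contract linear_coprod] linear_derivation)+

lemma lookup_one: "Poly_Mapping.lookup (1 :: 'a free_alg) w = (if w = [] then 1 else 0)"
  by (simp add: lookup_single when_def flip: mon_Nil)

lemma primitive_lookup_Nil:
  assumes "primitive f"
  shows "Poly_Mapping.lookup f [] = 0"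
proof -
  have "f = Poly_Mapping.lookup f [] *\<^sub>Q 1 + f"
    using assms contract_counit_coprod[of f]
    by (simp add: primitive_def lin_add[OF linear_contract] contract_tensor_one_indicator
        contract_one_tensor)
  then have "Poly_Mapping.lookup f [] *\<^sub>Q (1 :: 'a free_alg) = 0"
    by simp
  then show ?thesis
    using lookup_scale[of "Poly_Mapping.lookup f []" 1 "[]"] by (simp add: lookup_one)
qed

lemma primitive_derivation_letter:
  assumes "primitive f"
  shows "derivation (\<lambda>b. if b = a then 1 else 0) f = Poly_Mapping.lookup f [a] *\<^sub>Q 1"
  using assms contract_letter_coprod[of a f]
  by (simp add: primitive_def lin_add[OF linear_contract] contract_tensor_one_indicator
        contract_one_tensor)

text \<open>Deleting a letter \<open>a\<close> leaves a power of \<open>a\<close> only if the word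
  was one already, and each of its \<open>Suc n\<close> occurrences gives the same result.\<close>

lemma lookup_derivation_replicate:
  "Poly_Mapping.lookup (derivation (\<lambda>b. if b = a then 1 else 0) f) (replicate n a) =
     of_nat (Suc n) * Poly_Mapping.lookup f (replicate (Suc n) a)"
proof (induction f rule: free_alg_induct)
  case (scale c w)
  have "Poly_Mapping.lookup (der_word (\<lambda>b. if b = a then 1 else 0) w) (replicate n a) =
     of_nat (Suc n) * (if w = replicate (Suc n) a then 1 else 0)" for n
  proof (induction w arbitrary: n)
    case (Cons b w)
    have "Poly_Mapping.lookup (letter b * der_word (\<lambda>b. if b = a then 1 else 0) w) (replicate n a)
        = (if b = a then of_nat n * (if w = replicate n a then 1 else 0) else 0)"
    proof (cases n)
      case (Suc m)
      then show ?thesis using Cons[of m] by (auto simp: lookup_letter_mult)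
    qed (simp add: lookup_letter_mult)
    then show ?case
      by (auto simp: lookup_add lookup_single when_def)
  qed simp
  then show ?case
    by (simp add: derivation_def lin_ext_scale lookup_single when_def)
next
  case (add f g)
  then show ?case
    by (simp add: lin_add[OF linear_derivation] lookup_add algebra_simps)
qed

text \<open>By \<open>primitive_derivation_letter\<close>, deleting \<open>a\<close> from a
  primitive element leaves a constant. So the coefficient at a higher power of \<open>a\<close>,
  times a nonzero integer, vanishes.\<close>

lemma primitive_lookup_replicate:
  assumes "primitive f" "n \<noteq> 1"
  shows "Poly_Mapping.lookup f (replicate n a) = 0"
proof (cases n)
  case 0
  then show ?thesis using primitive_lookup_Nil[OF assms(1)] by simp
next
  case (Suc m)
  then show ?thesis
    using assms lookup_derivation_replicate[of a f m] primitive_derivation_letter[of f a]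
    by (simp add: lookup_one split: if_splits)
qed

abbreviation antipode :: "'a free_alg \<Rightarrow> 'a free_alg"
  where "antipode \<equiv> alg_antihom (\<lambda>a. - letter a)"

text \<open>The convolution of the antipode with the identity is the counit. On
  \<open>f \<otimes> 1 + 1 \<otimes> f\<close> it gives \<open>antipode f + f\<close>, and the
  counit of a primitive element is 0.\<close>

lemma primitive_antipode:
  assumes "primitive f"
  shows "antipode f = - f"
proof -
  define conv where "conv = lin_ext (\<lambda>(u :: 'a list, v). antipode (mon u) * mon v)"
  have L: "lin conv"
    by (simp add: conv_def linear_lin_ext)
  have conv_tensor: "conv (g \<otimes> h) = antipode g * h" for g h
  proof (rule bilinear_eqI[where S = "\<lambda>g h. conv (g \<otimes> h)"])
    show "conv (mon u \<otimes> mon v) = antipode (mon u) * mon v" for u v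
      by (simp add: tensor_mon conv_def)
  qed (rule linear_comp[OF L linear_tensor_left] linear_comp[OF L linear_tensor_right]
      linear_mult_right_comp[OF linear_alg_antihom] linear_mult_left)+
  \<comment> \<open>A letter on the left comes back between the two factors with a minus sign, where
    the same letter from the right stands with a plus sign.\<close>
  have cancel: "conv ((letter a \<otimes> 1) * X + (1 \<otimes> letter a) * X) = 0" for a X
  proof (rule tensor_eqI[where S = "\<lambda>X. conv ((letter a \<otimes> 1) * X + (1 \<otimes> letter a) * X)"
        and T = "\<lambda>X. 0"])
    show "conv ((letter a \<otimes> 1) * (g \<otimes> h) + (1 \<otimes> letter a) * (g \<otimes> h)) = 0" for g h
      by (simp add: tensor_mult lin_add[OF L] conv_tensor alg_antihom_mult alg_antihom_letter
          mult.assoc)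
  qed (rule linear_comp[OF L linear_add[OF linear_mult_left linear_mult_left]]
      linear_const_zero)+
  have "conv (coprod f) = contract (\<lambda>u. if u = [] then 1 else 0) (f \<otimes> 1)"
  proof (rule lin_mult_eqI[where S = "\<lambda>f. conv (coprod f)"])
    show "conv (coprod 1) = contract (\<lambda>u. if u = [] then 1 else 0) (1 \<otimes> 1)"
      by (simp add: coprod_one conv_tensor alg_antihom_one contract_one_tensor)
    show "conv (coprod (letter a * mon w)) =
        contract (\<lambda>u. if u = [] then 1 else 0) ((letter a * mon w) \<otimes> 1)" for a w
    proof -
      have "conv (coprod (letter a * mon w)) = 0"
        by (simp only: coprod_mon_Cons cancel)
      then show ?thesis
        using contract_tensor_mon[of "\<lambda>u. if u = [] then 1 else 0" "a # w" 1]
        by (simp add: mon_append[symmetric])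
    qed
  qed (rule linear_comp[OF L linear_coprod] linear_comp[OF linear_contract linear_tensor_left])+
  then have "antipode f + f = 0"
    using assms by (simp add: primitive_def lin_add[OF L] conv_tensor alg_antihom_one
        contract_tensor_one_indicator primitive_lookup_Nil)
  then show ?thesis
    by (rule eq_neg_iff_add_eq_0[THEN iffD2])
qed

section \<open>The Lie algebra of the stabilizer of the coproduct\<close>

lemma is_derivation_d_der: "is_derivation (d_der \<psi>)"
  by (simp add: d_der_def is_derivation_derivation)

lemma d_der_X0: "d_der \<psi> (letter X0) = 0"
  and d_der_X1: "d_der \<psi> (letter X1) = comm (letter X1) \<psi>"
  by (simp_all add: d_der_def derivation_letter)

lemma linear_d_der: "lin (\<lambda>\<psi>. d_der \<psi> f)"
proof (rule linI)
  fix \<psi> \<phi> :: "xletter free_alg" and c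
  have "d_der (\<psi> + \<phi>) (letter a) = d_der \<psi> (letter a) + d_der \<phi> (letter a)"
    "d_der (c *\<^sub>Q \<psi>) (letter a) = c *\<^sub>Q d_der \<psi> (letter a)" for a
    by (cases a; simp add: d_der_X0 d_der_X1 comm_add_right comm_scale_right)+
  then show "d_der (\<psi> + \<phi>) f = d_der \<psi> f + d_der \<phi> f" "d_der (c *\<^sub>Q \<psi>) f = c *\<^sub>Q d_der \<psi> f"
    using is_derivation_eqI[OF is_derivation_d_der
        is_derivation_add[OF is_derivation_d_der is_derivation_d_der]]
      is_derivation_eqI[OF is_derivation_d_der is_derivation_scale[OF is_derivation_d_der]]
    by blast+
qed

interpretation ihara: derivation_bracket d_der ihara s_map
proof
  fix \<psi> \<phi> :: "xletter free_alg" and a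
  show "d_der (ihara \<psi> \<phi>) (letter a) =
      d_der \<psi> (d_der \<phi> (letter a)) - d_der \<phi> (d_der \<psi> (letter a))"
  proof (cases a)
    case X0
    then show ?thesis
      by (simp add: d_der_X0 lin_zero[OF is_derivation_lin[OF is_derivation_d_der]])
  next
    case X1
    then show ?thesis
      by (simp add: d_der_X1 is_derivation_comm[OF is_derivation_d_der])
        (simp add: ihara_def comm_def algebra_simps)
  qed
qed (rule ihara_def s_map_def is_derivation_d_der lin_add[OF linear_d_der]
      lin_scale[OF linear_d_der])+

lemma primitive_ihara:
  assumes "primitive \<psi>" "primitive \<phi>"
  shows "primitive (ihara \<psi> \<phi>)"
proof -
  have "primitive (d_der \<psi> (letter a))" if "primitive \<psi>" for \<psi> a
    using that by (cases a) (simp_all add: d_der_X0 d_der_X1 primitive_zero primitive_comm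
        primitive_letter)
  then have "primitive (d_der \<psi> \<phi>)" if "primitive \<psi>" "primitive \<phi>" for \<psi> \<phi>
    using that by (blast intro: primitive_derivation[OF is_derivation_d_der])
  then show ?thesis
    using assms by (simp add: ihara_def primitive_add primitive_diff primitive_comm)
qed

lemma sY_mon: "sY \<psi> (mon v) = pi_Y (s_map \<psi> (mon (yx v)))"
  using fun_cong[OF pi_Y_s_map, of \<psi> "mon (yx v)"] by (simp add: pi_Y_yx)

lemma linear_sY_left: "lin (\<lambda>\<psi>. sY \<psi> f)"
proof (rule linI)
  fix \<psi> \<phi> :: "xletter free_alg" and c
  show "sY (\<psi> + \<phi>) f = sY \<psi> f + sY \<phi> f"
    by (rule linear_eqI[OF linear_sY linear_add[OF linear_sY linear_sY]])
      (simp add: sY_mon lin_add[OF ihara.linear_act_left] lin_add[OF linear_pi_Y])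
  show "sY (c *\<^sub>Q \<psi>) f = c *\<^sub>Q sY \<psi> f"
    by (rule linear_eqI[OF linear_sY linear_scale_comp[OF linear_sY]])
      (simp add: sY_mon lin_scale[OF ihara.linear_act_left] lin_scale[OF linear_pi_Y])
qed

lemma sY_ihara: "sY (ihara \<psi> \<phi>) f = sY \<psi> (sY \<phi> f) - sY \<phi> (sY \<psi> f)"
proof (rule linear_eqI[where S = "sY (ihara \<psi> \<phi>)"])
  fix v
  have "sY \<psi> (sY \<phi> (mon v)) = pi_Y (s_map \<psi> (s_map \<phi> (mon (yx v))))" for \<psi> \<phi>
    using fun_cong[OF pi_Y_s_map, of \<psi> "s_map \<phi> (mon (yx v))"] by (simp add: sY_mon)
  then show "sY (ihara \<psi> \<phi>) (mon v) = sY \<psi> (sY \<phi> (mon v)) - sY \<phi> (sY \<psi> (mon v))"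
    by (simp add: sY_mon ihara.act_br lin_diff[OF linear_pi_Y])
qed (intro linear_sY linear_diff linear_comp[OF linear_sY linear_sY])+

lemma stab_DeltaY_iff:
  "\<psi> \<in> stab_DeltaY \<longleftrightarrow> primitive \<psi> \<and> (\<forall>f. coder (sY \<psi>) (coprod f) = coprod (sY \<psi> f))"
  by (simp add: stab_DeltaY_def Lie_def coder_def)

text \<open>Terms with one operator on each tensor factor appear in both orders of composition and
  cancel. With \<open>sY_ihara\<close> this closes the stabilizer under the bracket.\<close>

lemma coder_comp:
  assumes "lin S" "lin T" "lin (\<lambda>f. S (T f) - T (S f))"
  shows "coder (\<lambda>f. S (T f) - T (S f)) X = coder S (coder T X) - coder T (coder S X)"
proof (rule tensor_eqI[where S = "coder (\<lambda>f. S (T f) - T (S f))"])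
  show "coder (\<lambda>f. S (T f) - T (S f)) (g \<otimes> h) =
      coder S (coder T (g \<otimes> h)) - coder T (coder S (g \<otimes> h))" for g h
    by (simp add: coder_tensor assms lin_add[OF linear_coder] tensor_diff_left tensor_diff_right)
qed (intro linear_coder linear_diff linear_comp[OF linear_coder linear_coder])+

lemma subspace_stab_DeltaY: "Qvs.subspace stab_DeltaY"
proof -
  have sY_simps: "sY (\<psi> + \<phi>) = (\<lambda>f. sY \<psi> f + sY \<phi> f)" "sY (c *\<^sub>Q \<psi>) = (\<lambda>f. c *\<^sub>Q sY \<psi> f)"
    "sY 0 = (\<lambda>f. 0)" for \<psi> \<phi> c
    by (simp_all add: fun_eq_iff lin_add[OF linear_sY_left] lin_scale[OF linear_sY_left]
        lin_zero[OF linear_sY_left])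
  have "coder (\<lambda>f. S f + T f) X = coder S X + coder T X" if "lin S" "lin T" for S T and X :: "yletter free_alg2"
    by (rule tensor_eqI[OF linear_coder linear_add[OF linear_coder linear_coder]])
      (simp add: coder_tensor that linear_add tensor_add_left tensor_add_right)
  moreover have "coder (\<lambda>f. c *\<^sub>Q S f) X = c *\<^sub>Q coder S X" if "lin S" for S c and X :: "yletter free_alg2"
    by (rule tensor_eqI[OF linear_coder linear_scale_comp[OF linear_coder]])
      (simp add: coder_tensor that linear_scale_comp tensor_scale_left tensor_scale_right
        Qvs.scale_right_distrib)
  ultimately show ?thesis
    by (auto simp: Qvs.subspace_def stab_DeltaY_iff primitive_zero primitive_add primitive_scale
        sY_simps linear_sY coder_zero lin_zero[OF linear_coprod] lin_add[OF linear_coprod]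
        lin_scale[OF linear_coprod])
qed

lemma ihara_stab_DeltaY:
  assumes "\<psi> \<in> stab_DeltaY" "\<phi> \<in> stab_DeltaY"
  shows "ihara \<psi> \<phi> \<in> stab_DeltaY"
proof -
  have eq: "sY (ihara \<psi> \<phi>) = (\<lambda>f. sY \<psi> (sY \<phi> f) - sY \<phi> (sY \<psi> f))"
    by (simp add: fun_eq_iff sY_ihara)
  have "lin (\<lambda>f. sY \<psi> (sY \<phi> f) - sY \<phi> (sY \<psi> f))"
    using linear_sY[of "ihara \<psi> \<phi>"] by (simp only: eq)
  then show ?thesis
    using assms by (simp add: stab_DeltaY_iff primitive_ihara eq coder_comp linear_sY
        lin_diff[OF linear_coprod])
qed

lemma lie_algebra_stab_DeltaY: "lie_algebra_on stab_DeltaY ihara"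
  by (rule ihara.lie_algebra_onI[OF subspace_stab_DeltaY ihara_stab_DeltaY])

section \<open>The Lie algebra of the stabilizer of the involution\<close>

definition neg_exp :: "(('m \<Rightarrow>\<^sub>0 rat) \<Rightarrow> ('m \<Rightarrow>\<^sub>0 rat)) \<Rightarrow> nat \<Rightarrow> ('m \<Rightarrow>\<^sub>0 rat) \<Rightarrow> ('m \<Rightarrow>\<^sub>0 rat)"
  where "neg_exp \<delta> n f = ((- 1) ^ n / fact n) *\<^sub>Q (\<delta> ^^ n) f"

lemma linear_neg_exp: "lin \<delta> \<Longrightarrow> lin (neg_exp \<delta> n)"
  unfolding neg_exp_def by (intro linear_scale_comp linear_funpow)

lemma neg_exp_0: "neg_exp \<delta> 0 f = f"
  by (simp add: neg_exp_def)

lemma deriv_neg_exp: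
  assumes "lin \<delta>"
  shows "\<delta> (neg_exp \<delta> n f) = - (of_nat (Suc n) *\<^sub>Q neg_exp \<delta> (Suc n) f)"
proof -
  have "(- 1) ^ n / fact n = - (of_nat (Suc n) * ((- 1) ^ Suc n / fact (Suc n) :: rat))"
    by (simp add: field_simps del: of_nat_Suc)
  then show ?thesis
    by (simp add: neg_exp_def lin_scale[OF assms])
qed

lemma neg_exp_Suc:
  assumes "lin \<delta>"
  shows "neg_exp \<delta> (Suc n) f = - (1 / of_nat (Suc n)) *\<^sub>Q \<delta> (neg_exp \<delta> n f)"
  unfolding deriv_neg_exp[OF assms] by (simp del: of_nat_Suc)

lemma neg_exp_commute:
  assumes "lin T" "lin \<delta>" "lin \<epsilon>" "\<And>f. \<epsilon> (T f) = T (\<delta> f)"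
  shows "neg_exp \<epsilon> n (T f) = T (neg_exp \<delta> n f)"
  by (induction n)
    (simp_all only: neg_exp_0 neg_exp_Suc[OF assms(2)] neg_exp_Suc[OF assms(3)] assms(4)
      lin_scale[OF assms(1)])

lemma neg_exp_eq_0:
  assumes "lin \<delta>" "\<delta> f = 0" "0 < n"
  shows "neg_exp \<delta> n f = 0"
proof -
  obtain m where "n = Suc m" using assms(3) by (cases n) auto
  moreover have "neg_exp \<delta> (Suc m) f = 0"
    by (induction m) (simp_all add: neg_exp_Suc[OF assms(1)] neg_exp_0 assms(2) lin_zero[OF assms(1)]
        del: of_nat_Suc)
  ultimately show ?thesis by simp
qed

text \<open>This is the multiplicativity of exp(-\<delta>), degree by degree. In the induction step
  \<delta> raises one of the two degrees; the resulting factors \<open>k\<close> and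
  \<open>Suc n - k\<close> add up to \<open>Suc n\<close>, which the recursion divides out.\<close>

lemma neg_exp_mult:
  assumes "is_derivation \<delta>"
  shows "neg_exp \<delta> n (f * g) = (\<Sum>k\<le>n. neg_exp \<delta> k f * neg_exp \<delta> (n - k) g)"
proof (induction n)
  case 0
  then show ?case by (simp add: neg_exp_0)
next
  case (Suc n)
  note lin = is_derivation_lin[OF assms]
  let ?a = "\<lambda>k. neg_exp \<delta> k f" let ?b = "\<lambda>k. neg_exp \<delta> k g"
  have "\<delta> (?a k * ?b (n - k)) = - (of_nat (Suc k) *\<^sub>Q (?a (Suc k) * ?b (n - k)))
      - of_nat (Suc n - k) *\<^sub>Q (?a k * ?b (Suc n - k))" if "k \<le> n" for k
    using that by (simp add: is_derivation_mult[OF assms] deriv_neg_exp[OF lin]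
        scale_mult_left scale_mult_right Suc_diff_le del: of_nat_Suc)
  then have "\<delta> (neg_exp \<delta> n (f * g)) =
      - (\<Sum>k\<le>n. of_nat (Suc k) *\<^sub>Q (?a (Suc k) * ?b (n - k)))
      - (\<Sum>k\<le>n. of_nat (Suc n - k) *\<^sub>Q (?a k * ?b (Suc n - k)))"
    by (simp add: Suc lin_sum[OF lin] sum_subtractf sum_negf del: of_nat_Suc)
  \<comment> \<open>After the index shift, the added term \<open>k = 0\<close> has coefficient 0; so
    has \<open>k = Suc n\<close> in the next sum.\<close>
  also have "(\<Sum>k\<le>n. of_nat (Suc k) *\<^sub>Q (?a (Suc k) * ?b (n - k))) =
      (\<Sum>k\<le>Suc n. of_nat k *\<^sub>Q (?a k * ?b (Suc n - k)))"
    by (subst sum.atMost_Suc_shift) simp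
  also have "(\<Sum>k\<le>n. of_nat (Suc n - k) *\<^sub>Q (?a k * ?b (Suc n - k))) =
      (\<Sum>k\<le>Suc n. of_nat (Suc n - k) *\<^sub>Q (?a k * ?b (Suc n - k)))"
    by simp
  also have "- (\<Sum>k\<le>Suc n. of_nat k *\<^sub>Q (?a k * ?b (Suc n - k))) -
      (\<Sum>k\<le>Suc n. of_nat (Suc n - k) *\<^sub>Q (?a k * ?b (Suc n - k))) =
      - (\<Sum>k\<le>Suc n. of_nat (Suc n) *\<^sub>Q (?a k * ?b (Suc n - k)))"
  proof -
    have "of_nat k *\<^sub>Q (?a k * ?b (Suc n - k)) + of_nat (Suc n - k) *\<^sub>Q (?a k * ?b (Suc n - k)) =
        of_nat (Suc n) *\<^sub>Q (?a k * ?b (Suc n - k))" if "k \<le> Suc n" for k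
      using that by (simp add: Qvs.scale_left_distrib[symmetric] of_nat_diff)
    then have "(\<Sum>k\<le>Suc n. of_nat k *\<^sub>Q (?a k * ?b (Suc n - k)) +
          of_nat (Suc n - k) *\<^sub>Q (?a k * ?b (Suc n - k))) =
        (\<Sum>k\<le>Suc n. of_nat (Suc n) *\<^sub>Q (?a k * ?b (Suc n - k)))"
      by (intro sum.cong) auto
    then show ?thesis
      by (simp only: sum.distrib minus_add_distrib[symmetric] diff_conv_add_uminus)
  qed
  finally show ?case
    unfolding neg_exp_Suc[OF lin, of n "f * g"]
    by (simp add: Qvs.scale_sum_right[symmetric] del: of_nat_Suc sum.atMost_Suc)
qed

lemma neg_exp_finite:
  fixes \<delta> :: "'a free_alg \<Rightarrow> 'a free_alg"
  assumes \<delta>: "is_derivation \<delta>" and letters: "\<And>a. \<exists>K. \<forall>n>K. neg_exp \<delta> n (letter a) = 0"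
  shows "\<exists>K. \<forall>n>K. neg_exp \<delta> n f = 0"
proof (induction f rule: free_alg_induct)
  case (scale c w)
  have "\<exists>K. \<forall>n>K. neg_exp \<delta> n (mon w) = 0"
  proof (induction w)
    case Nil
    show ?case
      using neg_exp_eq_0[OF is_derivation_lin[OF \<delta>] is_derivation_one[OF \<delta>]] by (auto simp: mon_Nil)
  next
    case (Cons a w)
    obtain K where K: "\<And>n. K < n \<Longrightarrow> neg_exp \<delta> n (letter a) = 0"
      using letters by blast
    obtain L where L: "\<And>n. L < n \<Longrightarrow> neg_exp \<delta> n (mon w) = 0"
      using Cons by blast
    have "neg_exp \<delta> k (letter a) * neg_exp \<delta> (n - k) (mon w) = 0" if "K + L < n" for n k
    proof (cases "K < k")
      case False
      then have "L < n - k" using that by linarith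
      then show ?thesis by (simp add: L)
    qed (simp add: K)
    then have "\<forall>n>K + L. neg_exp \<delta> n (letter a * mon w) = 0"
      unfolding neg_exp_mult[OF \<delta>] by simp
    then show ?case
      unfolding mon_Cons[of a w] ..
  qed
  then show ?case
    by (simp add: lin_scale[OF linear_neg_exp[OF is_derivation_lin[OF \<delta>]]]) blast
next
  case (add f g)
  then obtain K L where "\<forall>n>K. neg_exp \<delta> n f = 0" "\<forall>n>L. neg_exp \<delta> n g = 0"
    by blast
  then show ?case
    by (intro exI[of _ "max K L"]) (simp add: lin_add[OF linear_neg_exp[OF is_derivation_lin[OF \<delta>]]])
qed

text \<open>The substitution \<open>w \<mapsto> \<Sum> w(l)\<close> in the definition of \<open>\<partial>\<^sub>w\<close> is the exponential of minus the
  derivation \<open>b\<^sub>k \<mapsto> (k - 1) b\<^bsub>k-1\<^esub>\<close>; truncated subtraction makes \<open>b\<^sub>0\<close> and \<open>b\<^sub>1\<close> map to \<open>0\<close>.\<close>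

definition lower :: "nat free_alg \<Rightarrow> nat free_alg"
  where "lower = derivation (\<lambda>k. of_nat (k - 1) *\<^sub>Q letter (k - 1))"

abbreviation lower_exp :: "nat \<Rightarrow> nat free_alg \<Rightarrow> nat free_alg"
  where "lower_exp \<equiv> neg_exp lower"

lemma is_derivation_lower: "is_derivation lower"
  by (simp add: lower_def is_derivation_derivation)

lemma lower_letter: "lower (letter k) = of_nat (k - 1) *\<^sub>Q letter (k - 1)"
  by (simp add: lower_def derivation_letter)

lemma linear_lower: "lin lower"
  by (rule is_derivation_lin[OF is_derivation_lower])

lemmas linear_lower_exp = linear_neg_exp[OF linear_lower]
  and lower_neg_exp = deriv_neg_exp[OF linear_lower]
  and lower_exp_Suc = neg_exp_Suc[OF linear_lower]

text \<open>With \<open>l = k - n\<close> and the symmetry of binomial coefficients, this is the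
  factor with which \<partial>_w replaces b_k by b_l. Wherever \<open>k - n\<close> is truncated, or
  is 0 for positive \<open>k\<close>, the binomial coefficient is 0.\<close>

lemma lower_exp_letter:
  "lower_exp n (letter k) = ((- 1) ^ n * of_nat ((k - 1) choose n)) *\<^sub>Q letter (k - n)"
proof (induction n)
  case 0
  then show ?case by (simp add: neg_exp_0)
next
  case (Suc n)
  have "(k - n - 1) * ((k - 1) choose n) = Suc n * ((k - 1) choose Suc n)"
    using binomial_absorb_comp[of "k - 1" n] binomial_absorption[of n "k - 1"]
    by (simp add: diff_commute)
  then have "of_nat (k - n - 1) * of_nat ((k - 1) choose n) =
      (of_nat (Suc n) * of_nat ((k - 1) choose Suc n) :: rat)"
    by (simp only: of_nat_mult[symmetric])
  then show ?case
    unfolding lower_exp_Suc Suc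
    by (simp add: lin_scale[OF linear_lower] lower_letter field_simps del: of_nat_Suc)
qed

lemma sum_antidiagonal:
  fixes g :: "nat \<Rightarrow> nat \<Rightarrow> 'a::comm_monoid_add"
  assumes "\<And>i j. K < i \<or> M < j \<Longrightarrow> g i j = 0"
  shows "(\<Sum>n\<le>K + M. \<Sum>i\<le>n. g i (n - i)) = (\<Sum>i\<le>K. \<Sum>j\<le>M. g i j)"
proof -
  have fin: "finite {(i, j). i + j \<le> K + M}"
    by (rule finite_subset[of _ "{..K + M} \<times> {..K + M}"]) auto
  have supp: "i \<le> K \<and> j \<le> M" if "g i j \<noteq> 0" for i j
    using that assms[of i j] by (meson not_le)
  have "(\<Sum>n\<le>K + M. \<Sum>i\<le>n. g i (n - i)) = (\<Sum>(i, j)\<in>{(i, j). i + j \<le> K + M}. g i j)"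
    by (rule sum.triangle_reindex_eq[symmetric])
  also have "\<dots> = (\<Sum>(i, j)\<in>{..K} \<times> {..M}. g i j)"
    by (rule sum.mono_neutral_right[OF fin]) (auto dest: supp)
  finally show ?thesis
    by (simp add: sum.cartesian_product)
qed

lemma lower_exp_mon_eq_0: "sum_list w < n \<Longrightarrow> lower_exp n (mon w) = 0"
proof (induction w arbitrary: n)
  case Nil
  then show ?case
    by (simp add: mon_Nil neg_exp_eq_0[OF linear_lower is_derivation_one[OF is_derivation_lower]])
next
  case (Cons k w)
  have "lower_exp j (letter k) * lower_exp (n - j) (mon w) = 0" if "j \<le> n" for j
  proof (cases "k < j")
    case True
    then show ?thesis by (simp add: lower_exp_letter binomial_eq_0)
  next
    case False
    then show ?thesis using Cons that by simp
  qed
  then show ?case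
    unfolding mon_Cons[of k w] neg_exp_mult[OF is_derivation_lower] by (intro sum.neutral) simp
qed

lemma lower_exp_finite: "\<exists>K. \<forall>n>K. lower_exp n f = 0"
proof (rule neg_exp_finite[OF is_derivation_lower])
  show "\<exists>K. \<forall>n>K. lower_exp n (letter k) = 0" for k
    by (rule exI[of _ k]) (simp add: lower_exp_letter binomial_eq_0)
qed

lemma lowerings_Nil: "lowerings [] = {[]}"
  by (simp add: lowerings_def)

lemma lowerings_Cons:
  "lowerings (k # w) = (\<lambda>(l, v). l # v) ` ((if k = 0 then {0} else {1..k}) \<times> lowerings w)"
  by (auto simp: lowerings_def list_all2_Cons2)

lemma sum_list_lowerings: "v \<in> lowerings w \<Longrightarrow> sum_list v \<le> sum_list w"
  by (induction w arbitrary: v)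
    (auto simp: lowerings_Nil lowerings_Cons add_mono split: if_splits)

lemma lowering_coeff_Cons:
  "lowering_coeff (k # w) (l # v) =
     (- 1) ^ (k + l) * (if k = 0 then 1 else of_nat ((k - 1) choose (l - 1))) * lowering_coeff w v"
  by (simp add: lowering_coeff_def power_add)

text \<open>Grouping the words \<open>v\<close> by the drop \<open>sum_list w - sum_list v\<close>
  turns the sum in \<open>del_gen\<close> into the terms of exp(-lower). The family \<open>h\<close>
  is indexed by the drop because the letter bracketed with \<open>v\<close> in
  \<open>del_gen\<close> depends on it.\<close>

lemma sum_lowerings:
  assumes "\<And>n. lin (h n)"
  shows "(\<Sum>v\<in>lowerings w. lowering_coeff w v *\<^sub>Q h (sum_list w - sum_list v) (mon v)) =
         (\<Sum>n\<le>sum_list w. h n (lower_exp n (mon w)))"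
  using assms
proof (induction w arbitrary: h)
  case Nil
  then show ?case by (simp add: lowerings_Nil lowering_coeff_def neg_exp_0)
next
  case (Cons k w)
  note lin = Cons.prems
  let ?L = "if k = 0 then {0} else {1..k}"
  define c :: "nat \<Rightarrow> rat" where
    "c l = (- 1) ^ (k + l) * (if k = 0 then 1 else of_nat ((k - 1) choose (l - 1)))" for l
  define g where "g j i = h (j + i) (lower_exp j (letter k) * lower_exp i (mon w))" for j i
  have inj: "inj_on (\<lambda>(l, v). l # v) A" for A :: "(nat \<times> nat list) set"
    by (auto simp: inj_on_def)
  have "(\<Sum>v\<in>lowerings (k # w). lowering_coeff (k # w) v *\<^sub>Q
          h (sum_list (k # w) - sum_list v) (mon v)) =
      (\<Sum>l\<in>?L. \<Sum>v\<in>lowerings w. (c l * lowering_coeff w v) *\<^sub>Q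
          h (k + sum_list w - (l + sum_list v)) (letter l * mon v))"
    unfolding lowerings_Cons sum.reindex[OF inj] sum.cartesian_product
    by (simp add: case_prod_beta lowering_coeff_Cons c_def mon_append[symmetric])
  also have "\<dots> = (\<Sum>l\<in>?L. c l *\<^sub>Q (\<Sum>v\<in>lowerings w. lowering_coeff w v *\<^sub>Q
          h (k - l + (sum_list w - sum_list v)) (letter l * mon v)))"
  proof (intro sum.cong refl)
    fix l assume l: "l \<in> ?L"
    have "k + sum_list w - (l + sum_list v) = k - l + (sum_list w - sum_list v)"
      if "v \<in> lowerings w" for v
      using sum_list_lowerings[OF that] l by (auto split: if_splits)
    then show "(\<Sum>v\<in>lowerings w. (c l * lowering_coeff w v) *\<^sub>Q
          h (k + sum_list w - (l + sum_list v)) (letter l * mon v)) =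
        c l *\<^sub>Q (\<Sum>v\<in>lowerings w. lowering_coeff w v *\<^sub>Q
          h (k - l + (sum_list w - sum_list v)) (letter l * mon v))"
      by (simp add: Qvs.scale_sum_right)
  qed
  also have "\<dots> = (\<Sum>l\<in>?L. c l *\<^sub>Q (\<Sum>n\<le>sum_list w. h (k - l + n) (letter l * lower_exp n (mon w))))"
  proof (intro sum.cong refl arg_cong[where f = "\<lambda>x. _ *\<^sub>Q x"])
    fix l
    show "(\<Sum>v\<in>lowerings w. lowering_coeff w v *\<^sub>Q
          h (k - l + (sum_list w - sum_list v)) (letter l * mon v)) =
        (\<Sum>n\<le>sum_list w. h (k - l + n) (letter l * lower_exp n (mon w)))"
      \<comment> \<open>The hypothesis is used for the family shifted by \<open>k - l\<close> and
        composed with left multiplication by \<open>letter l\<close>.\<close>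
      by (rule Cons.IH[of "\<lambda>n f. h (k - l + n) (letter l * f)"])
        (rule linear_comp[OF lin linear_mult_left])
  qed
  also have "\<dots> = (\<Sum>l\<in>?L. \<Sum>n\<le>sum_list w. g (k - l) n)"
  proof (intro sum.cong refl)
    fix l assume l: "l \<in> ?L"
    have "lower_exp (k - l) (letter k) = c l *\<^sub>Q letter l"
    proof (cases "k = 0")
      case False
      with l have l: "1 \<le> l" "l \<le> k" by auto
      have "(k - 1) choose (k - l) = (k - 1) choose (l - 1)"
        using binomial_symmetric[of "l - 1" "k - 1"] l by (simp add: diff_diff_eq)
      moreover have "(- 1 :: rat) ^ (k - l) = (- 1) ^ (k + l)"
        using l by (simp add: minus_one_power_iff)
      ultimately show ?thesis
        using l False by (simp add: lower_exp_letter c_def)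
    qed (use l in \<open>simp add: neg_exp_0 c_def\<close>)
    then show "c l *\<^sub>Q (\<Sum>n\<le>sum_list w. h (k - l + n) (letter l * lower_exp n (mon w))) =
        (\<Sum>n\<le>sum_list w. g (k - l) n)"
      by (simp add: g_def scale_mult_left lin_scale[OF lin] Qvs.scale_sum_right)
  qed
  also have "\<dots> = (\<Sum>j\<le>k. \<Sum>n\<le>sum_list w. g j n)"
  proof (cases "k = 0")
    case False
    have "(\<Sum>l\<in>{1..k}. \<Sum>n\<le>sum_list w. g (k - l) n) = (\<Sum>j\<in>{..<k}. \<Sum>n\<le>sum_list w. g j n)"
      by (rule sum.reindex_bij_witness[of _ "\<lambda>j. k - j" "\<lambda>l. k - l"]) auto
    \<comment> \<open>The added term \<open>j = k\<close> vanishes, as k - 1 choose k is 0 for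
      positive \<open>k\<close>.\<close>
    also have "\<dots> = (\<Sum>j\<le>k. \<Sum>n\<le>sum_list w. g j n)"
      using False by (simp add: lessThan_Suc_atMost[symmetric] g_def lower_exp_letter binomial_eq_0
          lin_zero[OF lin])
    finally show ?thesis using False by simp
  qed simp
  also have "\<dots> = (\<Sum>n\<le>k + sum_list w. \<Sum>j\<le>n. g j (n - j))"
  proof (rule sum_antidiagonal[symmetric])
    show "g j n = 0" if "k < j \<or> sum_list w < n" for j n
      using that by (auto simp: g_def lower_exp_letter binomial_eq_0 lower_exp_mon_eq_0
          lin_zero[OF lin])
  qed
  also have "\<dots> = (\<Sum>n\<le>sum_list (k # w). h n (lower_exp n (mon (k # w))))"
    unfolding mon_Cons[of k w] neg_exp_mult[OF is_derivation_lower] lin_sum[OF lin] g_def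
    by (intro sum.cong) simp_all
  finally show ?case .
qed

section \<open>The derivations \<partial>_\<psi> and the bracket on Q<B>\<close>

lemma linear_del_left: "lin (\<lambda>\<psi>. del \<psi> f)"
  by (simp add: del_def linear_lin_ext)

lemma is_derivation_del: "is_derivation (del \<psi>)"
  by (simp add: is_derivation_def linear_del del_mult)

lemma sum_atMost_extend:
  fixes F :: "nat \<Rightarrow> 'a::comm_monoid_add"
  assumes "\<And>n. K < n \<Longrightarrow> F n = 0" "K \<le> L"
  shows "(\<Sum>n\<le>L. F n) = (\<Sum>n\<le>K. F n)"
  by (rule sum.mono_neutral_right) (use assms in \<open>auto simp flip: not_less\<close>)

lemma del_letter:
  assumes "1 \<le> i" "\<And>n. K < n \<Longrightarrow> lower_exp n \<psi> = 0"
  shows "del \<psi> (letter i) = (\<Sum>n\<le>K. comm (letter (i + n)) (lower_exp n \<psi>))"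
proof -
  \<comment> \<open>\<open>K\<close> bounds the series of \<psi> only; single words may have later
    terms that cancel, so \<open>L\<close> is also at least each of their weights.\<close>
  define L where "L = K + (\<Sum>w\<in>Poly_Mapping.keys \<psi>. sum_list w)"
  have "del \<psi> (letter i) = (\<Sum>n\<le>L. comm (letter (i + n)) (lower_exp n \<psi>))"
  proof (rule lin_eq_on_keys[OF linear_del_left])
    show "lin (\<lambda>\<psi>. \<Sum>n\<le>L. comm (letter (i + n)) (lower_exp n \<psi>))"
      by (intro linear_setsum linear_comp[OF linear_comm_right linear_lower_exp])
    fix w
    assume "w \<in> Poly_Mapping.keys \<psi>"
    then have L: "sum_list w \<le> L"
      unfolding L_def by (simp add: member_le_sum trans_le_add2)
    have "del (mon w) (letter i) =
        (\<Sum>v\<in>lowerings w. lowering_coeff w v *\<^sub>Q comm (letter (i + (sum_list w - sum_list v))) (mon v))"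
      using assms(1) by (simp add: del_def derivation_letter del_gen_def sum_list_lowerings)
    also have "\<dots> = (\<Sum>n\<le>sum_list w. comm (letter (i + n)) (lower_exp n (mon w)))"
      by (rule sum_lowerings[of "\<lambda>n. comm (letter (i + n))"]) (rule linear_comm_right)
    also have "\<dots> = (\<Sum>n\<le>L. comm (letter (i + n)) (lower_exp n (mon w)))"
      by (rule sum_atMost_extend[symmetric, OF _ L])
        (simp add: lower_exp_mon_eq_0 lin_zero[OF linear_comm_right])
    finally show "del (mon w) (letter i) = (\<Sum>n\<le>L. comm (letter (i + n)) (lower_exp n (mon w)))" .
  qed
  also have "\<dots> = (\<Sum>n\<le>K. comm (letter (i + n)) (lower_exp n \<psi>))"
    by (rule sum_atMost_extend) (simp_all add: L_def assms(2) lin_zero[OF linear_comm_right])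
  finally show ?thesis .
qed

text \<open>The difference is a derivation, so letters suffice. In \<open>del_letter\<close>,
  \<open>lower\<close> gives b_(i+n) the factor (i - 1) + n and raises the degree of the other
  entry. The part with i - 1 is \<partial>_\<psi>(lower b_i); the rest telescopes.\<close>

lemma lower_del: "lower (del \<psi> f) = del \<psi> (lower f)"
proof -
  have "lower (del \<psi> f) - del \<psi> (lower f) = 0"
  proof (rule is_derivation_eqI[OF is_derivation_bracket is_derivation_zero])
    fix i
    obtain K where K: "\<And>n. K < n \<Longrightarrow> lower_exp n \<psi> = 0"
      using lower_exp_finite by blast
    show "lower (del \<psi> (letter i)) - del \<psi> (lower (letter i)) = 0"
    proof (cases "i = 0")
      case True
      then show ?thesis
        by (simp add: del_letter_0 lower_letter lin_zero[OF linear_lower] lin_zero[OF linear_del])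
    next
      case False
      let ?t = "\<lambda>n. of_nat n *\<^sub>Q comm (letter (i + n - 1)) (lower_exp n \<psi>)"
      have "lower (comm (letter (i + n)) (lower_exp n \<psi>)) =
          of_nat (i - 1) *\<^sub>Q comm (letter (i - 1 + n)) (lower_exp n \<psi>) + (?t n - ?t (Suc n))" for n
      proof -
        have [simp]: "i + n - Suc 0 = i - Suc 0 + n"
          using False by simp
        show ?thesis
          by (simp add: is_derivation_comm[OF is_derivation_lower] lower_letter lower_neg_exp
              comm_scale_left comm_scale_right comm_add_left lin_minus[OF linear_comm_right]
              Qvs.scale_left_distrib del: of_nat_Suc)
      qed
      then have "lower (del \<psi> (letter i)) =
          of_nat (i - 1) *\<^sub>Q (\<Sum>n\<le>K. comm (letter (i - 1 + n)) (lower_exp n \<psi>)) +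
          (\<Sum>n\<le>K. ?t n - ?t (Suc n))"
        using False by (simp add: del_letter[OF _ K] lin_sum[OF linear_lower] sum.distrib
            Qvs.scale_sum_right del: of_nat_Suc)
      \<comment> \<open>Only \<open>?t 0\<close> and \<open>?t (Suc K)\<close> remain: the first has
        coefficient 0, the second lies beyond the end of the series.\<close>
      also have "(\<Sum>n\<le>K. ?t n - ?t (Suc n)) = 0"
        by (subst sum_telescope[of ?t K]) (simp add: K lin_zero[OF linear_comm_right])
      also have "of_nat (i - 1) *\<^sub>Q (\<Sum>n\<le>K. comm (letter (i - 1 + n)) (lower_exp n \<psi>)) =
          del \<psi> (lower (letter i))"
      proof (cases "i = 1")
        case True
        then show ?thesis by (simp add: lower_letter lin_zero[OF linear_del])
      next
        case F: False
        with False have "1 \<le> i - 1" by auto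
        then show ?thesis
          by (simp only: lower_letter lin_scale[OF linear_del] del_letter[OF _ K])
      qed
      finally show ?thesis by simp
    qed
  qed (rule is_derivation_lower is_derivation_del)+
  then show ?thesis by simp
qed

lemmas lower_exp_del = neg_exp_commute[OF linear_del linear_lower linear_lower lower_del]

lemma lower_exp_comm:
  "lower_exp n (comm f g) = (\<Sum>k\<le>n. comm (lower_exp k f) (lower_exp (n - k) g))"
proof -
  have "lower_exp n (g * f) = (\<Sum>k\<le>n. lower_exp (n - k) g * lower_exp k f)"
    unfolding neg_exp_mult[OF is_derivation_lower]
    by (rule sum.reindex_bij_witness[of _ "\<lambda>k. n - k" "\<lambda>k. n - k"]) auto
  then show ?thesis
    by (simp add: comm_def lin_diff[OF linear_lower_exp] neg_exp_mult[OF is_derivation_lower] sum_subtractf)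
qed

lemma comm_jacobi: "comm (comm f g) h - comm (comm f h) g = comm f (comm g h)"
  by (simp add: comm_def algebra_simps)

text \<open>As exp(-lower) commutes with \<partial> and is multiplicative, its terms on the bracket
  are known from those on \<psi> and \<phi>. The double sum from the commutator supplies what the
  Leibniz rule produces when one derivation acts on the letters b_(i+n) in the series of the
  other.\<close>

lemma del_bracket_A_letter:
  "del (bracket_A \<psi> \<phi>) (letter i) = del \<psi> (del \<phi> (letter i)) - del \<phi> (del \<psi> (letter i))"
proof (cases "i = 0")
  case True
  then show ?thesis by (simp add: del_letter_0 lin_zero[OF linear_del])
next
  case False
  then have i: "1 \<le> i" by simp
  obtain K1 K2 where "\<forall>n>K1. lower_exp n \<psi> = 0" "\<forall>n>K2. lower_exp n \<phi> = 0"
    using lower_exp_finite by meson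
  then obtain K where K\<psi>: "\<And>n. K < n \<Longrightarrow> lower_exp n \<psi> = 0"
    and K\<phi>: "\<And>n. K < n \<Longrightarrow> lower_exp n \<phi> = 0"
    by (metis max_less_iff_conj)
  let ?x = "\<lambda>n. lower_exp n \<psi>" let ?y = "\<lambda>n. lower_exp n \<phi>"
  have exp: "lower_exp n (bracket_A \<psi> \<phi>) =
      del \<psi> (?y n) - del \<phi> (?x n) + (\<Sum>k\<le>n. comm (?x k) (?y (n - k)))" for n
    by (simp add: bracket_A_def lin_add[OF linear_lower_exp] lin_diff[OF linear_lower_exp]
        lower_exp_del lower_exp_comm)
  have comm0: "comm (?x k) (?y m) = 0" if "K < k \<or> K < m" for k m
    using that K\<psi> K\<phi> by (auto simp: comm_def)
  have "lower_exp n (bracket_A \<psi> \<phi>) = 0" if "K + K < n" for n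
  proof -
    have "comm (?x k) (?y (n - k)) = 0" for k
      using that by (intro comm0) linarith
    then show ?thesis
      using that by (simp add: exp K\<psi> K\<phi> lin_zero[OF linear_del])
  qed
  then have "del (bracket_A \<psi> \<phi>) (letter i) =
      (\<Sum>n\<le>K + K. comm (letter (i + n)) (del \<psi> (?y n) - del \<phi> (?x n))) +
      (\<Sum>n\<le>K + K. \<Sum>k\<le>n. comm (letter (i + (k + (n - k)))) (comm (?x k) (?y (n - k))))"
    by (simp add: del_letter[OF i, of "K + K"] exp comm_add_right sum.distrib
        lin_sum[OF linear_comm_right])
  also have "(\<Sum>n\<le>K + K. comm (letter (i + n)) (del \<psi> (?y n) - del \<phi> (?x n))) =
      (\<Sum>n\<le>K. comm (letter (i + n)) (del \<psi> (?y n) - del \<phi> (?x n)))"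
    by (rule sum_atMost_extend)
      (simp_all add: K\<psi> K\<phi> lin_zero[OF linear_del] lin_zero[OF linear_comm_right])
  also have "(\<Sum>n\<le>K + K. \<Sum>k\<le>n. comm (letter (i + (k + (n - k)))) (comm (?x k) (?y (n - k)))) =
      (\<Sum>k\<le>K. \<Sum>m\<le>K. comm (letter (i + (k + m))) (comm (?x k) (?y m)))"
    by (rule sum_antidiagonal) (simp add: comm0 lin_zero[OF linear_comm_right])
  \<comment> \<open>The Jacobi identity puts b_(i+k+m) innermost, so that summing over one index
    gives \<partial>_\<psi>(b_(i+m)) or \<partial>_\<phi>(b_(i+k)).\<close>
  also have "\<dots> = (\<Sum>k\<le>K. \<Sum>m\<le>K. comm (comm (letter (i + (k + m))) (?x k)) (?y m)) -
      (\<Sum>k\<le>K. \<Sum>m\<le>K. comm (comm (letter (i + (k + m))) (?y m)) (?x k))"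
    by (simp only: comm_jacobi[symmetric] sum_subtractf)
  also have "(\<Sum>k\<le>K. \<Sum>m\<le>K. comm (comm (letter (i + (k + m))) (?x k)) (?y m)) =
      (\<Sum>m\<le>K. comm (del \<psi> (letter (i + m))) (?y m))"
    using i by (subst sum.swap)
      (simp add: del_letter[OF _ K\<psi>] lin_sum[OF linear_comm_left] ac_simps)
  also have "(\<Sum>k\<le>K. \<Sum>m\<le>K. comm (comm (letter (i + (k + m))) (?y m)) (?x k)) =
      (\<Sum>k\<le>K. comm (del \<phi> (letter (i + k))) (?x k))"
    using i by (simp add: del_letter[OF _ K\<phi>] lin_sum[OF linear_comm_left] add.assoc)
  finally show ?thesis
    by (simp add: del_letter[OF i K\<psi>] del_letter[OF i K\<phi>] lin_sum[OF linear_del]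
        is_derivation_comm[OF is_derivation_del] sum.distrib sum_subtractf
        lin_diff[OF linear_comm_right])
qed

interpretation bracket_A: derivation_bracket del bracket_A sigma
  by standard (rule bracket_A_def sigma_def is_derivation_del lin_add[OF linear_del_left]
      lin_scale[OF linear_del_left] del_bracket_A_letter)+

lemma primitive_lower: "primitive f \<Longrightarrow> primitive (lower f)"
  by (rule primitive_derivation[OF is_derivation_lower])
    (simp_all add: lower_letter primitive_scale primitive_letter)

lemma primitive_lower_exp: "primitive f \<Longrightarrow> primitive (lower_exp n f)"
proof (induction n)
  case (Suc n)
  then show ?case unfolding lower_exp_Suc by (intro primitive_scale primitive_lower)
qed (simp add: neg_exp_0)

lemma primitive_del:
  assumes "primitive \<psi>" "primitive f"
  shows "primitive (del \<psi> f)"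
proof (rule primitive_derivation[OF is_derivation_del _ assms(2)])
  fix i
  obtain K where K: "\<And>n. K < n \<Longrightarrow> lower_exp n \<psi> = 0"
    using lower_exp_finite by blast
  show "primitive (del \<psi> (letter i))"
  proof (cases "i = 0")
    case False
    then have "1 \<le> i" by simp
    then show ?thesis
      by (simp only: del_letter[OF _ K])
        (intro primitive_sum primitive_comm primitive_letter primitive_lower_exp assms(1))
  qed (simp add: del_letter_0 primitive_zero)
qed

lemma primitive_bracket_A:
  assumes "primitive \<psi>" "primitive \<phi>"
  shows "primitive (bracket_A \<psi> \<phi>)"
  using assms by (simp add: bracket_A_def primitive_add primitive_diff primitive_comm primitive_del)

section \<open>The subspace Q<B>^0 and the operators on it\<close>

lemma QB0_iff: "f \<in> QB0 \<longleftrightarrow> (\<forall>w. w \<noteq> [] \<and> last w = 0 \<longrightarrow> Poly_Mapping.lookup f w = 0)"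
  by (auto simp: QB0_def in_keys_iff)

lemma subspace_QB0: "Qvs.subspace QB0"
  by (auto simp: Qvs.subspace_def QB0_iff lookup_add)

lemmas QB0_add = Qvs.subspace_add[OF subspace_QB0]
  and QB0_scale = Qvs.subspace_scale[OF subspace_QB0]
  and QB0_sum = Qvs.subspace_sum[OF subspace_QB0]
  and QB0_zero = Qvs.subspace_0[OF subspace_QB0]

lemma mon_QB0: "w = [] \<or> last w \<noteq> 0 \<Longrightarrow> mon w \<in> QB0"
  by (simp add: QB0_def)

lemma lin_ext_QB0: "(\<And>w. w \<in> Poly_Mapping.keys f \<Longrightarrow> g w \<in> QB0) \<Longrightarrow> lin_ext g f \<in> QB0"
  unfolding lin_ext_def by (intro QB0_sum QB0_scale)

lemma pi_0_in_QB0: "pi_0 f \<in> QB0"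
  unfolding pi_0_def by (rule lin_ext_QB0) (auto intro: mon_QB0 QB0_zero)

lemma mon_blocks_QB0: "mon (blocks ps) \<in> QB0"
  by (rule mon_QB0) (use range_blocks[of "blocks ps"] in simp)

lemma tau_QB0: "tau f \<in> QB0"
  unfolding tau_def by (rule lin_ext_QB0) (auto intro: mon_blocks_QB0 QB0_zero)

lemma linear_tau: "lin tau"
  by (simp add: tau_def linear_lin_ext)

lemma QB0_eqI:
  assumes "lin S" "lin T" "f \<in> QB0" "\<And>ps. S (mon (blocks ps)) = T (mon (blocks ps))"
  shows "S f = T f"
proof (rule lin_eq_on_keys[OF assms(1,2)])
  fix w assume "w \<in> Poly_Mapping.keys f"
  then have "w \<in> range blocks"
    using assms(3) by (auto simp: range_blocks QB0_def)
  then show "S (mon w) = T (mon w)"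
    using assms(4) by auto
qed

lemma stab_tau_iff:
  "\<psi> \<in> stab_tau \<longleftrightarrow> primitive \<psi> \<and> (\<forall>f\<in>QB0. sigma0 \<psi> (tau f) = tau (sigma0 \<psi> f))"
  by (simp add: stab_tau_def Lie_def)

lemma linear_sigma0_left: "lin (\<lambda>\<psi>. sigma0 \<psi> f)"
  unfolding sigma0_def by (rule linear_comp[OF linear_pi_0 bracket_A.linear_act_left])

lemma sigma0_bracket_A: "sigma0 (bracket_A \<psi> \<phi>) f = sigma0 \<psi> (sigma0 \<phi> f) - sigma0 \<phi> (sigma0 \<psi> f)"
  using pi_0_sigma[of \<psi> "sigma \<phi> f"] pi_0_sigma[of \<phi> "sigma \<psi> f"]
  by (simp add: sigma0_def bracket_A.act_br lin_diff[OF linear_pi_0])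

lemma subspace_stab_tau: "Qvs.subspace stab_tau"
  by (auto simp: Qvs.subspace_def stab_tau_iff primitive_zero primitive_add primitive_scale
      lin_zero[OF linear_sigma0_left] lin_add[OF linear_sigma0_left]
      lin_scale[OF linear_sigma0_left] lin_zero[OF linear_tau] lin_add[OF linear_tau]
      lin_scale[OF linear_tau])

lemma bracket_A_stab_tau:
  assumes "\<psi> \<in> stab_tau" "\<phi> \<in> stab_tau"
  shows "bracket_A \<psi> \<phi> \<in> stab_tau"
proof -
  have "sigma0 \<psi> f \<in> QB0" for \<psi> f
    by (simp add: sigma0_def pi_0_in_QB0)
  then show ?thesis
    using assms by (simp add: stab_tau_iff primitive_bracket_A sigma0_bracket_A
        lin_diff[OF linear_tau])
qed

lemma lie_algebra_stab_tau: "lie_algebra_on stab_tau bracket_A"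
  by (rule bracket_A.lie_algebra_onI[OF subspace_stab_tau bracket_A_stab_tau])

section \<open>Consequences of the stabilizer condition\<close>

lemma yindex_Y: "1 \<le> n \<Longrightarrow> yindex (Y n) = n"
  by (simp add: Y_inverse)

lemma yindex_ge_1: "1 \<le> yindex y"
  using yindex[of y] by simp

section \<open>The inclusion of Q<Y> in Q<X>, a section of \<open>pi_Y\<close>\<close>

definition iota :: "yletter free_alg \<Rightarrow> xletter free_alg"
  where "iota = alg_hom (\<lambda>y. letter X0 ^ (yindex y - 1) * letter X1)"

lemma linear_iota: "lin iota"
  by (simp add: iota_def linear_alg_hom)

lemma iota_mult: "iota (f * g) = iota f * iota g"
  by (simp add: iota_def alg_hom_mult)

lemma iota_one: "iota 1 = 1"
  by (simp add: iota_def alg_hom_one)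

lemma iota_letter: "iota (letter y) = letter X0 ^ (yindex y - 1) * letter X1"
  by (simp add: iota_def alg_hom_letter)

lemma mon_yx_Cons: "mon (yx (y # v)) = letter X0 ^ (yindex y - 1) * letter X1 * mon (yx v)"
  unfolding yx_Cons mon_append mon_Cons[of X1 "yx v"] mon_replicate by (rule mult.assoc[symmetric])

lemma iota_mon: "iota (mon v) = mon (yx v)"
proof (induction v)
  case (Cons y v)
  then show ?case
    unfolding mon_Cons[of y v] mon_yx_Cons by (simp add: iota_mult iota_letter)
qed (simp add: mon_Nil iota_one)

lemma pi_Y_iota: "pi_Y (iota q) = q"
  by (rule linear_eqI[where S = "\<lambda>q. pi_Y (iota q)"])
    (rule linear_comp[OF linear_pi_Y linear_iota] linear_ident
      | simp add: iota_mon pi_Y_yx)+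

lemma iota_pi_Y: "\<exists>g. f = iota (pi_Y f) + g * letter X0"
proof (induction f rule: free_alg_induct)
  case (scale c w)
  show ?case
  proof (cases "w \<in> range yx")
    case True
    then show ?thesis
      by (intro exI[of _ 0]) (auto simp: lin_scale[OF linear_pi_Y] lin_scale[OF linear_iota]
          pi_Y_yx iota_mon)
  next
    case False
    then obtain u where "w = u @ [X0]"
      by (cases w rule: rev_exhaust) (auto simp: range_yx intro: xletter.exhaust)
    then have "c *\<^sub>Q mon w = (c *\<^sub>Q mon u) * letter X0"
      by (simp add: mon_append scale_mult_left)
    then show ?thesis
      by (intro exI[of _ "c *\<^sub>Q mon u"]) (simp add: pi_Y_X0 lin_zero[OF linear_iota])
  qed
next
  case (add f g)
  then obtain f' g' where "f = iota (pi_Y f) + f' * letter X0" "g = iota (pi_Y g) + g' * letter X0"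
    by blast
  from arg_cong2[OF this, of "(+)"]
  have "f + g = (iota (pi_Y f) + f' * letter X0) + (iota (pi_Y g) + g' * letter X0)" .
  also have "\<dots> = iota (pi_Y (f + g)) + (f' + g') * letter X0"
    by (simp add: lin_add[OF linear_pi_Y] lin_add[OF linear_iota] algebra_simps)
  finally show ?case ..
qed

lemma pi_Y_iota_mult: "pi_Y (iota q * f) = q * pi_Y f"
proof -
  obtain g where "f = iota (pi_Y f) + g * letter X0"
    using iota_pi_Y by blast
  then have "iota q * f = iota (q * pi_Y f) + (iota q * g) * letter X0"
    by (metis iota_mult distrib_left mult.assoc)
  then show ?thesis
    by (simp add: lin_add[OF linear_pi_Y] pi_Y_iota pi_Y_X0)
qed

lemma iota_pi_Y_X1: "iota (pi_Y (f * letter X1)) = f * letter X1"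
proof (rule linear_eqI[where S = "\<lambda>f. iota (pi_Y (f * letter X1))"])
  show "iota (pi_Y (mon w * letter X1)) = mon w * letter X1" for w
  proof -
    have "w @ [X1] \<in> range yx" by (simp add: range_yx)
    then obtain v where "w @ [X1] = yx v" by blast
    then show ?thesis
      unfolding mon_append[symmetric] by (simp add: pi_Y_yx iota_mon)
  qed
qed (rule linear_comp[OF linear_iota linear_comp[OF linear_pi_Y linear_mult_right]]
    linear_mult_right)+

lemma mult_letter_cancel:
  assumes "f * letter a = g * letter a"
  shows "f = g"
proof (rule poly_mapping_eqI)
  show "Poly_Mapping.lookup f w = Poly_Mapping.lookup g w" for w
    using lookup_mult_letter[of f a w a] lookup_mult_letter[of g a w a] assms by simp
qed

text \<open>Words ending in x_1 lie in the range of \<open>yx\<close>, so \<open>pi_Y\<close> loses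
  nothing on multiples of x_1, and x_1 cancels on the right.\<close>

lemma pi_Y_X1_inject:
  assumes "pi_Y (f * letter X1) = pi_Y (g * letter X1)"
  shows "f = g"
proof (rule mult_letter_cancel)
  show "f * letter X1 = g * letter X1"
    using arg_cong[OF assms, of iota] by (simp only: iota_pi_Y_X1)
qed

section \<open>Deletion of a letter x_0 and its counterparts on Q<Y> and Q<B>\<close>

definition dX :: "xletter free_alg \<Rightarrow> xletter free_alg"
  where "dX = derivation (\<lambda>b. if b = X0 then 1 else 0)"

text \<open>The counterpart of \<open>dX\<close> under \<open>iota\<close>, by
  \<open>dX_iota\<close>. For y_1 the argument of \<open>Y\<close> is 0, which is no index, but the
  coefficient is 0 as well.\<close>

definition dY :: "yletter free_alg \<Rightarrow> yletter free_alg"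
  where "dY = derivation (\<lambda>y. of_nat (yindex y - 1) *\<^sub>Q letter (Y (yindex y - 1)))"

lemma is_derivation_dX: "is_derivation dX" and is_derivation_dY: "is_derivation dY"
  by (simp_all add: dX_def dY_def is_derivation_derivation)

lemmas linear_dX = is_derivation_lin[OF is_derivation_dX]
  and linear_dY = is_derivation_lin[OF is_derivation_dY]

lemma dX_X0: "dX (letter X0) = 1" and dX_X1: "dX (letter X1) = 0"
  by (simp_all add: dX_def derivation_letter)

lemma dY_letter: "dY (letter y) = of_nat (yindex y - 1) *\<^sub>Q letter (Y (yindex y - 1))"
  by (simp add: dY_def derivation_letter)

lemma dX_X0_power: "dX (letter X0 ^ n) = of_nat n *\<^sub>Q letter X0 ^ (n - 1)"
proof (induction n)
  case (Suc n)
  have "letter X0 * (of_nat n *\<^sub>Q letter X0 ^ (n - 1)) = of_nat n *\<^sub>Q letter X0 ^ n"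
    by (cases n) (simp_all add: scale_mult_right)
  with Suc show ?case
    by (simp add: is_derivation_mult[OF is_derivation_dX] dX_X0 Qvs.scale_left_distrib)
qed (simp add: is_derivation_one[OF is_derivation_dX])

lemma dX_iota: "dX (iota q) = iota (dY q)"
proof (rule lin_mult_eqI[where S = "\<lambda>q. dX (iota q)"])
  fix y v
  assume IH: "dX (iota (mon v)) = iota (dY (mon v))"
  have "dX (iota (letter y)) = iota (dY (letter y))"
  proof (cases "yindex y = 1")
    case True
    then show ?thesis
      by (simp add: iota_letter dX_X1 dY_letter lin_zero[OF linear_iota])
  next
    case False
    then have "1 \<le> yindex y - 1" using yindex_ge_1[of y] by linarith
    then show ?thesis
      by (simp add: iota_letter dX_X1 dX_X0_power dY_letter lin_scale[OF linear_iota] yindex_Y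
          is_derivation_mult[OF is_derivation_dX] scale_mult_left)
  qed
  with IH show "dX (iota (letter y * mon v)) = iota (dY (letter y * mon v))"
    by (simp add: iota_mult is_derivation_mult[OF is_derivation_dX]
        is_derivation_mult[OF is_derivation_dY] lin_add[OF linear_iota])
qed (rule linear_comp[OF linear_dX linear_iota] linear_comp[OF linear_iota linear_dY]
    | simp add: iota_one is_derivation_one[OF is_derivation_dX] is_derivation_one[OF is_derivation_dY]
        lin_zero[OF linear_iota])+

lemma linear_theta_Y: "lin theta_Y"
  by (simp add: theta_Y_def linear_alg_antihom)

lemma theta_Y_mult: "theta_Y (f * g) = theta_Y g * theta_Y f"
  by (simp add: theta_Y_def alg_antihom_mult)

lemma theta_Y_one: "theta_Y 1 = 1"
  by (simp add: theta_Y_def alg_antihom_one)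

lemma theta_Y_letter: "theta_Y (letter y) = letter (yindex y)"
  by (simp add: theta_Y_def alg_antihom_letter)

text \<open>Links \<open>section_pi_Y\<close> with \<open>del_letter\<close>: \<open>theta_Y\<close>
  carries \<open>dY\<close> to the operator behind \<partial>. The formulas agree on letters, and
  reversing products respects the Leibniz rule.\<close>

lemma theta_Y_dY: "lower (theta_Y q) = theta_Y (dY q)"
proof (rule lin_mult_eqI[where S = "\<lambda>q. lower (theta_Y q)"])
  fix y v
  assume IH: "lower (theta_Y (mon v)) = theta_Y (dY (mon v))"
  have "lower (theta_Y (letter y)) = theta_Y (dY (letter y))"
  proof (cases "yindex y = 1")
    case True
    then show ?thesis
      by (simp add: theta_Y_letter lower_letter dY_letter lin_zero[OF linear_theta_Y])
  next
    case False
    then have "1 \<le> yindex y - 1" using yindex_ge_1[of y] by linarith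
    then show ?thesis
      by (simp add: theta_Y_letter lower_letter dY_letter lin_scale[OF linear_theta_Y] yindex_Y)
  qed
  with IH show "lower (theta_Y (letter y * mon v)) = theta_Y (dY (letter y * mon v))"
    by (simp add: theta_Y_mult is_derivation_mult[OF is_derivation_lower]
        is_derivation_mult[OF is_derivation_dY] lin_add[OF linear_theta_Y] add.commute)
qed (rule linear_comp[OF linear_lower linear_theta_Y] linear_comp[OF linear_theta_Y linear_dY]
    | simp add: theta_Y_one is_derivation_one[OF is_derivation_lower]
        is_derivation_one[OF is_derivation_dY] lin_zero[OF linear_theta_Y])+

text \<open>The series exp(-dX) sends x_0 to x_0 - 1, so only two terms of the product rule
  remain.\<close>

lemma neg_exp_dX_X0: "neg_exp dX (Suc n) (g * letter X0) = neg_exp dX (Suc n) g * letter X0 - neg_exp dX n g"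
proof (induction n)
  case 0
  show ?case
    by (simp add: neg_exp_Suc[OF linear_dX] neg_exp_0 is_derivation_mult[OF is_derivation_dX] dX_X0
        scale_mult_left Qvs.scale_right_distrib)
next
  case (Suc n)
  have "neg_exp dX (Suc (Suc n)) (g * letter X0) = - (1 / of_nat (Suc (Suc n))) *\<^sub>Q
      (dX (neg_exp dX (Suc n) g) * letter X0 + neg_exp dX (Suc n) g - dX (neg_exp dX n g))"
    by (simp only: neg_exp_Suc[OF linear_dX, of "Suc n"] Suc lin_diff[OF linear_dX]
        is_derivation_mult[OF is_derivation_dX] dX_X0 mult_1_right)
  also have "\<dots> = - (1 / of_nat (Suc (Suc n))) *\<^sub>Q
      (dX (neg_exp dX (Suc n) g) * letter X0 + of_nat (Suc (Suc n)) *\<^sub>Q neg_exp dX (Suc n) g)"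
    by (simp only: deriv_neg_exp[OF linear_dX, of n] diff_minus_eq_add add.assoc
        of_nat_Suc[of "Suc n"] Qvs.scale_left_distrib Qvs.scale_one)
  also have "\<dots> = neg_exp dX (Suc (Suc n)) g * letter X0 - neg_exp dX (Suc n) g"
    by (simp add: neg_exp_Suc[OF linear_dX, of "Suc n"] Qvs.scale_right_distrib scale_mult_left
        Qvs.scale_right_diff_distrib del: of_nat_Suc)
  finally show ?case .
qed

text \<open>Telescopes by \<open>neg_exp_dX_X0\<close>; the remaining term is 0 for \<open>K\<close>
  beyond the bound in \<open>neg_exp_dX_finite\<close>.\<close>

lemma sum_neg_exp_dX_X0:
  "(\<Sum>n\<le>K. neg_exp dX n (g * letter X0) * letter X0 ^ n) = neg_exp dX K g * letter X0 ^ Suc K"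
  by (induction K) (simp_all add: neg_exp_0 neg_exp_dX_X0 algebra_simps power_commutes)

lemma neg_exp_dX_finite: "\<exists>K. \<forall>n>K. neg_exp dX n f = 0"
proof (rule neg_exp_finite[OF is_derivation_dX])
  fix a
  have "dX (dX (letter a)) = 0"
    by (cases a) (simp_all add: dX_X0 dX_X1 is_derivation_one[OF is_derivation_dX]
        lin_zero[OF linear_dX])
  then have "neg_exp dX n (dX (letter a)) = 0" if "0 < n" for n
    using that by (intro neg_exp_eq_0[OF linear_dX])
  moreover have "neg_exp dX (Suc n) f = - (1 / of_nat (Suc n)) *\<^sub>Q neg_exp dX n (dX f)" for n f
    using neg_exp_commute[OF linear_dX linear_dX linear_dX, of n f]
    by (simp only: neg_exp_Suc[OF linear_dX])
  ultimately have "neg_exp dX n (letter a) = 0" if "1 < n" for n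
    using that by (cases n) (simp_all del: of_nat_Suc)
  then show "\<exists>K. \<forall>n>K. neg_exp dX n (letter a) = 0" by blast
qed

text \<open>The operator \<open>f \<mapsto> \<Sum> (-1)\<^sup>n/n! dX\<^sup>n(f) x\<^sub>0\<^sup>n\<close> kills multiples of \<open>x\<^sub>0\<close> and fixes the kernel
  of \<open>dX\<close>, so elements of the kernel are recovered from their image under \<open>\<pi>\<^sub>Y\<close>.\<close>

lemma section_pi_Y:
  assumes "dX \<psi> = 0"
  shows "\<exists>K0. \<forall>K\<ge>K0. \<psi> = (\<Sum>n\<le>K. iota (neg_exp dY n (pi_Y \<psi>)) * letter X0 ^ n)"
proof -
  obtain g where g: "\<psi> = iota (pi_Y \<psi>) + g * letter X0"
    using iota_pi_Y by blast
  obtain K0 where K0: "\<And>n. K0 < n \<Longrightarrow> neg_exp dX n g = 0"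
    using neg_exp_dX_finite by blast
  have "\<psi> = (\<Sum>n\<le>K. iota (neg_exp dY n (pi_Y \<psi>)) * letter X0 ^ n)" if "Suc K0 \<le> K" for K
  proof -
    have "neg_exp dX n \<psi> * letter X0 ^ n = (if n = 0 then \<psi> else 0)" for n
      by (simp add: neg_exp_0 neg_exp_eq_0[OF linear_dX assms])
    then have "\<psi> = (\<Sum>n\<le>K. neg_exp dX n \<psi> * letter X0 ^ n)"
      by simp
    also have "\<dots> = (\<Sum>n\<le>K. neg_exp dX n (iota (pi_Y \<psi>) + g * letter X0) * letter X0 ^ n)"
      using g by simp
    also have "\<dots> = (\<Sum>n\<le>K. neg_exp dX n (iota (pi_Y \<psi>)) * letter X0 ^ n) +
        (\<Sum>n\<le>K. neg_exp dX n (g * letter X0) * letter X0 ^ n)"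
      by (simp add: lin_add[OF linear_neg_exp[OF linear_dX]] distrib_right sum.distrib)
    also have "(\<Sum>n\<le>K. neg_exp dX n (g * letter X0) * letter X0 ^ n) = 0"
      using that by (simp add: sum_neg_exp_dX_X0 K0)
    finally show ?thesis
      by (simp add: neg_exp_commute[OF linear_iota linear_dY linear_dX dX_iota])
  qed
  then show ?thesis by blast
qed

text \<open>Reversing an X-word with the sign of its depth realises the antipode of \<open>\<rat>\<langle>Y\<rangle>\<close> on
  \<open>\<rat>\<langle>X\<rangle> x\<^sub>1\<close>.\<close>

definition rho :: "xletter free_alg \<Rightarrow> xletter free_alg"
  where "rho = alg_antihom (\<lambda>a. case a of X0 \<Rightarrow> letter X0 | X1 \<Rightarrow> - letter X1)"

lemma linear_rho: "lin rho"
  by (simp add: rho_def linear_alg_antihom)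

lemma rho_mult: "rho (f * g) = rho g * rho f"
  by (simp add: rho_def alg_antihom_mult)

lemma rho_one: "rho 1 = 1"
  by (simp add: rho_def alg_antihom_one)

lemma rho_X0: "rho (letter X0) = letter X0" and rho_X1: "rho (letter X1) = - letter X1"
  by (simp_all add: rho_def alg_antihom_letter)

lemma rho_X0_power: "rho (letter X0 ^ n) = letter X0 ^ n"
  by (induction n) (simp_all add: rho_one rho_mult rho_X0 power_commutes)

lemma linear_antipode: "lin antipode"
  by (rule linear_alg_antihom)

lemma lookup_antihom_sign:
  assumes "\<And>a. g a = s a *\<^sub>Q letter a"
  shows "Poly_Mapping.lookup (alg_antihom g f) w = prod_list (map s w) * Poly_Mapping.lookup f (rev w)"
proof (induction f rule: free_alg_induct)
  case (scale c v)
  have "alg_antihom g (mon v) = prod_list (map s v) *\<^sub>Q mon (rev v)" for v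
  proof (induction v)
    case (Cons a v)
    then show ?case
      unfolding mon_Cons[of a v] alg_antihom_mult alg_antihom_letter assms
      by (simp add: scale_mult_left scale_mult_right mon_append mult.commute)
  qed (simp add: mon_Nil alg_antihom_one)
  moreover have "prod_list (map s (rev w)) = prod_list (map s w)"
    by (induction w) (simp_all add: mult.commute)
  ultimately show ?case
    by (auto simp: lin_scale[OF linear_alg_antihom] lookup_single when_def)
next
  case (add f g)
  then show ?case
    by (simp add: lin_add[OF linear_alg_antihom] lookup_add algebra_simps)
qed

lemma lookup_antipode: "Poly_Mapping.lookup (antipode f) w = (- 1) ^ length w * Poly_Mapping.lookup f (rev w)"
  using lookup_antihom_sign[of "\<lambda>a. - letter a" "\<lambda>a. - 1" f w]
  by (simp add: map_replicate_const prod_list_replicate)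

lemma lookup_rho:
  "Poly_Mapping.lookup (rho f) w =
     prod_list (map (\<lambda>a. case a of X0 \<Rightarrow> 1 | X1 \<Rightarrow> - 1) w) * Poly_Mapping.lookup f (rev w)"
  unfolding rho_def by (rule lookup_antihom_sign) (simp split: xletter.split)

text \<open>Reversal puts each x_1 in front of its power of x_0. The x_1 multiplied on the right
  closes the last block and leaves one x_1 free on the left. Each block contains one x_1, hence one
  sign, like a letter under the antipode.\<close>

lemma rho_yx: "rho (mon (yx v)) * letter X1 = letter X1 * iota (antipode (mon v))"
proof (induction v)
  case (Cons y v)
  have "rho (mon (yx (y # v))) * letter X1 =
      - (rho (mon (yx v)) * letter X1) * (letter X0 ^ (yindex y - 1) * letter X1)"
    by (simp add: mon_yx_Cons rho_mult rho_X1 rho_X0_power mult.assoc)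
  also have "\<dots> = letter X1 * iota (antipode (mon (y # v)))"
    unfolding Cons mon_Cons[of y v] alg_antihom_mult alg_antihom_letter iota_mult
      lin_minus[OF linear_iota] iota_letter
    by (simp add: mult.assoc)
  finally show ?case .
qed (simp add: mon_Nil rho_one alg_antihom_one iota_one)

lemma word_eq_yx_replicate: "\<exists>v r. w = yx v @ replicate r X0"
proof (induction w rule: rev_induct)
  case Nil
  show ?case by (rule exI[of _ "[]"]) auto
next
  case (snoc a w)
  then obtain v r where w: "w = yx v @ replicate r X0" by blast
  show ?case
  proof (cases a)
    case X0
    then have "w @ [a] = yx v @ replicate (Suc r) X0"
      by (simp add: w replicate_append_same)
    then show ?thesis by blast
  next
    case X1
    then have "w @ [a] = yx (v @ [Y (Suc r)]) @ replicate 0 X0"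
      by (simp add: w yx_snoc yindex_Y)
    then show ?thesis by blast
  qed
qed

text \<open>The block completed by the factor x_1 has its own sign under the antipode, whereas
  \<open>rho\<close> acts before that x_1 is attached; hence the minus.\<close>

lemma antipode_pi_Y: "antipode (pi_Y (h * letter X1)) = - pi_Y (rho h * letter X1)"
proof (rule linear_eqI[where S = "\<lambda>h. antipode (pi_Y (h * letter X1))"])
  fix w
  obtain v r where "w = yx v @ replicate r X0"
    using word_eq_yx_replicate by blast
  then have w: "mon w = iota (mon v) * letter X0 ^ r"
    by (simp add: mon_append mon_replicate iota_mon)
  have y: "letter X0 ^ r * letter X1 = iota (letter (Y (Suc r)))"
    by (simp add: iota_letter yindex_Y)
  have "rho (mon w) * letter X1 = letter X0 ^ r * (rho (mon (yx v)) * letter X1)"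
    by (simp add: w rho_mult rho_X0_power iota_mon mult.assoc)
  also have "\<dots> = iota (letter (Y (Suc r)) * antipode (mon v))"
    unfolding rho_yx by (simp only: iota_mult y[symmetric] mult.assoc)
  finally have "pi_Y (rho (mon w) * letter X1) = letter (Y (Suc r)) * antipode (mon v)"
    by (simp add: pi_Y_iota)
  moreover have "pi_Y (mon w * letter X1) = mon v * letter (Y (Suc r))"
    by (simp only: w mult.assoc y pi_Y_iota_mult pi_Y_iota)
  ultimately show "antipode (pi_Y (mon w * letter X1)) = - pi_Y (rho (mon w) * letter X1)"
    by (simp add: alg_antihom_mult alg_antihom_letter)
next
  show "lin (\<lambda>h. antipode (pi_Y (h * letter X1)))"
    by (rule linear_comp[OF linear_antipode linear_comp[OF linear_pi_Y linear_mult_right]])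
  have "lin (\<lambda>h. 0 - pi_Y (rho h * letter X1))"
    by (rule linear_diff[OF linear_const_zero
        linear_comp[OF linear_pi_Y linear_comp[OF linear_mult_right linear_rho]]])
  then show "lin (\<lambda>h. - pi_Y (rho h * letter X1))"
    by simp
qed

text \<open>Comparing h x_0 with x_0 h at x_0^r x_1 u x_0 moves one x_0 from the front of a word to
  its end without changing the coefficient. When no leading x_0 is left, the coefficient is 0. So
  only powers of x_0 can occur in \<open>h\<close>.\<close>

lemma centralizer_X0:
  assumes comm: "h * letter X0 = letter X0 * h"
    and X0: "\<And>n. Poly_Mapping.lookup h (replicate n X0) = 0"
  shows "h = 0"
proof (rule poly_mapping_eqI)
  have *: "Poly_Mapping.lookup h (replicate r X0 @ X1 # u) = 0" for r u
  proof (induction r arbitrary: u)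
    case 0
    then show ?case
      using lookup_mult_letter[of h X0 "X1 # u" X0] by (simp add: comm lookup_letter_mult)
  next
    case (Suc r)
    then show ?case
      using lookup_mult_letter[of h X0 "replicate (Suc r) X0 @ X1 # u" X0]
      by (simp add: comm lookup_letter_mult)
  qed
  fix w
  have "(\<exists>n. w = replicate n X0) \<or> (\<exists>r u. w = replicate r X0 @ X1 # u)"
  proof (induction w)
    case Nil
    then show ?case by simp
  next
    case (Cons a w)
    show ?case
    proof (cases a)
      case X1
      then have "a # w = replicate 0 X0 @ X1 # w" by simp
      then show ?thesis by blast
    next
      case X0
      with Cons show ?thesis
        by (metis append_Cons replicate_Suc)
    qed
  qed
  then show "Poly_Mapping.lookup h w = Poly_Mapping.lookup 0 w"
    using * X0 by auto
qed

section \<open>The stabilizer condition at 1 and at y_2\<close>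

lemma sY_iota: "sY \<psi> q = pi_Y (s_map \<psi> (iota q))"
  using fun_cong[OF pi_Y_s_map, of \<psi> "iota q"] by (simp add: pi_Y_iota)

lemma s_map_mult: "s_map \<psi> (f * g) = (s_map \<psi> f - f * \<psi>) * g + f * s_map \<psi> g"
  by (simp add: s_map_def is_derivation_mult[OF is_derivation_d_der] algebra_simps)

lemma s_map_X1: "s_map \<psi> (letter X1) = letter X1 * \<psi>"
  by (simp add: s_map_def d_der_X1 comm_def)

lemma stab_primitive_pi_Y:
  assumes "\<psi> \<in> stab_DeltaY"
  shows "primitive (pi_Y \<psi>)"
proof -
  have "sY \<psi> 1 = pi_Y \<psi>"
    by (simp add: sY_iota iota_one ihara.act_one)
  moreover have "coder (sY \<psi>) (coprod 1) = coprod (sY \<psi> 1)"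
    using assms by (simp add: stab_DeltaY_iff)
  ultimately show ?thesis
    by (simp add: coprod_one coder_tensor[OF linear_sY] primitive_def)
qed

text \<open>From s_\<psi>(x_0 x_1) = [\<psi>, x_0] x_1 + x_0 x_1 \<psi> one gets
  \<open>?G + ?y * ?q\<close> as the value of \<open>sY \<psi>\<close> at y_2. Since
  \<open>?q\<close> is primitive, all terms of the condition at y_2 that contain \<open>?q\<close>
  cancel.\<close>

lemma stab_primitive_comm_X0:
  assumes "\<psi> \<in> stab_DeltaY"
  shows "primitive (pi_Y (comm \<psi> (letter X0) * letter X1))"
proof -
  let ?y = "letter (Y 2)" let ?q = "pi_Y \<psi>" let ?G = "pi_Y (comm \<psi> (letter X0) * letter X1)"
  have q: "coprod ?q = ?q \<otimes> 1 + 1 \<otimes> ?q"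
    using stab_primitive_pi_Y[OF assms] by (simp add: primitive_def)
  have y: "iota ?y = letter X0 * letter X1"
    by (simp add: iota_letter yindex_Y)
  have "s_map \<psi> (letter X0 * letter X1) = comm \<psi> (letter X0) * letter X1 + iota ?y * \<psi>"
    unfolding s_map_mult[of \<psi> "letter X0"] s_map_X1
    by (simp add: s_map_def d_der_X0 comm_def y mult.assoc)
  then have sy: "sY \<psi> ?y = ?G + ?y * ?q"
    by (simp add: sY_iota y lin_add[OF linear_pi_Y] pi_Y_iota_mult[of ?y, unfolded y])
  have s1: "sY \<psi> 1 = ?q"
    by (simp add: sY_iota iota_one ihara.act_one)
  have "coder (sY \<psi>) (coprod ?y) = coprod (sY \<psi> ?y)"
    using assms by (simp add: stab_DeltaY_iff)
  then show ?thesis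
    by (simp add: coprod_letter lin_add[OF linear_coder] coder_tensor[OF linear_sY] sy s1
        lin_add[OF linear_coprod] coprod_mult q tensor_mult primitive_def tensor_add_left
        tensor_add_right algebra_simps)
qed

text \<open>For h = [\<psi>, x_0], the antipode on the primitive element pi_Y(h x_1) gives rho h =
  h. As \<open>rho\<close> reverses products and fixes x_0, \<psi> + rho \<psi> commutes with x_0.
  Its coefficients at powers of x_0 vanish by primitivity of \<psi> and the assumption at
  x_0.\<close>

lemma rho_stab:
  assumes \<psi>: "\<psi> \<in> stab_DeltaY" and X0: "Poly_Mapping.lookup \<psi> [X0] = 0"
  shows "rho \<psi> = - \<psi>"
proof -
  let ?h = "comm \<psi> (letter X0)"
  have "pi_Y (?h * letter X1) = pi_Y (rho ?h * letter X1)"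
    using primitive_antipode[OF stab_primitive_comm_X0[OF \<psi>]] by (simp add: antipode_pi_Y)
  then have "?h = rho ?h"
    by (rule pi_Y_X1_inject)
  then have "?h = letter X0 * rho \<psi> - rho \<psi> * letter X0"
    by (simp add: comm_def lin_diff[OF linear_rho] rho_mult rho_X0)
  then have "(\<psi> + rho \<psi>) * letter X0 = letter X0 * (\<psi> + rho \<psi>)"
    by (simp add: comm_def algebra_simps)
  moreover have "Poly_Mapping.lookup (\<psi> + rho \<psi>) (replicate n X0) = 0" for n
  proof -
    have "Poly_Mapping.lookup \<psi> (replicate n X0) = 0"
      using primitive_lookup_replicate[of \<psi> n X0] \<psi> X0
      by (cases "n = 1") (auto simp: stab_DeltaY_iff)
    then show ?thesis
      by (simp add: lookup_add lookup_rho)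
  qed
  ultimately have "\<psi> + rho \<psi> = 0"
    by (rule centralizer_X0)
  then show ?thesis
    by (metis add.commute eq_neg_iff_add_eq_0)
qed

lemma stab_in_ls:
  assumes \<psi>: "\<psi> \<in> stab_DeltaY"
    and X0: "Poly_Mapping.lookup \<psi> [X0] = 0" and X1: "Poly_Mapping.lookup \<psi> [X1] = 0"
  shows "\<psi> \<in> ls"
proof -
  have prim: "primitive \<psi>"
    using \<psi> by (simp add: stab_DeltaY_iff)
  have "Poly_Mapping.lookup \<psi> (replicate (n - 1) X0 @ [X1]) = 0" if "2 \<le> n" "even n" for n
  proof -
    let ?w = "replicate (n - 1) X0 @ [X1]"
    \<comment> \<open>With a single x_1 in the word, \<open>rho_stab\<close> makes the coefficient
      invariant under reversal; the antipode makes it change sign when the length is even.\<close>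
    have "Poly_Mapping.lookup \<psi> ?w = Poly_Mapping.lookup \<psi> (rev ?w)"
      using lookup_rho[of \<psi> ?w] by (simp add: rho_stab[OF \<psi> X0])
    moreover have "- Poly_Mapping.lookup \<psi> ?w = Poly_Mapping.lookup \<psi> (rev ?w)"
      using lookup_antipode[of \<psi> ?w] that by (simp add: primitive_antipode[OF prim])
    ultimately show ?thesis by simp
  qed
  then show ?thesis
    using prim stab_primitive_pi_Y[OF \<psi>] X0 X1 by (simp add: ls_def)
qed

lemma s_map_X0_left: "s_map (letter X0) f = f * letter X0"
proof -
  have "d_der (letter X0) f = f * letter X0 - letter X0 * f"
  proof -
    have "d_der (letter X0) f = - 1 *\<^sub>Q (letter X0 * f - f * letter X0)"
    proof (rule is_derivation_eqI[OF is_derivation_d_der is_derivation_scale[OF is_derivation_ad]])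
      show "d_der (letter X0) (letter a) = - 1 *\<^sub>Q (letter X0 * letter a - letter a * letter X0)" for a
        by (cases a) (simp_all add: d_der_X0 d_der_X1 comm_def)
    qed
    then show ?thesis by simp
  qed
  then show ?thesis by (simp add: s_map_def)
qed

lemma s_map_X1_left: "s_map (letter X1) f = letter X1 * f"
proof -
  have "d_der (letter X1) f = 0"
  proof (rule is_derivation_eqI[OF is_derivation_d_der is_derivation_zero])
    show "d_der (letter X1) (letter a) = 0" for a
      by (cases a) (simp_all add: d_der_X0 d_der_X1 comm_def)
  qed
  then show ?thesis by (simp add: s_map_def)
qed

lemma X0_stab: "letter X0 \<in> stab_DeltaY"
proof -
  have "sY (letter X0) = (\<lambda>f. 0)"
    by (simp add: fun_eq_iff sY_iota s_map_X0_left pi_Y_X0)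
  then show ?thesis
    by (simp add: stab_DeltaY_iff primitive_letter lin_zero[OF linear_coprod] coder_zero)
qed

lemma X1_stab: "letter X1 \<in> stab_DeltaY"
proof -
  have y: "iota (letter (Y 1)) = letter X1"
    by (simp add: iota_letter yindex_Y)
  have sY: "sY (letter X1) = (\<lambda>f. letter (Y 1) * f)"
    by (simp add: fun_eq_iff sY_iota s_map_X1_left pi_Y_iota_mult[of "letter (Y 1)", unfolded y] pi_Y_iota)
  have "coder (\<lambda>f. letter a * f) X = coprod (letter a) * X" for a and X :: "yletter free_alg2"
    by (rule tensor_eqI[OF linear_coder linear_mult_left])
      (simp add: coder_tensor[OF linear_mult_left] coprod_letter distrib_right tensor_mult)
  then show ?thesis
    by (simp add: stab_DeltaY_iff primitive_letter sY coprod_mult)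
qed

text \<open>Subtracting the linear part stays in the stabilizer, and \<open>stab_in_ls\<close>
  applies to the rest. Membership of \<psi> in \<open>stab_DeltaY\<close> is kept because the
  results on \<open>theta\<close> are stated for stabilizer elements.\<close>

lemma stab_decompose:
  assumes "f \<in> stab_DeltaY"
  obtains \<psi> c1 c0 where "\<psi> \<in> stab_DeltaY" "\<psi> \<in> ls" "f = \<psi> + c1 *\<^sub>Q letter X1 + c0 *\<^sub>Q letter X0"
proof -
  define c1 c0 where "c1 = Poly_Mapping.lookup f [X1]" "c0 = Poly_Mapping.lookup f [X0]"
  define \<psi> where "\<psi> = f - c1 *\<^sub>Q letter X1 - c0 *\<^sub>Q letter X0"
  have "\<psi> \<in> stab_DeltaY"
    unfolding \<psi>_def using assms X0_stab X1_stab
    by (intro Qvs.subspace_diff Qvs.subspace_scale subspace_stab_DeltaY)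
  moreover from this have "\<psi> \<in> ls"
    by (rule stab_in_ls) (simp_all add: \<psi>_def c1_c0_def lookup_minus lookup_single when_def)
  ultimately show thesis
    by (rule that[of \<psi> c1 c0]) (simp add: \<psi>_def)
qed

section \<open>The morphism\<close>

lemma linear_theta_X: "lin theta_X"
  by (simp add: theta_X_def linear_alg_hom)

lemma theta_X_mult: "theta_X (f * g) = theta_X f * theta_X g"
  by (simp add: theta_X_def alg_hom_mult)

lemma theta_X_one: "theta_X 1 = 1"
  by (simp add: theta_X_def alg_hom_one)

lemma theta_X_X0: "theta_X (letter X0) = letter 0" and theta_X_X1: "theta_X (letter X1) = letter 1"
  by (simp_all add: theta_X_def alg_hom_letter)

lemma theta_X_X0_power: "theta_X (letter X0 ^ n) = letter 0 ^ n"
  by (induction n) (simp_all add: theta_X_one theta_X_mult theta_X_X0)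

lemma theta_X_comm: "theta_X (comm f g) = comm (theta_X f) (theta_X g)"
  by (simp add: comm_def lin_diff[OF linear_theta_X] theta_X_mult)

lemma primitive_theta_X: "primitive f \<Longrightarrow> primitive (theta_X f)"
  unfolding theta_X_def by (rule primitive_alg_hom) (simp_all add: primitive_letter split: xletter.split)

text \<open>\<open>theta_Y\<close> reverses products, so \<open>primitive_alg_hom\<close> does not
  apply directly. Composed with the antipode it is a homomorphism with primitive values on letters,
  and on primitive elements the antipode is only a sign.\<close>

lemma primitive_theta_Y:
  assumes "primitive f"
  shows "primitive (theta_Y f)"
proof -
  have "theta_Y (antipode f) = alg_hom (\<lambda>y. - letter (yindex y)) f"
  proof (rule lin_mult_eqI[where S = "\<lambda>f. theta_Y (antipode f)"])
    show "theta_Y (antipode (letter y * mon v)) = alg_hom (\<lambda>y. - letter (yindex y)) (letter y * mon v)"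
      if "theta_Y (antipode (mon v)) = alg_hom (\<lambda>y. - letter (yindex y)) (mon v)" for y v
      by (simp add: alg_antihom_mult alg_antihom_letter theta_Y_mult lin_minus[OF linear_theta_Y]
          theta_Y_letter that alg_hom_mult alg_hom_letter)
  qed (rule linear_comp[OF linear_theta_Y linear_antipode] linear_alg_hom
      | simp add: alg_antihom_one theta_Y_one alg_hom_one)+
  then have "primitive (theta_Y (antipode f))"
    using primitive_alg_hom[of "\<lambda>y. - letter (yindex y)" f] assms
    by (simp add: primitive_minus primitive_letter)
  then have "primitive (- theta_Y f)"
    by (simp add: primitive_antipode[OF assms] lin_minus[OF linear_theta_Y])
  from primitive_minus[OF this] show ?thesis by simp
qed

lemma lower_theta_X: "lower (theta_X f) = 0"
proof (rule lin_mult_eqI[where S = "\<lambda>f. lower (theta_X f)" and T = "\<lambda>f. 0"])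
  show "lower (theta_X (letter a * mon w)) = 0" if "lower (theta_X (mon w)) = 0" for a w
    using that by (cases a) (simp_all add: theta_X_mult theta_X_X0 theta_X_X1 lower_letter
        is_derivation_mult[OF is_derivation_lower])
qed (rule linear_comp[OF linear_lower linear_theta_X] linear_const_zero
    | simp add: theta_X_one is_derivation_one[OF is_derivation_lower])+

text \<open>Words in b_0 and b_1 are killed by \<open>lower\<close>, so only the term n = 0 of
  \<open>del_letter\<close> is left.\<close>

lemma del_theta_X_letter:
  assumes "1 \<le> i"
  shows "del (theta_X \<psi>) (letter i) = comm (letter i) (theta_X \<psi>)"
  using del_letter[OF assms, of 0 "theta_X \<psi>"]
  by (simp add: neg_exp_eq_0[OF linear_lower lower_theta_X] neg_exp_0)

lemma del_theta_X_theta_X: "del (theta_X \<psi>) (theta_X f) = theta_X (d_der \<psi> f)"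
proof (rule lin_mult_eqI[where S = "\<lambda>f. del (theta_X \<psi>) (theta_X f)"])
  fix a w
  assume IH: "del (theta_X \<psi>) (theta_X (mon w)) = theta_X (d_der \<psi> (mon w))"
  have "del (theta_X \<psi>) (theta_X (letter a)) = theta_X (d_der \<psi> (letter a))"
    by (cases a) (simp_all add: theta_X_X0 theta_X_X1 d_der_X0 d_der_X1 del_letter_0
        del_theta_X_letter theta_X_comm lin_zero[OF linear_theta_X])
  with IH show "del (theta_X \<psi>) (theta_X (letter a * mon w)) = theta_X (d_der \<psi> (letter a * mon w))"
    by (simp add: theta_X_mult del_mult is_derivation_mult[OF is_derivation_d_der]
        lin_add[OF linear_theta_X])
qed (rule linear_comp[OF linear_del linear_theta_X]
      linear_comp[OF linear_theta_X is_derivation_lin[OF is_derivation_d_der]]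
    | simp add: theta_X_one is_derivation_one[OF is_derivation_del]
        is_derivation_one[OF is_derivation_d_der] lin_zero[OF linear_theta_X])+

lemma del_theta_X_theta_Y: "del (theta_X \<psi>) (theta_Y q) = comm (theta_Y q) (theta_X \<psi>)"
proof (rule lin_mult_eqI[where S = "\<lambda>q. del (theta_X \<psi>) (theta_Y q)"])
  show "del (theta_X \<psi>) (theta_Y (letter y * mon v)) = comm (theta_Y (letter y * mon v)) (theta_X \<psi>)"
    if "del (theta_X \<psi>) (theta_Y (mon v)) = comm (theta_Y (mon v)) (theta_X \<psi>)" for y v
    by (simp add: theta_Y_mult del_mult that theta_Y_letter del_theta_X_letter[OF yindex_ge_1])
      (simp add: comm_def algebra_simps)
qed (rule linear_comp[OF linear_del linear_theta_Y] linear_comp[OF linear_comm_left linear_theta_Y]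
    | simp add: theta_Y_one is_derivation_one[OF is_derivation_del] comm_def)+

lemma bracket_A_theta_X: "bracket_A (theta_X \<psi>) (theta_X \<phi>) = theta_X (ihara \<psi> \<phi>)"
  by (simp add: bracket_A_def ihara_def del_theta_X_theta_X theta_X_comm lin_add[OF linear_theta_X]
      lin_diff[OF linear_theta_X])

section \<open>The involution \<open>tau\<close> on images of \<open>theta_X\<close>\<close>

definition xb :: "xletter \<Rightarrow> nat"
  where "xb a = (case a of X0 \<Rightarrow> 0 | X1 \<Rightarrow> 1)"

lemma xb_simps [simp]: "xb X0 = 0" "xb X1 = 1"
  by (simp_all add: xb_def)

lemma theta_X_mon: "theta_X (mon w) = mon (map xb w)"
proof (induction w)
  case (Cons a w)
  have "theta_X (letter a) = letter (xb a)"
    by (cases a) (simp_all add: theta_X_X0 theta_X_X1)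
  with Cons show ?case
    unfolding mon_Cons[of a w] theta_X_mult by (simp flip: mon_append)
qed (simp add: mon_Nil theta_X_one)

lemma theta_Y_mon: "theta_Y (mon v) = mon (map yindex (rev v))"
proof (induction v)
  case (Cons y v)
  then show ?case
    unfolding mon_Cons[of y v] theta_Y_mult by (simp add: theta_Y_letter mon_append)
qed (simp add: mon_Nil theta_Y_one)

lemma theta_X_yx:
  "theta_X (mon (yx v)) = mon (blocks (map (\<lambda>y. (yindex y - 1, 0)) v))"
proof -
  have "map xb (yx v) = blocks (map (\<lambda>y. (yindex y - 1, 0)) v)"
    by (induction v) (simp_all add: yx_Cons blocks_Cons, simp add: blocks_def)
  then show ?thesis by (simp only: theta_X_mon)
qed

lemma blocks_append: "blocks (ps @ qs) = blocks ps @ blocks qs"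
  by (simp add: blocks_def)

lemma blocks_yindex: "blocks (map (\<lambda>y. (0, yindex y - 1)) v) = map yindex v"
proof (induction v)
  case (Cons y v)
  then show ?case
    using yindex_ge_1[of y] by (simp add: blocks_Cons)
qed (simp add: blocks_def)

text \<open>For the word y_(k_1) ... y_(k_d) x_0^r, the product with b_(m+1) has the blocks (k_i -
  1, 0) and finally (r, m). Reversing and swapping gives (m, r), which is b_0^m b_(r+1), and then
  the single letters b_(k_i) in reverse order. On the other side x_1 completes x_0^r to
  y_(r+1).\<close>

lemma tau_theta_X: "tau (theta_X h * letter (Suc m)) = letter 0 ^ m * theta_Y (pi_Y (h * letter X1))"
  and theta_X_letter_QB0: "theta_X h * letter (Suc m) \<in> QB0"
proof -
  have word: "\<exists>v r. mon w = iota (mon v) * letter X0 ^ r \<and>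
      theta_X (mon w) * letter (Suc m) = mon (blocks (map (\<lambda>y. (yindex y - 1, 0)) v @ [(r, m)]))" for w
  proof -
    obtain v r where "w = yx v @ replicate r X0"
      using word_eq_yx_replicate by blast
    then have "mon w = iota (mon v) * letter X0 ^ r"
      by (simp add: mon_append mon_replicate iota_mon)
    moreover from this have "theta_X (mon w) * letter (Suc m) =
        mon (blocks (map (\<lambda>y. (yindex y - 1, 0)) v @ [(r, m)]))"
      by (simp add: theta_X_mult iota_mon theta_X_yx theta_X_X0_power blocks_append mult.assoc
          mon_append[of "blocks (map (\<lambda>y. (yindex y - Suc 0, 0)) v)"] blocks_def[of "[_]"] block_def mon_replicate
          mon_append[of "replicate r 0"])
    ultimately show ?thesis by blast
  qed
  show "tau (theta_X h * letter (Suc m)) = letter 0 ^ m * theta_Y (pi_Y (h * letter X1))"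
  proof (rule linear_eqI[where S = "\<lambda>h. tau (theta_X h * letter (Suc m))"])
    fix w
    obtain v r where w: "mon w = iota (mon v) * letter X0 ^ r"
      and \<theta>: "theta_X (mon w) * letter (Suc m) = mon (blocks (map (\<lambda>y. (yindex y - 1, 0)) v @ [(r, m)]))"
      using word by blast
    have y: "letter X0 ^ r * letter X1 = iota (letter (Y (Suc r)))"
      by (simp add: iota_letter yindex_Y)
    have "pi_Y (mon w * letter X1) = mon v * letter (Y (Suc r))"
      by (simp only: w mult.assoc y pi_Y_iota_mult pi_Y_iota)
    then have "theta_Y (pi_Y (mon w * letter X1)) = letter (Suc r) * mon (map yindex (rev v))"
      by (simp add: theta_Y_mult theta_Y_letter theta_Y_mon yindex_Y)
    moreover have "tau (theta_X (mon w) * letter (Suc m)) =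
        mon (replicate m 0 @ Suc r # map yindex (rev v))"
      unfolding \<theta> tau_blocks
      by (simp add: blocks_Cons rev_map[symmetric] comp_def) (simp add: rev_map blocks_yindex[of "rev v", simplified])
    ultimately show "tau (theta_X (mon w) * letter (Suc m)) =
        letter 0 ^ m * theta_Y (pi_Y (mon w * letter X1))"
      using mon_Cons[of "Suc r" "map yindex (rev v)"] by (simp add: mon_append mon_replicate)
  next
    show "lin (\<lambda>h. tau (theta_X h * letter (Suc m)))"
      by (rule linear_comp[OF linear_tau linear_mult_right_comp[OF linear_theta_X]])
    show "lin (\<lambda>h. letter 0 ^ m * theta_Y (pi_Y (h * letter X1)))"
      by (rule linear_mult_left_comp[OF linear_comp[OF linear_theta_Y
            linear_comp[OF linear_pi_Y linear_mult_right]]])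
  qed
  have "theta_X h * letter (Suc m) = lin_ext (\<lambda>w. theta_X (mon w) * letter (Suc m)) h"
    by (rule linear_eq_lin_ext[OF linear_mult_right_comp[OF linear_theta_X]])
  then show "theta_X h * letter (Suc m) \<in> QB0"
    using word mon_blocks_QB0 by (metis lin_ext_QB0)
qed

text \<open>Multiples of x_0 disappear on both sides. On the rest \<open>tau\<close> swaps the block
  (k - 1, 0) of x_0^(k-1) x_1 to the block (0, k - 1) of b_k and reverses the order.\<close>

lemma tau_pi_0_theta_X: "tau (pi_0 (theta_X h)) = theta_Y (pi_Y h)"
proof -
  obtain g where h: "h = iota (pi_Y h) + g * letter X0"
    using iota_pi_Y by blast
  have "tau (pi_0 (theta_X (iota q))) = theta_Y q" for q
  proof (rule linear_eqI[where S = "\<lambda>q. tau (pi_0 (theta_X (iota q)))"])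
    show "tau (pi_0 (theta_X (iota (mon v)))) = theta_Y (mon v)" for v
      by (simp add: iota_mon theta_X_yx pi_0_QB0[OF mon_blocks_QB0] tau_blocks theta_Y_mon comp_def
          rev_map blocks_yindex[simplified])
  qed (rule linear_comp[OF linear_tau linear_comp[OF linear_pi_0 linear_comp[OF linear_theta_X
            linear_iota]]] linear_theta_Y)+
  moreover have "pi_0 (theta_X h) = pi_0 (theta_X (iota (pi_Y h)))"
    by (subst h) (simp add: lin_add[OF linear_theta_X] theta_X_mult theta_X_X0 lin_add[OF linear_pi_0]
        pi_0_letter_0)
  ultimately show ?thesis by simp
qed

lemma QB0_mult:
  assumes "f \<in> QB0" "g \<in> QB0"
  shows "f * g \<in> QB0"
proof -
  have words: "mon u * mon v \<in> QB0" if "u \<in> Poly_Mapping.keys f" "v \<in> Poly_Mapping.keys g" for u v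
    unfolding mon_append[symmetric] using assms that
    by (intro mon_QB0) (auto simp: QB0_def last_append)
  have "mon u * g \<in> QB0" if "u \<in> Poly_Mapping.keys f" for u
  proof -
    have "mon u * g = lin_ext (\<lambda>v. mon u * mon v) g"
      by (rule linear_eq_lin_ext[OF linear_mult_left])
    then show ?thesis
      using words[OF that] by (simp only: lin_ext_QB0)
  qed
  moreover have "f * g = lin_ext (\<lambda>u. mon u * g) f"
    by (rule linear_eq_lin_ext[OF linear_mult_right])
  ultimately show ?thesis
    by (simp only: lin_ext_QB0)
qed

lemma pi_0_mult:
  assumes "f \<in> QB0"
  shows "pi_0 (f * g) = f * pi_0 g"
proof (rule QB0_eqI[OF _ _ assms, where S = "\<lambda>f. pi_0 (f * g)"])
  fix ps
  show "pi_0 (mon (blocks ps) * g) = mon (blocks ps) * pi_0 g"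
  proof (rule linear_eqI[where S = "\<lambda>g. pi_0 (mon (blocks ps) * g)"])
    show "pi_0 (mon (blocks ps) * mon w) = mon (blocks ps) * pi_0 (mon w)" for w
      using range_blocks[of "blocks ps"]
      by (cases "w = []") (auto simp: pi_0_def last_append simp flip: mon_append)
  qed (rule linear_comp[OF linear_pi_0 linear_mult_left] linear_mult_left_comp[OF linear_pi_0])+
qed (rule linear_comp[OF linear_pi_0 linear_mult_right] linear_mult_right)+

lemma tau_tau:
  assumes "f \<in> QB0"
  shows "tau (tau f) = f"
  by (rule QB0_eqI[OF linear_comp[OF linear_tau linear_tau] linear_ident assms])
    (simp add: tau_blocks rev_map[symmetric] comp_def)

text \<open>By \<open>section_pi_Y\<close>, \<open>\<psi> x\<^sub>0\<^sup>j x\<^sub>1\<close> gives one half of the commutators in \<open>del_letter\<close>; the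
  equation \<open>rho \<psi> = - \<psi>\<close> turns it into the other half.\<close>

lemma del_theta_Y_letter:
  assumes \<psi>: "\<psi> \<in> stab_DeltaY" and X0: "Poly_Mapping.lookup \<psi> [X0] = 0"
  shows "del (theta_Y (pi_Y \<psi>)) (letter (Suc j)) =
           theta_Y (pi_Y (comm \<psi> (letter X0 ^ j) * letter X1))"
proof -
  let ?q = "pi_Y \<psi>" let ?c = "theta_Y (pi_Y \<psi>)"
  define D where "D n = neg_exp dY n ?q" for n
  have "dX \<psi> = 0"
    using primitive_derivation_letter[of \<psi> X0] \<psi> X0 by (simp add: stab_DeltaY_iff dX_def)
  then obtain K0 where K0: "\<And>K. K0 \<le> K \<Longrightarrow> \<psi> = (\<Sum>n\<le>K. iota (D n) * letter X0 ^ n)"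
    using section_pi_Y unfolding D_def by blast
  obtain K1 where K1: "\<And>n. K1 < n \<Longrightarrow> lower_exp n ?c = 0"
    using lower_exp_finite by blast
  define K where "K = max K0 K1"
  have K: "\<psi> = (\<Sum>n\<le>K. iota (D n) * letter X0 ^ n)"
    by (rule K0) (simp add: K_def)
  have exp: "lower_exp n ?c = theta_Y (D n)" for n
    unfolding D_def by (rule neg_exp_commute[OF linear_theta_Y linear_dY linear_lower theta_Y_dY])
  have y: "letter X0 ^ n * letter X1 = iota (letter (Y (Suc n)))" for n
    by (simp add: iota_letter yindex_Y)
  have "\<psi> * letter X0 ^ j * letter X1 = (\<Sum>n\<le>K. iota (D n) * (letter X0 ^ (n + j) * letter X1))"
    by (subst K) (simp add: sum_distrib_right mult.assoc power_add)
  then have left: "pi_Y (\<psi> * letter X0 ^ j * letter X1) = (\<Sum>n\<le>K. D n * letter (Y (Suc (n + j))))"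
    by (simp add: lin_sum[OF linear_pi_Y] y pi_Y_iota_mult pi_Y_iota)
  have prim_D: "primitive (D n)" for n
  proof (induction n)
    case 0
    then show ?case by (simp add: D_def neg_exp_0 stab_primitive_pi_Y[OF \<psi>])
  next
    case (Suc n)
    have "primitive (dY (D n))"
      by (rule primitive_derivation[OF is_derivation_dY _ Suc])
        (simp add: dY_letter primitive_scale primitive_letter)
    then show ?case
      unfolding D_def neg_exp_Suc[OF linear_dY] by (rule primitive_scale)
  qed
  have "rho (\<psi> * letter X0 ^ j) = - (letter X0 ^ j * \<psi>)"
    by (simp add: rho_mult rho_X0_power rho_stab[OF \<psi> X0])
  then have "pi_Y (letter X0 ^ j * \<psi> * letter X1) = antipode (pi_Y (\<psi> * letter X0 ^ j * letter X1))"
    by (simp add: antipode_pi_Y lin_minus[OF linear_pi_Y])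
  \<comment> \<open>The antipode swaps the factors; the signs of the letter and of the primitive
    factor \<open>D n\<close> cancel.\<close>
  also have "\<dots> = (\<Sum>n\<le>K. letter (Y (Suc (n + j))) * D n)"
    by (simp add: left lin_sum[OF linear_antipode] alg_antihom_mult alg_antihom_letter
        primitive_antipode[OF prim_D])
  finally have right: "pi_Y (letter X0 ^ j * \<psi> * letter X1) = (\<Sum>n\<le>K. letter (Y (Suc (n + j))) * D n)" .
  have "del ?c (letter (Suc j)) = (\<Sum>n\<le>K. comm (letter (Suc j + n)) (lower_exp n ?c))"
    by (rule del_letter) (simp_all add: K1 K_def)
  also have "\<dots> = (\<Sum>n\<le>K. theta_Y (D n * letter (Y (Suc (n + j)))) -
      theta_Y (letter (Y (Suc (n + j))) * D n))"
    by (simp add: exp comm_def theta_Y_mult theta_Y_letter yindex_Y add.commute)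
  also have "\<dots> = theta_Y (pi_Y (comm \<psi> (letter X0 ^ j) * letter X1))"
    by (simp add: comm_def left_diff_distrib lin_diff[OF linear_pi_Y] lin_diff[OF linear_theta_Y]
        left right lin_sum[OF linear_theta_Y] sum_subtractf)
  finally show ?thesis .
qed

text \<open>\<open>theta_X f\<close> involves only b_0 and b_1, and b_1 is killed because the
  commutator of \<psi> with x_0^0 = 1 is 0.\<close>

lemma del_theta_Y_theta_X:
  assumes "\<psi> \<in> stab_DeltaY" "Poly_Mapping.lookup \<psi> [X0] = 0"
  shows "del (theta_Y (pi_Y \<psi>)) (theta_X f) = 0"
proof (rule lin_mult_eqI[where S = "\<lambda>f. del (theta_Y (pi_Y \<psi>)) (theta_X f)" and T = "\<lambda>f. 0"])
  have X1: "del (theta_Y (pi_Y \<psi>)) (letter (Suc 0)) = 0"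
    using del_theta_Y_letter[OF assms, of 0]
    by (simp add: comm_def lin_zero[OF linear_pi_Y] lin_zero[OF linear_theta_Y])
  show "del (theta_Y (pi_Y \<psi>)) (theta_X (letter a * mon w)) = 0"
    if "del (theta_Y (pi_Y \<psi>)) (theta_X (mon w)) = 0" for a w
    using that X1 by (cases a) (simp_all add: theta_X_mult del_mult theta_X_X0 theta_X_X1 del_letter_0)
qed (rule linear_comp[OF linear_del linear_theta_X] linear_const_zero
    | simp add: theta_X_one is_derivation_one[OF is_derivation_del])+

text \<open>\<open>eta\<close> is \<open>sigma (theta_X \<psi>)\<close> minus right multiplication
  by a = \<open>theta_X \<psi>\<close>, hence a derivation. On a block it gives [a, b_0^j] b_(m+1),
  which \<open>tau_theta_X\<close> and \<open>del_theta_Y_letter\<close> convert; product rules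
  extend this to all block words. Membership in \<open>QB0\<close> is proved alongside because
  \<open>tau_mult\<close> requires it.\<close>

lemma tau_eta:
  fixes \<psi> :: "xletter free_alg"
  assumes \<psi>: "\<psi> \<in> stab_DeltaY" "Poly_Mapping.lookup \<psi> [X0] = 0" and f: "f \<in> QB0"
  defines "eta \<equiv> \<lambda>f. del (theta_X \<psi>) f + (theta_X \<psi> * f - f * theta_X \<psi>)"
  shows "eta f \<in> QB0 \<and> tau (eta f) = del (theta_Y (pi_Y \<psi>)) (tau f)"
proof -
  let ?a = "theta_X \<psi>" let ?c = "theta_Y (pi_Y \<psi>)"
  have der: "is_derivation eta"
    unfolding eta_def by (rule is_derivation_add[OF is_derivation_del is_derivation_ad])
  note lin = is_derivation_lin[OF der]
  have block: "mon (block (j, m)) = letter 0 ^ j * letter (Suc m)" for j m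
    by (simp add: block_def mon_append mon_replicate)
  have eta_block: "eta (mon (block (j, m))) = theta_X (comm \<psi> (letter X0 ^ j)) * letter (Suc m)" for j m
  proof -
    have "del ?a (letter 0 ^ j) = 0"
      by (induction j) (simp_all add: is_derivation_one[OF is_derivation_del] del_mult del_letter_0)
    then show ?thesis
      by (simp add: eta_def block del_mult del_theta_X_letter theta_X_comm theta_X_X0_power comm_def
          lin_diff[OF linear_theta_X] theta_X_mult algebra_simps)
  qed
  have gen: "tau (eta (mon (block (j, m)))) = del ?c (mon (block (m, j)))" for j m
  proof -
    have "del ?c (letter 0 ^ m) = 0"
      by (induction m) (simp_all add: is_derivation_one[OF is_derivation_del] del_mult del_letter_0)
    then show ?thesis
      unfolding eta_block tau_theta_X by (simp add: block del_mult del_theta_Y_letter[OF \<psi>])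
  qed
  have gen_QB0: "eta (mon (block (j, m))) \<in> QB0" for j m
    by (simp add: eta_block theta_X_letter_QB0)
  have words: "eta (mon (blocks ps)) \<in> QB0 \<and>
      tau (eta (mon (blocks ps))) = del ?c (tau (mon (blocks ps)))" for ps
  proof (induction ps)
    case Nil
    have "tau 1 = 1"
      using tau_blocks[of "[]"] by (simp add: blocks_def mon_Nil)
    then show ?case
      by (simp add: blocks_def mon_Nil is_derivation_one[OF der] is_derivation_one[OF is_derivation_del]
          lin_zero[OF linear_tau] QB0_zero)
  next
    case (Cons p ps)
    obtain j m where p: "p = (j, m)" by (cases p)
    let ?z = "mon (block (j, m))" let ?g = "mon (blocks ps)"
    have QB0: "?z \<in> QB0" "?g \<in> QB0"
      using mon_blocks_QB0[of "[(j, m)]"] mon_blocks_QB0[of ps] by (simp_all add: blocks_def)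
    have eq: "mon (blocks (p # ps)) = ?z * ?g"
      by (simp add: blocks_def p mon_append)
    have tz: "tau ?z = mon (block (m, j))"
      using tau_blocks[of "[(j, m)]"] by (simp add: blocks_def)
    have "eta (?z * ?g) = eta ?z * ?g + ?z * eta ?g"
      by (rule is_derivation_mult[OF der])
    moreover have "eta ?z * ?g \<in> QB0" "?z * eta ?g \<in> QB0"
      using Cons QB0 gen_QB0 by (auto intro: QB0_mult)
    ultimately show ?case
      using Cons QB0 gen_QB0 unfolding eq
      by (simp add: QB0_add lin_add[OF linear_tau] tau_mult gen tz del_mult add.commute)
  qed
  have "tau (eta f) = del ?c (tau f)"
    by (rule QB0_eqI[OF linear_comp[OF linear_tau lin] linear_comp[OF linear_del linear_tau] f])
      (use words in blast)
  moreover have "eta f \<in> QB0"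
  proof -
    \<comment> \<open>Being fixed by \<open>pi_0\<close> is a linear equation, so it extends from
      block words to \<open>f\<close>.\<close>
    have "pi_0 (eta f) = eta f"
      by (rule QB0_eqI[OF linear_comp[OF linear_pi_0 lin] lin f]) (use words in \<open>simp add: pi_0_QB0\<close>)
    then show ?thesis using pi_0_in_QB0 by metis
  qed
  ultimately show ?thesis by blast
qed

text \<open>For a = \<open>theta_X \<psi>\<close>, \<open>sigma a f\<close> is \<open>f * a\<close>
  plus the derivation of \<open>tau_eta\<close>. Here \<open>pi_0\<close> affects only the factor a,
  and \<open>tau\<close> turns \<open>f * pi_0 a\<close> into
  \<open>theta_Y (pi_Y \<psi>) * tau f\<close>.\<close>

lemma sigma_theta_Y_tau:
  assumes \<psi>: "\<psi> \<in> stab_DeltaY" "Poly_Mapping.lookup \<psi> [X0] = 0" and f: "f \<in> QB0"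
  shows "sigma (theta_Y (pi_Y \<psi>)) (tau f) = tau (sigma0 (theta_X \<psi>) f)"
proof -
  let ?a = "theta_X \<psi>" let ?c = "theta_Y (pi_Y \<psi>)"
  define e where "e = del ?a f + (?a * f - f * ?a)"
  have e: "e \<in> QB0" "tau e = del ?c (tau f)"
    using tau_eta[OF assms] by (simp_all add: e_def)
  have "sigma ?a f = f * ?a + e"
    by (simp add: sigma_def e_def)
  then have "sigma0 ?a f = f * pi_0 ?a + e"
    by (simp add: sigma0_def lin_add[OF linear_pi_0] pi_0_mult[OF f] pi_0_QB0[OF e(1)])
  then show ?thesis
    by (simp add: lin_add[OF linear_tau] tau_mult[OF f pi_0_in_QB0] tau_pi_0_theta_X e(2) sigma_def)
qed

lemma theta_stab_tau:
  assumes \<psi>: "\<psi> \<in> stab_DeltaY" "Poly_Mapping.lookup \<psi> [X0] = 0"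
  shows "theta \<psi> \<in> stab_tau"
proof -
  let ?a = "theta_X \<psi>" let ?c = "theta_Y (pi_Y \<psi>)"
  have sigma0_QB0: "sigma0 \<chi> f \<in> QB0" for \<chi> f
    by (simp add: sigma0_def pi_0_in_QB0)
  have 1: "sigma0 ?c (tau f) = tau (sigma0 ?a f)" if "f \<in> QB0" for f
    unfolding sigma0_def[of ?c] sigma_theta_Y_tau[OF \<psi> that] by (rule pi_0_QB0[OF tau_QB0])
  \<comment> \<open>The same relation with the summands exchanged, as \<open>tau\<close> is an
    involution on \<open>QB0\<close>; both together give the claim for
    \<open>theta \<psi>\<close>.\<close>
  have 2: "sigma0 ?a (tau f) = tau (sigma0 ?c f)" if "f \<in> QB0" for f
    using 1[OF tau_QB0[of f]] by (simp add: tau_tau[OF that] tau_tau[OF sigma0_QB0])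
  have "primitive (theta \<psi>)"
    using \<psi>(1) stab_primitive_pi_Y[OF \<psi>(1)]
    by (simp add: theta_def stab_DeltaY_iff primitive_add primitive_theta_X primitive_theta_Y)
  then show ?thesis
    by (simp add: stab_tau_iff theta_def lin_add[OF linear_sigma0_left] lin_add[OF linear_tau] 1 2)
qed

lemma linear_theta: "lin theta"
  unfolding theta_def
  by (intro linear_add linear_theta_X linear_comp[OF linear_theta_Y linear_pi_Y])

lemma theta_ihara:
  assumes \<psi>: "\<psi> \<in> stab_DeltaY" "Poly_Mapping.lookup \<psi> [X0] = 0"
    and \<phi>: "\<phi> \<in> stab_DeltaY" "Poly_Mapping.lookup \<phi> [X0] = 0"
  shows "theta (ihara \<psi> \<phi>) = bracket_A (theta \<psi>) (theta \<phi>)"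
proof -
  let ?c = "\<lambda>\<psi>. theta_Y (pi_Y \<psi>)"
  \<comment> \<open>For a = \<open>theta_X \<psi>\<close> and c = \<open>?c \<phi>\<close>,
    \<partial>_a(c) = [c, a] cancels the commutator [a, c], and \<partial>_c(a) = 0.\<close>
  have mixed: "bracket_A (theta_X \<psi>) (?c \<phi>) = 0"
    if "\<phi> \<in> stab_DeltaY" "Poly_Mapping.lookup \<phi> [X0] = 0" for \<psi> \<phi>
    by (simp add: bracket_A_def del_theta_X_theta_Y del_theta_Y_theta_X[OF that] comm_def)
  have "sigma (?c \<psi>) (?c \<phi>) = tau (pi_0 (sigma (theta_X \<psi>) (theta_X \<phi>)))"
    if "\<psi> \<in> stab_DeltaY" "Poly_Mapping.lookup \<psi> [X0] = 0" for \<psi> \<phi>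
    using sigma_theta_Y_tau[OF that pi_0_in_QB0, of "theta_X \<phi>"]
    by (simp add: tau_pi_0_theta_X pi_0_sigma)
  then have "bracket_A (?c \<psi>) (?c \<phi>) = tau (pi_0 (bracket_A (theta_X \<psi>) (theta_X \<phi>)))"
    using \<psi> \<phi> by (simp add: bracket_A.br_eq_act lin_diff[OF linear_tau] lin_diff[OF linear_pi_0])
  then have "bracket_A (?c \<psi>) (?c \<phi>) = ?c (ihara \<psi> \<phi>)"
    by (simp add: bracket_A_theta_X tau_pi_0_theta_X)
  moreover have "bracket_A (?c \<psi>) (theta_X \<phi>) = 0"
    using mixed[OF \<psi>, of \<phi>] bracket_A.br_skew[of "?c \<psi>" "theta_X \<phi>"] by simp
  ultimately show ?thesis
    by (simp add: theta_def lin_add[OF bracket_A.linear_br] lin_add[OF bracket_A.linear_br_left]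
        bracket_A_theta_X mixed[OF \<phi>])
qed

section \<open>The letters x_0, x_1 and b_0, b_1\<close>

lemma theta_X1: "theta (letter X1) = 2 *\<^sub>Q letter 1"
proof -
  have "iota (letter (Y 1)) = letter X1"
    by (simp add: iota_letter yindex_Y)
  then have "pi_Y (letter X1) = letter (Y 1)"
    using pi_Y_iota[of "letter (Y 1)"] by simp
  moreover have "letter 1 + letter 1 = (2 :: rat) *\<^sub>Q letter (1 :: nat)"
    using Qvs.scale_left_distrib[of 1 1 "letter (1 :: nat)"] by simp
  ultimately show ?thesis
    by (simp add: theta_def theta_X_X1 theta_Y_letter yindex_Y)
qed

text \<open>Both summands of \<open>theta\<close> map x_1 to b_1, while \<open>theta10\<close> sends
  x_1 to b_1 once. Rescaling transfers the results on \<open>theta\<close> at x_1 to the letter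
  b_1.\<close>

lemma letter_1_eq: "letter 1 = (1 / 2) *\<^sub>Q theta (letter X1)"
  by (simp add: theta_X1)

lemma letter_1_stab_tau: "letter 1 \<in> stab_tau"
  unfolding letter_1_eq
  by (intro Qvs.subspace_scale[OF subspace_stab_tau] theta_stab_tau X1_stab)
    (simp add: lookup_single when_def)

lemma sigma_letter_0_left: "sigma (letter 0) f = f * letter 0"
proof -
  have "del (letter 0) f = - 1 *\<^sub>Q (letter 0 * f - f * letter 0)"
  proof (rule is_derivation_eqI[OF is_derivation_del is_derivation_scale[OF is_derivation_ad]])
    fix i :: nat
    show "del (letter 0) (letter i) = - 1 *\<^sub>Q (letter 0 * letter i - letter i * letter 0)"
      using del_theta_X_letter[of i "letter X0"]
      by (cases "i = 0") (simp_all add: del_letter_0 theta_X_X0 comm_def)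
  qed
  then show ?thesis by (simp add: sigma_def)
qed

lemma letter_0_stab_tau: "letter 0 \<in> stab_tau"
  by (simp add: stab_tau_iff primitive_letter sigma0_def sigma_letter_0_left pi_0_letter_0
      lin_zero[OF linear_tau])

text \<open>\<open>s_map\<close> of x_0 is right multiplication by x_0, and
  \<open>s_map \<phi>\<close> also sends x_0 to \<phi> x_0, so the two terms of
  \<open>br_eq_act\<close> agree. Together with \<open>ihara_X1\<close> this makes both letters
  central.\<close>

lemma ihara_X0: "ihara (letter X0) \<phi> = 0"
  by (simp add: ihara.br_eq_act s_map_X0_left) (simp add: s_map_def d_der_X0)

lemma ihara_X1: "ihara (letter X1) \<phi> = 0"
  by (simp add: ihara.br_eq_act s_map_X1_left s_map_X1)

lemma bracket_A_letter_0: "bracket_A (letter 0) \<chi> = 0"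
  by (simp add: bracket_A.br_eq_act sigma_letter_0_left) (simp add: sigma_def del_letter_0)

lemma bracket_A_letter_1:
  assumes "\<phi> \<in> stab_DeltaY" "Poly_Mapping.lookup \<phi> [X0] = 0"
  shows "bracket_A (letter 1) (theta \<phi>) = 0"
proof -
  have "bracket_A (theta (letter X1)) (theta \<phi>) = theta (ihara (letter X1) \<phi>)"
    by (rule theta_ihara[symmetric, OF X1_stab _ assms]) (simp add: lookup_single when_def)
  then show ?thesis
    unfolding letter_1_eq lin_scale[OF bracket_A.linear_br_left]
    by (simp add: ihara_X1 lin_zero[OF linear_theta])
qed

text \<open>Each x_1 is replaced by [x_1, \<psi>], which has no terms of length less than 2 when
  \<psi> has no constant term.\<close>

lemma lookup_d_der:
  assumes "Poly_Mapping.lookup \<psi> [] = 0"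
  shows "Poly_Mapping.lookup (d_der \<psi> f) [] = 0" "Poly_Mapping.lookup (d_der \<psi> f) [a] = 0"
proof -
  have gen: "Poly_Mapping.lookup (d_der \<psi> (letter b)) [] = 0 \<and>
      Poly_Mapping.lookup (d_der \<psi> (letter b)) [c] = 0" for b c
    by (cases b) (simp_all add: d_der_X0 d_der_X1 comm_def lookup_minus lookup_Nil_mult
        lookup_single_letter_mult assms lookup_single)
  have words: "Poly_Mapping.lookup (d_der \<psi> (mon w)) [] = 0 \<and>
      Poly_Mapping.lookup (d_der \<psi> (mon w)) [c] = 0" for w c
  proof (induction w)
    case (Cons b w)
    then show ?case
      unfolding mon_Cons[of b w] is_derivation_mult[OF is_derivation_d_der]
      by (simp add: lookup_add lookup_Nil_mult lookup_single_letter_mult gen lookup_single when_def)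
  qed (simp add: mon_Nil is_derivation_one[OF is_derivation_d_der])
  have "Poly_Mapping.lookup (d_der \<psi> f) [] = 0 \<and> Poly_Mapping.lookup (d_der \<psi> f) [a] = 0"
    by (induction f rule: free_alg_induct)
      (simp_all add: lin_scale[OF is_derivation_lin[OF is_derivation_d_der]] words
        lin_add[OF is_derivation_lin[OF is_derivation_d_der]] lookup_add)
  then show "Poly_Mapping.lookup (d_der \<psi> f) [] = 0" "Poly_Mapping.lookup (d_der \<psi> f) [a] = 0"
    by auto
qed

text \<open>Commutators and \<open>d_der\<close> produce no terms of length 1, so
  \<open>stab_in_ls\<close> applies whatever the linear parts of the arguments. Hence
  \<open>theta10\<close> agrees with \<open>theta\<close> on brackets.\<close>

lemma ihara_in_ls:
  assumes "\<psi> \<in> stab_DeltaY" "\<phi> \<in> stab_DeltaY"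
  shows "ihara \<psi> \<phi> \<in> ls"
proof -
  have nil: "Poly_Mapping.lookup \<psi> [] = 0" "Poly_Mapping.lookup \<phi> [] = 0"
    using assms by (auto simp: stab_DeltaY_iff primitive_lookup_Nil)
  have "Poly_Mapping.lookup (ihara \<psi> \<phi>) [a] = 0" for a
    by (simp add: ihara_def lookup_add lookup_minus comm_def lookup_single_letter_mult nil
        lookup_d_der)
  then show ?thesis
    using ihara_stab_DeltaY[OF assms] by (intro stab_in_ls)
qed

lemma ls_add: "\<psi> \<in> ls \<Longrightarrow> \<phi> \<in> ls \<Longrightarrow> \<psi> + \<phi> \<in> ls"
  by (simp add: ls_def lookup_add primitive_add lin_add[OF linear_pi_Y])

lemma ls_scale: "\<psi> \<in> ls \<Longrightarrow> c *\<^sub>Q \<psi> \<in> ls"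
  by (simp add: ls_def primitive_scale lin_scale[OF linear_pi_Y])

section \<open>Injectivity of the extended map\<close>

lemma inj_xb: "inj xb"
  by (rule injI) (simp add: xb_def split: xletter.splits)

lemma lookup_theta_X:
  "Poly_Mapping.lookup (theta_X f) (map xb w) = Poly_Mapping.lookup f w"
proof (induction f rule: free_alg_induct)
  case (scale c v)
  then show ?case
    by (simp add: lin_scale[OF linear_theta_X] theta_X_mon lookup_single when_def
        inj_map_eq_map[OF inj_xb])
qed (simp add: lin_add[OF linear_theta_X] lookup_add)

lemma lookup_theta_Y_0: "0 \<in> set w \<Longrightarrow> Poly_Mapping.lookup (theta_Y q) w = 0"
proof (induction q rule: free_alg_induct)
  case (scale c v)
  have "map yindex (rev v) \<noteq> w"
  proof
    assume "map yindex (rev v) = w"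
    with scale obtain y where "yindex y = 0" by auto
    then show False using yindex_ge_1[of y] by simp
  qed
  then show ?case
    by (simp add: lin_scale[OF linear_theta_Y] theta_Y_mon lookup_single when_def)
qed (simp add: lin_add[OF linear_theta_Y] lookup_add)

text \<open>\<open>theta_Y\<close> produces no words with b_0, so there \<open>theta_X\<close> alone
  shows the coefficients of \<psi>. The remaining words are powers of x_1, at which \<psi> vanishes
  by primitivity and the condition at x_1 in \<open>ls\<close>. With \<psi> = 0 the coefficient at
  b_1 is \<open>c1\<close>.\<close>

lemma theta10_kernel:
  assumes \<psi>: "\<psi> \<in> ls" and eq: "theta \<psi> + c1 *\<^sub>Q letter 1 + c0 *\<^sub>Q letter 0 = 0"
  shows "\<psi> = 0 \<and> c1 = 0 \<and> c0 = 0"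
proof -
  let ?m = "map xb"
  have with_X0: "Poly_Mapping.lookup \<psi> w + (if w = [X0] then c0 else 0) = 0" if "X0 \<in> set w" for w
  proof -
    have 0: "0 \<in> set (?m w)"
      using imageI[OF that, of xb] by simp
    have "[0] = ?m w \<longleftrightarrow> w = [X0]"
      using inj_map_eq_map[OF inj_xb, of "[X0]" w] by auto
    moreover have "[1] \<noteq> ?m w"
      using 0 by (metis empty_iff empty_set set_ConsD zero_neq_one)
    moreover have "Poly_Mapping.lookup (theta \<psi>) (?m w) = Poly_Mapping.lookup \<psi> w"
      by (simp add: theta_def lookup_add lookup_theta_X lookup_theta_Y_0[OF 0])
    ultimately show ?thesis
      using arg_cong[OF eq, of "\<lambda>f. Poly_Mapping.lookup f (?m w)"]
      by (simp only: lookup_add lookup_scale lookup_single when_def lookup_zero)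
        (simp split: if_splits)
  qed
  have c0: "c0 = 0"
    using with_X0[of "[X0]"] \<psi> by (simp add: ls_def)
  have "\<psi> = 0"
  proof (rule poly_mapping_eqI)
    fix w
    show "Poly_Mapping.lookup \<psi> w = Poly_Mapping.lookup 0 w"
    proof (cases "X0 \<in> set w")
      case True
      then show ?thesis using with_X0[of w] c0 by (simp split: if_splits)
    next
      case False
      then have "\<forall>a\<in>set w. a = X1"
        by (metis xletter.exhaust)
      then obtain n where "w = replicate n X1"
        using replicate_length_same by metis
      then show ?thesis
        using primitive_lookup_replicate[of \<psi> n X1] \<psi> by (cases "n = 1") (auto simp: ls_def)
    qed
  qed
  moreover from this have "c1 = 0"
    using arg_cong[OF eq, of "\<lambda>f. Poly_Mapping.lookup f [1]"] c0
    by (simp add: lin_zero[OF linear_theta] lookup_single)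
  ultimately show ?thesis using c0 by simp
qed

section \<open>The map on the whole stabilizer\<close>

lemma theta10_add:
  assumes "f \<in> stab_DeltaY" "g \<in> stab_DeltaY"
  shows "theta10 (f + g) = theta10 f + theta10 g"
proof -
  obtain \<psi> c1 c0 where f: "\<psi> \<in> stab_DeltaY" "\<psi> \<in> ls" "f = \<psi> + c1 *\<^sub>Q letter X1 + c0 *\<^sub>Q letter X0"
    by (rule stab_decompose[OF assms(1)])
  obtain \<phi> e1 e0 where g: "\<phi> \<in> stab_DeltaY" "\<phi> \<in> ls" "g = \<phi> + e1 *\<^sub>Q letter X1 + e0 *\<^sub>Q letter X0"
    by (rule stab_decompose[OF assms(2)])
  have "f + g = (\<psi> + \<phi>) + (c1 + e1) *\<^sub>Q letter X1 + (c0 + e0) *\<^sub>Q letter X0"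
    by (simp add: f(3) g(3) Qvs.scale_left_distrib)
  then show ?thesis
    by (simp add: theta10_eq[OF ls_add[OF f(2) g(2)]])
      (simp add: f(3) g(3) theta10_eq[OF f(2)] theta10_eq[OF g(2)] lin_add[OF linear_theta]
        Qvs.scale_left_distrib)
qed

lemma theta10_scale:
  assumes "f \<in> stab_DeltaY"
  shows "theta10 (c *\<^sub>Q f) = c *\<^sub>Q theta10 f"
proof -
  obtain \<psi> c1 c0 where f: "\<psi> \<in> stab_DeltaY" "\<psi> \<in> ls" "f = \<psi> + c1 *\<^sub>Q letter X1 + c0 *\<^sub>Q letter X0"
    by (rule stab_decompose[OF assms(1)])
  have "c *\<^sub>Q f = c *\<^sub>Q \<psi> + (c * c1) *\<^sub>Q letter X1 + (c * c0) *\<^sub>Q letter X0"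
    by (simp add: f(3) Qvs.scale_right_distrib)
  then show ?thesis
    by (simp add: theta10_eq[OF ls_scale[OF f(2)]])
      (simp add: f(3) theta10_eq[OF f(2)] lin_scale[OF linear_theta] Qvs.scale_right_distrib)
qed

lemma theta10_stab_tau:
  assumes "f \<in> stab_DeltaY"
  shows "theta10 f \<in> stab_tau"
proof -
  obtain \<psi> c1 c0 where f: "\<psi> \<in> stab_DeltaY" "\<psi> \<in> ls" "f = \<psi> + c1 *\<^sub>Q letter X1 + c0 *\<^sub>Q letter X0"
    by (rule stab_decompose[OF assms(1)])
  have "theta \<psi> \<in> stab_tau"
    using f by (intro theta_stab_tau) (auto simp: ls_def)
  then show ?thesis
    unfolding f(3) theta10_eq[OF f(2)]
    by (intro Qvs.subspace_add Qvs.subspace_scale subspace_stab_tau letter_1_stab_tau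
        letter_0_stab_tau)
qed

text \<open>The linear parts drop out of both brackets, which reduces the claim to
  \<open>theta_ihara\<close>.\<close>

lemma theta10_ihara:
  assumes "f \<in> stab_DeltaY" "g \<in> stab_DeltaY"
  shows "theta10 (ihara f g) = bracket_A (theta10 f) (theta10 g)"
proof -
  obtain \<psi> c1 c0 where f: "\<psi> \<in> stab_DeltaY" "\<psi> \<in> ls" "f = \<psi> + c1 *\<^sub>Q letter X1 + c0 *\<^sub>Q letter X0"
    by (rule stab_decompose[OF assms(1)])
  obtain \<phi> e1 e0 where g: "\<phi> \<in> stab_DeltaY" "\<phi> \<in> ls" "g = \<phi> + e1 *\<^sub>Q letter X1 + e0 *\<^sub>Q letter X0"
    by (rule stab_decompose[OF assms(2)])
  have X0: "Poly_Mapping.lookup \<psi> [X0] = 0" "Poly_Mapping.lookup \<phi> [X0] = 0"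
    using f(2) g(2) by (simp_all add: ls_def)
  have cX: "ihara \<chi> (letter X0) = 0" "ihara \<chi> (letter X1) = 0" for \<chi>
    using ihara.br_skew[of \<chi>] by (simp_all add: ihara_X0 ihara_X1)
  have "ihara f g = ihara \<psi> \<phi>"
    by (simp add: f g lin_add[OF ihara.linear_br] lin_add[OF ihara.linear_br_left]
        lin_scale[OF ihara.linear_br] lin_scale[OF ihara.linear_br_left] ihara_X0 ihara_X1 cX)
  moreover have "theta10 (ihara \<psi> \<phi>) = theta (ihara \<psi> \<phi>)"
    using theta10_eq[OF ihara_in_ls[OF f(1) g(1)], of 0 0] by simp
  moreover have "bracket_A (theta10 f) (theta10 g) = bracket_A (theta \<psi>) (theta \<phi>)"
  proof -
    have "bracket_A \<chi> (letter 0) = 0" for \<chi>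
      using bracket_A.br_skew[of \<chi>] by (simp add: bracket_A_letter_0)
    moreover have "bracket_A (letter 1) (theta \<phi>) = 0"
      by (rule bracket_A_letter_1[OF g(1) X0(2)])
    moreover have "bracket_A (theta \<psi>) (letter 1) = 0"
      using bracket_A.br_skew[of "theta \<psi>" "letter 1"] bracket_A_letter_1[OF f(1) X0(1)] by simp
    ultimately show ?thesis
      unfolding f(3) g(3) theta10_eq[OF f(2)] theta10_eq[OF g(2)]
      by (simp add: lin_add[OF bracket_A.linear_br] lin_add[OF bracket_A.linear_br_left]
          lin_scale[OF bracket_A.linear_br] lin_scale[OF bracket_A.linear_br_left]
          bracket_A_letter_0 bracket_A.br_self)
  qed
  ultimately show ?thesis
    by (simp add: theta_ihara f(1) g(1) X0)
qed

lemma inj_on_theta10: "inj_on theta10 stab_DeltaY"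
proof (rule inj_onI)
  fix f g
  assume f: "f \<in> stab_DeltaY" and g: "g \<in> stab_DeltaY" and eq: "theta10 f = theta10 g"
  have mg: "- 1 *\<^sub>Q g \<in> stab_DeltaY"
    by (rule Qvs.subspace_scale[OF subspace_stab_DeltaY g])
  have "theta10 (f + - 1 *\<^sub>Q g) = 0"
    unfolding theta10_add[OF f mg] theta10_scale[OF g] by (simp add: eq)
  then have 0: "theta10 (f - g) = 0" by simp
  have "f - g \<in> stab_DeltaY"
    by (rule Qvs.subspace_diff[OF subspace_stab_DeltaY f g])
  then obtain \<psi> c1 c0 where \<psi>: "\<psi> \<in> stab_DeltaY" "\<psi> \<in> ls" "f - g = \<psi> + c1 *\<^sub>Q letter X1 + c0 *\<^sub>Q letter X0"
    by (rule stab_decompose)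
  then have "\<psi> = 0 \<and> c1 = 0 \<and> c0 = 0"
    using 0 by (intro theta10_kernel) (simp_all add: theta10_eq)
  then show "f = g"
    using \<psi>(3) by simp
qed

theorem theorem3p2:
  shows "lie_hom_on stab_DeltaY ihara stab_tau bracket_A theta10 \<and> inj_on theta10 stab_DeltaY"
  by (simp add: lie_hom_on_def lie_algebra_stab_DeltaY lie_algebra_stab_tau theta10_stab_tau
      theta10_add theta10_scale theta10_ihara inj_on_theta10)

end
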